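(* Consider the lognormal model and its non-symmetric interior penalty DG discretization as described in the context, under all assumptions (L1)–(L5) listed there, with $\beta_j:=\|\psi_j\|_{L^\infty}$ and penalty parameter $$\eta(\boldsymbol y):=\frac{(\max_{\boldsymbol x\in\overline D}a_0(\boldsymbol x))^2}{\min_{\boldsymbol x\in\overline D}a_0(\boldsymbol x)}\exp\bigg(\sum_{j=1}^\infty3\beta_j|y_j|\bigg).$$ Then for all $\boldsymbol\nu\in\mathscr F$ with $0\ne|\boldsymbol\nu|_\infty\le1$ and almost every $\boldsymbol y\in U_{\boldsymbol\beta}$, $$\|\partial_{\boldsymbol y}^{\boldsymbol\nu}u_h(\cdot,\boldsymbol y)\|_{V_h}\le C_{\rm DG}^{|\boldsymbol\nu|}\,4^{|\boldsymbol\nu|}\,\frac{|\boldsymbol\nu|!}{(\log2)^{|\boldsymbol\nu|}}\,\boldsymbol\beta^{\boldsymbol\nu}\,\frac{\sigma}{\alpha\,a_{\min}(\boldsymbol y)^{1/2}}\,\|f\|_{L^2(D)},$$ where $\alpha=1$ and the constants $C_{\rm DG},\sigma>0$, independent of $\boldsymbol y$ and $h$, are those of the context.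
   Context: **Multi-indices.** $\mathscr F:=\{\boldsymbol\nu\in\mathbb N_0^{\mathbb N}:|{\rm supp}(\boldsymbol\nu)|<\infty\}$, ${\rm supp}(\boldsymbol\nu)=\{j:\nu_j\ne0\}$, $|\boldsymbol\nu|=\sum_j\nu_j$, $|\boldsymbol\nu|_\infty=\sup_j\nu_j$, $\boldsymbol\beta^{\boldsymbol\nu}=\prod_{j\in{\rm supp}(\boldsymbol\nu)}\beta_j^{\nu_j}$. **Lognormal model.** $D\subset\mathbb R^d$, $d\in\{1,2,3\}$, $f\in L^2(D)$, $\beta_j:=\|\psi_j\|_{L^\infty}$, $\boldsymbol\beta=(\beta_j)_{j\ge1}$, $U_{\boldsymbol\beta}:=\{\boldsymbol y\in\mathbb R^{\mathbb N}:\sum_{j\ge1}\beta_j|y_j|<\infty\}$, and $a(\boldsymbol x,\boldsymbol y):=a_0(\boldsymbol x)\exp\big(\sum_{j\ge1}y_j\psi_j(\boldsymbol x)\big)$ for $\boldsymbol x\in D$, $\boldsymbol y\in U_{\boldsymbol\beta}$, with real-valued $a_0,\psi_j$. "Almost every" is with respect to the product Gaussian measure $\bigotimes_{j\ge1}\mathcal N(0,1)$, for which $U_{\boldsymbol\beta}$ has full measure. Assumptions: (L1) $a_0\in L^\infty(D)$ and $\sum_{j\ge1}\|\psi_j\|_{L^\infty}<\infty$; (L2) $\min_{\overline D}a_0>0$ and $\max_{\overline D}a_0<\infty$; one defines $a_{\min}(\boldsymbol y):=(\min_{\overline D}a_0)\exp(-\sum_{j\ge1}|y_j|\beta_j)$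 and $a_{\max}(\boldsymbol y):=(\max_{\overline D}a_0)\exp(\sum_{j\ge1}|y_j|\beta_j)$; (L3) $\sum_{j\ge1}\|\psi_j\|_{L^\infty}^p<\infty$ for some $0<p<1$; (L4) $a_0\in W^{1,\infty}(D)$ and $\sum_{j\ge1}\|\psi_j\|_{W^{1,\infty}}<\infty$, where $\|v\|_{W^{1,\infty}}:=\max\{\|v\|_{L^\infty},\|\nabla v\|_{L^\infty}\}$; (L5) $D$ is a convex and bounded polyhedron. **Mesh and DG space.** $\mathcal T_h$ is a member of a shape- and contact-regular sequence of meshes of $D$ without hanging nodes: each $\mathcal T_h$ is a partition of $D$ into polyhedral elements admitting a matching simplicial submesh $\mathcal S_h$, and there are $\rho_1,\rho_2>0$ independent of $h$ such that every simplex $T'\in\mathcal S_h$ has inradius $\ge\rho_1\operatorname{diam}T'$, and $\rho_2\operatorname{diam}T\le\operatorname{diam}T'$ whenever $T'\subset T\in\mathcal T_h$. $\mathcal F$ is the set of all faces; $h_F$ is the diameter of the face $F$ (if $d=1$, $h_F$ is the minimum of the diameters of the elements adjacent to $F$). For a fixed polynomial degree $k\in\mathbb N$, $$V_h=\{v_h\in L^2(D): v_h|_T\in\mathcal P_k(T)\ \forall T\in\mathcal T_h\},$$ with $\mathcal P_k(T)$ the polynomials of total degree at most $k$. On a face shared by $T^+\ne T^-$, put $\{\![v]\!\}=\frac12(v|_{T^+}+v|_{T^-})$ (componentwise for vector fields) and $[\![v]\!]=v|_{T^+}\boldsymbol n_{T^+}+v|_{T^-}\boldsymbol n_{T^-}$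 with outward unit normals; on $F\subset\partial D\cap\partial T$ put $\{\![v]\!\}=v|_T$, $[\![v]\!]=v|_T\boldsymbol n$. **DG problem (NIPDG, $\theta=1$).** With $a=a(\cdot,\boldsymbol y)$, $$B_h(\boldsymbol y;w,v)=\sum_{T\in\mathcal T_h}\int_T a\nabla w\cdot\nabla v\,{\rm d}\boldsymbol x+\sum_{F\in\mathcal F}\int_F\Big[\{\![a\nabla v]\!\}\cdot[\![w]\!]-\{\![a\nabla w]\!\}\cdot[\![v]\!]+\tfrac{\eta(\boldsymbol y)}{h_F}[\![w]\!]\cdot[\![v]\!]\Big]{\rm d}\sigma.$$ $u_h(\cdot,\boldsymbol y)\in V_h$ is the solution of $B_h(\boldsymbol y;u_h(\cdot,\boldsymbol y),v_h)=\int_Dfv_h\,{\rm d}\boldsymbol x$ for all $v_h\in V_h$. The norms ($\boldsymbol y$-dependent) are $\|v_h\|_{V_h}^2=\sum_T\|\sqrt{a(\cdot,\boldsymbol y)}\nabla v_h\|_{L^2(T)}^2+\sum_F\frac{\eta(\boldsymbol y)}{h_F}\|[\![v_h]\!]\|_{L^2(F)}^2$ and $\|v_h\|_{V_h^\ast}^2=\|v_h\|_{V_h}^2+\sum_F\frac{h_F}{\eta(\boldsymbol y)}\|\{\![a(\cdot,\boldsymbol y)\nabla v_h]\!\}\|_{L^2(F)}^2$. **Constants.** $C_{\rm DG}:=C_{\rm equiv}^2$, where $C_{\rm equiv}$ is a constant independent of $\boldsymbol y$ and $h$ with $\|v_h\|_{V_h^\ast}\le C_{\rm equiv}\|v_h\|_{V_h}$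 for all $v_h\in V_h$ and all $\boldsymbol y\in U_{\boldsymbol\beta}$ (such a constant exists for this $\eta$). $\sigma>0$ is a constant independent of $h$ with $\|v_h\|_{L^2(D)}\le\sigma\big(\sum_T\|\nabla v_h\|_{L^2(T)}^2+\sum_F\frac1{h_F}\|[\![v_h]\!]\|_{L^2(F)}^2\big)^{1/2}$ for all $v_h\in V_h$. $\alpha=1$ is the coercivity constant of NIPDG: $B_h(\boldsymbol y;v_h,v_h)=\|v_h\|_{V_h}^2$. *)

theory Defs
  imports "HOL-Probability.Probability"
begin

section \<open>Lebesgue and Sobolev spaces\<close>

text \<open>Functions are not identified when they agree almost everywhere; all notions below are
  invariant under changes on null sets unless stated otherwise.\<close>

definition L2 :: "'a measure \<Rightarrow> ('a \<Rightarrow> real) set" where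
  "L2 M = {v \<in> borel_measurable M. integrable M (\<lambda>x. (v x)\<^sup>2)}"

definition L2norm :: "'a measure \<Rightarrow> ('a \<Rightarrow> 'b::real_normed_vector) \<Rightarrow> real" where
  "L2norm M g = sqrt (\<integral>x. (norm (g x))\<^sup>2 \<partial>M)"

definition Linf :: "('a::euclidean_space) set \<Rightarrow> ('a \<Rightarrow> 'b::euclidean_space) set" where
  "Linf D = {v \<in> borel_measurable (lebesgue_on D).
     esssup (lebesgue_on D) (\<lambda>x. ereal (norm (v x))) < \<infinity>}"

definition Linf_norm :: "('a::euclidean_space) set \<Rightarrow> ('a \<Rightarrow> 'b::euclidean_space) \<Rightarrow> real" where
  "Linf_norm D v = real_of_ereal (esssup (lebesgue_on D) (\<lambda>x. ereal (norm (v x))))"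

definition partial_x :: "'d::finite \<Rightarrow> (real^'d \<Rightarrow> real) \<Rightarrow> real^'d \<Rightarrow> real" where
  "partial_x i \<phi> x = frechet_derivative \<phi> (at x) (axis i 1)"

primrec Ck :: "nat \<Rightarrow> (real^'d::finite \<Rightarrow> real) \<Rightarrow> bool" where
  "Ck 0 \<phi> = continuous_on UNIV \<phi>"
| "Ck (Suc m) \<phi> = ((\<forall>x. \<phi> differentiable (at x)) \<and> (\<forall>i. Ck m (partial_x i \<phi>)))"

definition test_function :: "(real^'d::finite) set \<Rightarrow> (real^'d \<Rightarrow> real) \<Rightarrow> bool" where
  "test_function D \<phi> \<longleftrightarrow> (\<forall>m. Ck m \<phi>)
     \<and> compact (closure {x. \<phi> x \<noteq> 0}) \<and> closure {x. \<phi> x \<noteq> 0} \<subseteq> D"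

definition Linf_weak_gradient ::
    "(real^'d::finite) set \<Rightarrow> (real^'d \<Rightarrow> real) \<Rightarrow> (real^'d \<Rightarrow> real^'d) \<Rightarrow> bool" where
  "Linf_weak_gradient D v g \<longleftrightarrow> g \<in> Linf D \<and>
     (\<forall>\<phi> i. test_function D \<phi> \<longrightarrow>
        (\<integral>x. v x * partial_x i \<phi> x \<partial>lebesgue_on D) = - (\<integral>x. g x $ i * \<phi> x \<partial>lebesgue_on D))"

text \<open>For a bounded convex open \<open>D\<close>, every class in \<open>W\<^sup>1\<^sup>,\<^sup>\<infinity>(D)\<close> has exactly one representative that
  is continuous on the closure of \<open>D\<close>, up to its values outside that closure; this representative
  is what gives the class its values on element faces and its minimum and maximum over the closure.
  Membership below refers to this representative.\<close>

definition W1inf :: "(real^'d::finite) set \<Rightarrow> (real^'d \<Rightarrow> real) set" where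
  "W1inf D = {v \<in> Linf D. continuous_on (closure D) v \<and> (\<exists>g. Linf_weak_gradient D v g)}"

definition W1inf_norm :: "(real^'d::finite) set \<Rightarrow> (real^'d \<Rightarrow> real) \<Rightarrow> real" where
  "W1inf_norm D v = max (Linf_norm D v) (Linf_norm D (SOME g. Linf_weak_gradient D v g))"


section \<open>Multi-indices and parametric derivatives\<close>

text \<open>The index set of the parameters is \<open>nat\<close>, starting at \<open>0\<close>.\<close>

definition supp :: "(nat \<Rightarrow> nat) \<Rightarrow> nat set" where
  "supp \<nu> = {j. \<nu> j \<noteq> 0}"

definition multi_indices :: "(nat \<Rightarrow> nat) set" where
  "multi_indices = {\<nu>. finite (supp \<nu>)}"

definition mi_abs :: "(nat \<Rightarrow> nat) \<Rightarrow> nat" where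
  "mi_abs \<nu> = (\<Sum>j\<in>supp \<nu>. \<nu> j)"

definition mi_sup :: "(nat \<Rightarrow> nat) \<Rightarrow> nat" where
  "mi_sup \<nu> = (SUP j. \<nu> j)"

definition mi_power :: "(nat \<Rightarrow> real) \<Rightarrow> (nat \<Rightarrow> nat) \<Rightarrow> real" where
  "mi_power \<beta> \<nu> = (\<Prod>j\<in>supp \<nu>. \<beta> j ^ \<nu> j)"

text \<open>\<open>iter_partial D V u js y w\<close>: the iterated partial derivative of \<open>u : y \<mapsto> u(y) \<in> V\<close>, taken
  first in the last direction of the list \<open>js\<close> and last in its head, exists at \<open>y\<close> and equals
  \<open>w \<in> V\<close>. Difference quotients converge in \<open>L\<^sup>2(D)\<close>; for the finite-dimensional \<open>V = V\<^sub>h\<close> any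
  other norm gives the same derivative. Differentiating in direction \<open>j\<close> at \<open>y\<close> requires
  the previous derivative to exist only on the line through \<open>y\<close> in direction \<open>j\<close>, near \<open>y\<close>.\<close>

primrec iter_partial :: "('a::euclidean_space) set \<Rightarrow> ('a \<Rightarrow> real) set
    \<Rightarrow> ((nat \<Rightarrow> real) \<Rightarrow> 'a \<Rightarrow> real) \<Rightarrow> nat list \<Rightarrow> (nat \<Rightarrow> real) \<Rightarrow> ('a \<Rightarrow> real) \<Rightarrow> bool" where
  "iter_partial D V u [] y w \<longleftrightarrow> w \<in> V \<and> (AE x in lebesgue_on D. w x = u y x)"
| "iter_partial D V u (j # js) y w \<longleftrightarrow> w \<in> V \<and>
     (\<exists>g. (\<forall>\<^sub>F t in nhds 0. iter_partial D V u js (y(j := y j + t)) (g t)) \<and>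
          ((\<lambda>t. L2norm (lebesgue_on D) (\<lambda>x. (g t x - g 0 x) / t - w x)) \<longlongrightarrow> 0) (at 0))"

text \<open>\<open>w\<close> is the mixed derivative of multi-index \<open>\<nu>\<close>: the derivatives may be taken in any order.\<close>

definition mixed_partial :: "('a::euclidean_space) set \<Rightarrow> ('a \<Rightarrow> real) set
    \<Rightarrow> ((nat \<Rightarrow> real) \<Rightarrow> 'a \<Rightarrow> real) \<Rightarrow> (nat \<Rightarrow> nat) \<Rightarrow> (nat \<Rightarrow> real) \<Rightarrow> ('a \<Rightarrow> real) \<Rightarrow> bool" where
  "mixed_partial D V u \<nu> y w \<longleftrightarrow>
     (\<forall>js. (\<forall>j. count_list js j = \<nu> j) \<longrightarrow> iter_partial D V u js y w)"


section \<open>The lognormal coefficient\<close>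

definition beta :: "('a::euclidean_space) set \<Rightarrow> (nat \<Rightarrow> 'a \<Rightarrow> real) \<Rightarrow> nat \<Rightarrow> real" where
  "beta D \<psi> j = Linf_norm D (\<psi> j)"

definition U_beta :: "(nat \<Rightarrow> real) \<Rightarrow> (nat \<Rightarrow> real) set" where
  "U_beta \<beta> = {y. summable (\<lambda>j. \<beta> j * \<bar>y j\<bar>)}"

definition gauss_measure :: "(nat \<Rightarrow> real) measure" where
  "gauss_measure = (\<Pi>\<^sub>M j\<in>UNIV. density lborel (\<lambda>t. ennreal (std_normal_density t)))"

definition lognormal_coeff ::
    "('a \<Rightarrow> real) \<Rightarrow> (nat \<Rightarrow> 'a \<Rightarrow> real) \<Rightarrow> (nat \<Rightarrow> real) \<Rightarrow> 'a \<Rightarrow> real" where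
  "lognormal_coeff a0 \<psi> y x = a0 x * exp (\<Sum>j. y j * \<psi> j x)"

text \<open>For \<open>a0\<close> continuous on the compact closure, the next two are the minimum and maximum.\<close>

definition min_cl :: "('a::euclidean_space) set \<Rightarrow> ('a \<Rightarrow> real) \<Rightarrow> real" where
  "min_cl D a0 = (INF x\<in>closure D. a0 x)"

definition max_cl :: "('a::euclidean_space) set \<Rightarrow> ('a \<Rightarrow> real) \<Rightarrow> real" where
  "max_cl D a0 = (SUP x\<in>closure D. a0 x)"

definition a_min ::
    "('a::euclidean_space) set \<Rightarrow> ('a \<Rightarrow> real) \<Rightarrow> (nat \<Rightarrow> 'a \<Rightarrow> real) \<Rightarrow> (nat \<Rightarrow> real) \<Rightarrow> real" where
  "a_min D a0 \<psi> y = min_cl D a0 * exp (- (\<Sum>j. \<bar>y j\<bar> * beta D \<psi> j))"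

definition penalty ::
    "('a::euclidean_space) set \<Rightarrow> ('a \<Rightarrow> real) \<Rightarrow> (nat \<Rightarrow> 'a \<Rightarrow> real) \<Rightarrow> (nat \<Rightarrow> real) \<Rightarrow> real" where
  "penalty D a0 \<psi> y =
     (max_cl D a0)\<^sup>2 / min_cl D a0 * exp (\<Sum>j. 3 * beta D \<psi> j * \<bar>y j\<bar>)"


section \<open>Meshes\<close>

definition convex_polyhedral_domain :: "('a::euclidean_space) set \<Rightarrow> bool" where
  "convex_polyhedral_domain D \<longleftrightarrow> open D \<and> D \<noteq> {} \<and> convex D \<and> bounded D \<and> polytope (closure D)"

definition hyperplane :: "('a::euclidean_space) set \<Rightarrow> bool" where
  "hyperplane H \<longleftrightarrow> (\<exists>a b. a \<noteq> 0 \<and> H = {x. a \<bullet> x = b})"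

text \<open>Elements are closed sets, not necessarily convex. Their faces are the maximal connected flat
  pieces of codimension one of the boundary; for a convex element of full dimension these are
  the sets \<open>F\<close> with \<open>F facet_of T\<close>. In dimension one they are the singletons of the end points.\<close>

definition element_faces :: "('a::euclidean_space) set \<Rightarrow> 'a set set" where
  "element_faces T = {closure C |C H. hyperplane H \<and>
     C \<in> components ((top_of_set H) interior_of (frontier T \<inter> H))}"

definition is_outward_normal ::
    "('a::euclidean_space) set \<Rightarrow> 'a set \<Rightarrow> 'a \<Rightarrow> bool" where
  "is_outward_normal T F n \<longleftrightarrow> norm n = 1 \<and> (\<forall>x\<in>F. \<forall>z\<in>F. n \<bullet> (x - z) = 0) \<and>
     (\<forall>x\<in>rel_interior F. \<exists>\<epsilon>>0. \<forall>t\<in>{0<..<\<epsilon>}. x - t *\<^sub>R n \<in> T \<and> x + t *\<^sub>R n \<notin> T)"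

definition outward_normal :: "('a::euclidean_space) set \<Rightarrow> 'a set \<Rightarrow> 'a" where
  "outward_normal T F = (SOME n. is_outward_normal T F n)"

text \<open>The last condition says that the element lies locally on only one side of each face.\<close>

definition polyhedral_element :: "('a::euclidean_space) set \<Rightarrow> bool" where
  "polyhedral_element T \<longleftrightarrow> bounded T \<and> interior T \<noteq> {} \<and> connected (interior T)
     \<and> T = closure (interior T)
     \<and> (\<exists>\<H>. finite \<H> \<and> (\<forall>H\<in>\<H>. hyperplane H) \<and> frontier T \<subseteq> \<Union>\<H>)
     \<and> (\<forall>F\<in>element_faces T. \<exists>n. is_outward_normal T F n)"

text \<open>The last condition excludes hanging nodes: every interior face of an element is a whole face
  of a neighbouring element.\<close>

definition polyhedral_mesh :: "('a::euclidean_space) set \<Rightarrow> 'a set set \<Rightarrow> bool" where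
  "polyhedral_mesh D \<T> \<longleftrightarrow> finite \<T> \<and> (\<forall>T\<in>\<T>. polyhedral_element T) \<and> \<Union>\<T> = closure D
     \<and> (\<forall>T\<in>\<T>. \<forall>T'\<in>\<T>. T \<noteq> T' \<longrightarrow> interior T \<inter> interior T' = {})
     \<and> (\<forall>T\<in>\<T>. \<forall>F\<in>element_faces T.
          F \<subseteq> frontier D \<or> (\<exists>T'\<in>\<T>. T' \<noteq> T \<and> F \<in> element_faces T'))"

definition matching_simplicial_submesh ::
    "('a::euclidean_space) set \<Rightarrow> 'a set set \<Rightarrow> 'a set set \<Rightarrow> bool" where
  "matching_simplicial_submesh D \<T> \<S> \<longleftrightarrow> finite \<S> \<and> (\<forall>S\<in>\<S>. int DIM('a) simplex S)
     \<and> \<Union>\<S> = closure D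
     \<and> (\<forall>S\<in>\<S>. \<forall>S'\<in>\<S>. (S \<inter> S') face_of S)
     \<and> (\<forall>S\<in>\<S>. \<exists>T\<in>\<T>. S \<subseteq> T)"

definition inradius :: "('a::euclidean_space) set \<Rightarrow> real" where
  "inradius S = Sup {r. 0 \<le> r \<and> (\<exists>c. cball c r \<subseteq> S)}"

definition regular_mesh_sequence ::
    "('a::euclidean_space) set \<Rightarrow> (nat \<Rightarrow> 'a set set) \<Rightarrow> bool" where
  "regular_mesh_sequence D \<T> \<longleftrightarrow> (\<exists>\<rho>\<^sub>1>0. \<exists>\<rho>\<^sub>2>0. \<forall>m. polyhedral_mesh D (\<T> m) \<and>
     (\<exists>\<S>. matching_simplicial_submesh D (\<T> m) \<S> \<and>
        (\<forall>S\<in>\<S>. \<rho>\<^sub>1 * diameter S \<le> inradius S) \<and>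
        (\<forall>S\<in>\<S>. \<forall>T\<in>\<T> m. S \<subseteq> T \<longrightarrow> \<rho>\<^sub>2 * diameter T \<le> diameter S)))"

definition faces :: "('a::euclidean_space) set set \<Rightarrow> 'a set set" where
  "faces \<T> = (\<Union>T\<in>\<T>. element_faces T)"

definition adjacent :: "('a::euclidean_space) set set \<Rightarrow> 'a set \<Rightarrow> 'a set set" where
  "adjacent \<T> F = {T\<in>\<T>. F \<in> element_faces T}"

definition h_face :: "('a::euclidean_space) set set \<Rightarrow> 'a set \<Rightarrow> real" where
  "h_face \<T> F = (if DIM('a) = 1 then Min (diameter ` adjacent \<T> F) else diameter F)"

text \<open>Surface measure on a set \<open>F\<close> in a hyperplane with unit normal \<open>n\<close>: the measure of \<open>A \<subseteq> F\<close> is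
  the Lebesgue measure of the right prism of height one over \<open>A\<close>. In dimension one this is the
  unit point mass. It is a measure on the space \<open>F\<close>, since the coefficient need
  not be measurable outside the closure of the domain.\<close>

definition face_measure :: "('a::euclidean_space) set \<Rightarrow> 'a measure" where
  "face_measure F =
     (let n = (SOME n. norm n = 1 \<and> (\<forall>x\<in>F. \<forall>z\<in>F. n \<bullet> (x - z) = 0));
          p = (SOME p. p \<in> F)
      in distr (restrict_space lborel {x + t *\<^sub>R n |x t. x \<in> F \<and> t \<in> {0..1}})
           (restrict_space borel F) (\<lambda>z. z - (n \<bullet> (z - p)) *\<^sub>R n))"


section \<open>Discontinuous Galerkin discretization\<close>

definition polys :: "nat \<Rightarrow> (real^'d::finite \<Rightarrow> real) set" where
  "polys k = {q. \<exists>c. q = (\<lambda>x. \<Sum>\<alpha>::'d \<Rightarrow> nat | sum \<alpha> UNIV \<le> k. c \<alpha> * (\<Prod>i\<in>UNIV. x $ i ^ \<alpha> i))}"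

definition dg_space ::
    "(real^'d::finite) set \<Rightarrow> (real^'d) set set \<Rightarrow> nat \<Rightarrow> (real^'d \<Rightarrow> real) set" where
  "dg_space D \<T> k = {v \<in> L2 (lebesgue_on D).
     \<forall>T\<in>\<T>. \<exists>q\<in>polys k. AE x in lebesgue_on T. v x = q x}"

text \<open>The polynomial that \<open>v\<close> coincides with on \<open>T\<close>, unique as \<open>T\<close> has non-empty interior. Its values
  on the boundary of \<open>T\<close> are the traces of \<open>v\<close> from within \<open>T\<close>.\<close>

definition poly_on ::
    "nat \<Rightarrow> (real^'d::finite \<Rightarrow> real) \<Rightarrow> (real^'d) set \<Rightarrow> real^'d \<Rightarrow> real" where
  "poly_on k v T = (SOME q. q \<in> polys k \<and> (AE x in lebesgue_on T. v x = q x))"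

definition grad :: "('a::euclidean_space \<Rightarrow> real) \<Rightarrow> 'a \<Rightarrow> 'a" where
  "grad q x = (THE g. GDERIV q x :> g)"

text \<open>Averages and jumps take an elementwise family \<open>g\<close>, where \<open>g T\<close> is the branch on \<open>T\<close>. Two
  elements are adjacent to an interior face and one to a boundary face, so both cases of
  the usual definitions are covered.\<close>

definition average :: "('a::euclidean_space) set set \<Rightarrow> 'a set \<Rightarrow> ('a set \<Rightarrow> 'a \<Rightarrow> 'b::real_vector)
    \<Rightarrow> 'a \<Rightarrow> 'b" where
  "average \<T> F g x = (1 / real (card (adjacent \<T> F))) *\<^sub>R (\<Sum>T\<in>adjacent \<T> F. g T x)"

definition jump :: "('a::euclidean_space) set set \<Rightarrow> 'a set \<Rightarrow> ('a set \<Rightarrow> 'a \<Rightarrow> real)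
    \<Rightarrow> 'a \<Rightarrow> 'a" where
  "jump \<T> F g x = (\<Sum>T\<in>adjacent \<T> F. g T x *\<^sub>R outward_normal T F)"

definition flux :: "nat \<Rightarrow> (real^'d::finite \<Rightarrow> real) \<Rightarrow> (real^'d \<Rightarrow> real)
    \<Rightarrow> (real^'d) set \<Rightarrow> real^'d \<Rightarrow> real^'d" where
  "flux k a v T x = a x *\<^sub>R grad (poly_on k v T) x"

definition nipdg_form :: "(real^'d::finite) set set \<Rightarrow> nat \<Rightarrow> (real^'d \<Rightarrow> real) \<Rightarrow> real
    \<Rightarrow> (real^'d \<Rightarrow> real) \<Rightarrow> (real^'d \<Rightarrow> real) \<Rightarrow> real" where
  "nipdg_form \<T> k a \<eta> w v =
     (\<Sum>T\<in>\<T>. \<integral>x. flux k a w T x \<bullet> grad (poly_on k v T) x \<partial>lebesgue_on T) +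
     (\<Sum>F\<in>faces \<T>. \<integral>x.
          (average \<T> F (flux k a v) x \<bullet> jump \<T> F (poly_on k w) x
         - average \<T> F (flux k a w) x \<bullet> jump \<T> F (poly_on k v) x
         + \<eta> / h_face \<T> F * (jump \<T> F (poly_on k w) x \<bullet> jump \<T> F (poly_on k v) x))
        \<partial>face_measure F)"

definition dg_norm :: "(real^'d::finite) set set \<Rightarrow> nat \<Rightarrow> (real^'d \<Rightarrow> real) \<Rightarrow> real
    \<Rightarrow> (real^'d \<Rightarrow> real) \<Rightarrow> real" where
  "dg_norm \<T> k a \<eta> v = sqrt (
     (\<Sum>T\<in>\<T>. (L2norm (lebesgue_on T) (\<lambda>x. sqrt (a x) *\<^sub>R grad (poly_on k v T) x))\<^sup>2) +
     (\<Sum>F\<in>faces \<T>. \<eta> / h_face \<T> F * (L2norm (face_measure F) (jump \<T> F (poly_on k v)))\<^sup>2))"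

definition dg_norm_star :: "(real^'d::finite) set set \<Rightarrow> nat \<Rightarrow> (real^'d \<Rightarrow> real) \<Rightarrow> real
    \<Rightarrow> (real^'d \<Rightarrow> real) \<Rightarrow> real" where
  "dg_norm_star \<T> k a \<eta> v = sqrt ((dg_norm \<T> k a \<eta> v)\<^sup>2 +
     (\<Sum>F\<in>faces \<T>. h_face \<T> F / \<eta> * (L2norm (face_measure F) (average \<T> F (flux k a v)))\<^sup>2))"

definition broken_norm :: "(real^'d::finite) set set \<Rightarrow> nat \<Rightarrow> (real^'d \<Rightarrow> real) \<Rightarrow> real" where
  "broken_norm \<T> k v = sqrt (
     (\<Sum>T\<in>\<T>. (L2norm (lebesgue_on T) (grad (poly_on k v T)))\<^sup>2) +
     (\<Sum>F\<in>faces \<T>. 1 / h_face \<T> F * (L2norm (face_measure F) (jump \<T> F (poly_on k v)))\<^sup>2))"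

definition dg_solution :: "(real^'d::finite) set \<Rightarrow> (real^'d) set set \<Rightarrow> nat \<Rightarrow> (real^'d \<Rightarrow> real) \<Rightarrow> real
    \<Rightarrow> (real^'d \<Rightarrow> real) \<Rightarrow> (real^'d \<Rightarrow> real) \<Rightarrow> bool" where
  "dg_solution D \<T> k a \<eta> f w \<longleftrightarrow> w \<in> dg_space D \<T> k \<and>
     (\<forall>v\<in>dg_space D \<T> k. nipdg_form \<T> k a \<eta> w v = (\<integral>x. f x * v x \<partial>lebesgue_on D))"

end

theory Submission
  imports Defs "HOL-Library.Function_Algebras"
begin

text \<open>Differentiating the discrete problem in the directions of a nonempty set \<open>S\<close> gives
  \<open>\<Sum>\<^bsub>R \<subseteq> S\<^esub> B\<^sub>R(y; \<partial>\<^bsup>S - R\<^esup> u, v) = 0\<close>, where \<open>B\<^sub>R\<close> is the same form with coefficient \<open>\<psi>\<^sup>R a\<close> and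
  penalty \<open>\<Prod>\<^bsub>j \<in> R\<^esub> (3 \<beta>\<^sub>j sgn y\<^sub>j) \<eta>\<close>. For nonempty \<open>R\<close> the form \<open>B\<^sub>R\<close> is bounded in the starred norm
  by \<open>(1 + 3\<^bsup>|R|\<^esup>) \<beta>\<^sup>R \<le> 4\<^bsup>|R|\<^esup> \<beta>\<^sup>R\<close>, and coercivity turns the recursion into one for the ordered Bell
  numbers, which are at most \<open>n! / (ln 2)\<^sup>n\<close>. Conversely, coercivity makes this recursion solvable for
  every \<open>S\<close>, and its solutions are the derivatives because their difference quotients satisfy the same
  equations up to a small remainder. The penalty is differentiable in \<open>y\<^sub>j\<close> only off \<open>y\<^sub>j = 0\<close>, which
  excludes a null set for the finitely many \<open>j\<close> involved.\<close>

section \<open>Coercive forms and ordered Bell numbers\<close>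

text \<open>The discrete space consists of functions, not of classes modulo null sets, so the energy
  norm is only a seminorm and discrete solutions are not unique. Derivatives are therefore picked by
  choice, solvability comes from a finite set that spans up to norm zero, and every estimate is
  insensitive to vectors of norm zero. The norm also moves with \<open>y\<close>: remainders are
  measured in the norm at the base point throughout, and coercivity near that point is recovered
  from the Lipschitz dependence of the form.

  The 3 is the rate in the exponent of the penalty, and \<open>sgn\<close> comes from
  differentiating an absolute value. Leaving the starred norm costs \<open>C\<^sub>e\<close> in each
  argument of a form, which gives \<open>C\<^sub>D\<^sub>G\<close>. Unrolling the recursion peels
  off one nonempty block at a time, so it counts ordered partitions; their exponential generating
  function 1/(2 - exp x) has its pole at ln 2. As no direction is repeated, a multi-index is a
  finite set, and a recursion over sets makes the derivatives independent of the order of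
  differentiation.\<close>

definition lin_on :: "'a::real_vector set \<Rightarrow> ('a \<Rightarrow> real) \<Rightarrow> bool" where
  "lin_on V l \<longleftrightarrow> (\<forall>c d. \<forall>v\<in>V. \<forall>w\<in>V. l (c *\<^sub>R v + d *\<^sub>R w) = c * l v + d * l w)"

lemma lin_onD:
  "lin_on V l \<Longrightarrow> v \<in> V \<Longrightarrow> w \<in> V \<Longrightarrow> l (c *\<^sub>R v + d *\<^sub>R w) = c * l v + d * l w"
  by (simp add: lin_on_def)

lemma lin_on_add: "lin_on V l \<Longrightarrow> v \<in> V \<Longrightarrow> w \<in> V \<Longrightarrow> l (v + w) = l v + l w"
  using lin_onD[of V l v w 1 1] by simp

lemma lin_on_diff: "lin_on V l \<Longrightarrow> v \<in> V \<Longrightarrow> w \<in> V \<Longrightarrow> l (v - w) = l v - l w"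
  using lin_onD[of V l v w 1 "-1"] by simp

lemma lin_on_scale: "lin_on V l \<Longrightarrow> v \<in> V \<Longrightarrow> l (c *\<^sub>R v) = c * l v"
  using lin_onD[of V l v v c 0] by simp

lemma lin_on_sum:
  assumes "\<And>i. i \<in> I \<Longrightarrow> lin_on V (l i)"
  shows "lin_on V (\<lambda>v. \<Sum>i\<in>I. l i v)"
  unfolding lin_on_def
proof (intro allI ballI)
  fix c d v w assume "v \<in> V" "w \<in> V"
  then have "(\<Sum>i\<in>I. l i (c *\<^sub>R v + d *\<^sub>R w)) = (\<Sum>i\<in>I. c * l i v + d * l i w)"
    by (intro sum.cong refl lin_onD[OF assms]) auto
  then show "(\<Sum>i\<in>I. l i (c *\<^sub>R v + d *\<^sub>R w)) = c * (\<Sum>i\<in>I. l i v) + d * (\<Sum>i\<in>I. l i w)"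
    by (simp add: sum.distrib sum_distrib_left)
qed

lemma lin_on_uminus: "lin_on V l \<Longrightarrow> lin_on V (\<lambda>v. - l v)"
  by (simp add: lin_on_def)

lemma lin_on_eq_span:
  assumes V: "subspace V" and "lin_on V l" "lin_on V l'" and S: "S \<subseteq> V"
    and eq: "\<And>v. v \<in> S \<Longrightarrow> l v = l' v" and w: "w \<in> span S"
  shows "l w = l' w"
proof -
  have "subspace {v \<in> V. l v = l' v}"
    using V assms(2,3) lin_on_add[of V l] lin_on_add[of V l'] lin_on_scale[of V l] lin_on_scale[of V l']
      lin_on_scale[of V l 0 0] lin_on_scale[of V l' 0 0]
    unfolding subspace_def by auto
  then have "span S \<subseteq> {v \<in> V. l v = l' v}"
    using S eq by (intro span_minimal) auto
  with w show ?thesis by auto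
qed

text \<open>The seminorm may vanish on nonzero vectors; boundedness of \<open>b\<close> and \<open>l\<close> makes the right-hand
  side compatible with its null space.\<close>

lemma coercive_solvable:
  fixes b :: "'a::real_vector \<Rightarrow> 'a \<Rightarrow> real"
  assumes V: "subspace V"
    and b1: "\<And>v. v \<in> V \<Longrightarrow> lin_on V (\<lambda>w. b w v)"
    and b2: "\<And>w. w \<in> V \<Longrightarrow> lin_on V (b w)"
    and bdd: "\<And>w v. w \<in> V \<Longrightarrow> v \<in> V \<Longrightarrow> \<bar>b w v\<bar> \<le> C * n w * n v"
    and coer: "\<And>v. v \<in> V \<Longrightarrow> b v v = (n v)\<^sup>2"
    and S: "finite S" "S \<subseteq> V"
    and l: "lin_on V l" "\<And>v. v \<in> V \<Longrightarrow> \<bar>l v\<bar> \<le> C' * n v"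
  shows "\<exists>w\<in>span S. \<forall>v\<in>S. b w v = l v"
  using S l
proof (induction S arbitrary: l C' rule: finite_induct)
  case empty
  then show ?case using span_zero by blast
next
  case (insert x S)
  have SV: "S \<subseteq> V" "x \<in> V" and spV: "span S \<subseteq> V"
    using insert.prems(1) V by (auto intro: span_minimal[THEN subsetD])
  have sp: "w \<in> span (insert x S)" if "w \<in> span S" for w
    using that span_mono[of S "insert x S"] by auto
  obtain w1 where w1: "w1 \<in> span S" "\<And>v. v \<in> S \<Longrightarrow> b w1 v = b x v"
    using insert.IH[OF SV(1) b2[OF SV(2)], of "C * n x"] bdd SV(2) by auto
  obtain w2 where w2: "w2 \<in> span S" "\<And>v. v \<in> S \<Longrightarrow> b w2 v = l v"
    using insert.IH[OF SV(1) insert.prems(2,3)] by auto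
  \<comment> \<open>Gram-Schmidt step for a nonsymmetric form: \<open>b z\<close> vanishes on
    \<open>span S\<close>, whereas \<open>b v z\<close> for \<open>v\<close> in
    \<open>span S\<close> may not. The solution is therefore corrected by a multiple of
    \<open>z\<close>.\<close>
  define z where "z = x - w1"
  have zV: "z \<in> V" using SV(2) w1(1) spV V by (auto simp: z_def subspace_diff)
  have w12V: "w1 \<in> V" "w2 \<in> V" using w1(1) w2(1) spV by auto
  have zS: "b z v = 0" if "v \<in> span S" for v
  proof (rule lin_on_eq_span[OF V b2[OF zV] _ SV(1) _ that])
    show "lin_on V (\<lambda>_. 0)" by (simp add: lin_on_def)
    show "b z v = 0" if "v \<in> S" for v
      using that w1(2)[OF that] SV lin_on_diff[OF b1 SV(2) w12V(1)] by (auto simp: z_def)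
  qed
  have x: "x = z + w1" by (simp add: z_def)
  have zsp: "z \<in> span (insert x S)"
    unfolding z_def by (intro span_diff sp w1 span_base) simp
  show ?case
  proof (cases "n z = 0")
    case True
    \<comment> \<open>Boundedness kills both \<open>b w2 z\<close> and \<open>l z\<close>, so the
      solution on \<open>span S\<close> already satisfies the new equation.\<close>
    have "b w2 x = b w2 z + b w2 w1"
      using lin_on_add[OF b2[OF w12V(2)] zV w12V(1)] x by simp
    also have "b w2 z = 0" using bdd[OF w12V(2) zV] True by simp
    also have "b w2 w1 = l w1"
      by (rule lin_on_eq_span[OF V b2[OF w12V(2)] insert.prems(2) SV(1) w2(2) w1(1)])
    also have "0 + l w1 = l z + l w1" using insert.prems(3)[OF zV] True by simp
    also have "\<dots> = l x" using lin_on_add[OF insert.prems(2) zV w12V(1)] x by simp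
    finally show ?thesis using w2 sp by (intro bexI[of _ w2]) auto
  next
    case False
    \<comment> \<open>Adding a multiple of \<open>z\<close> leaves the equations for
      \<open>S\<close> intact; at \<open>x\<close> it acts through
      \<open>b z x = b z z = (n z)\<^sup>2\<close>.\<close>
    define c where "c = (l x - b w2 x) / (n z)\<^sup>2"
    have "b z x = (n z)\<^sup>2"
      using lin_on_add[OF b2[OF zV] zV w12V(1)] zS[OF w1(1)] coer[OF zV] x by simp
    then have "b (w2 + c *\<^sub>R z) x = l x"
      using lin_onD[OF b1[OF SV(2)] w12V(2) zV, of 1 c] False by (simp add: c_def)
    moreover have "b (w2 + c *\<^sub>R z) v = l v" if "v \<in> S" for v
      using lin_onD[OF b1[of v] w12V(2) zV, of 1 c] that SV w2(2)[OF that] zS[OF span_base[OF that]]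
      by auto
    ultimately show ?thesis
      using w2 sp zsp by (intro bexI[of _ "w2 + c *\<^sub>R z"]) (auto intro!: span_add span_scale)
  qed
qed

section \<open>Sums over the subsets of a finite set\<close>

lemma sum_Pow_insert:
  assumes "finite S" "j \<notin> S"
  shows "(\<Sum>R\<in>Pow (insert j S). f R) = (\<Sum>R\<in>Pow S. f R + f (insert j R))"
proof -
  have "(\<Sum>R\<in>Pow (insert j S). f R) = (\<Sum>R\<in>Pow S. f R) + (\<Sum>R\<in>insert j ` Pow S. f R)"
    unfolding Pow_insert by (rule sum.union_disjoint) (use assms in auto)
  also have "(\<Sum>R\<in>insert j ` Pow S. f R) = (\<Sum>R\<in>Pow S. f (insert j R))"
    by (subst sum.reindex) (use assms in \<open>auto simp: inj_on_def\<close>)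
  finally show ?thesis by (simp add: sum.distrib)
qed

lemma sum_Pow_card:
  fixes h :: "nat \<Rightarrow> real"
  assumes "finite S"
  shows "(\<Sum>R\<in>Pow S. h (card R)) = (\<Sum>i\<le>card S. real (card S choose i) * h i)"
proof -
  have "(\<Sum>R\<in>Pow S. h (card R)) = (\<Sum>i\<le>card S. \<Sum>R\<in>{R \<in> Pow S. card R = i}. h (card R))"
    by (rule sum.group[symmetric]) (use assms in \<open>auto simp: card_mono\<close>)
  also have "\<dots> = (\<Sum>i\<le>card S. real (card {R \<in> Pow S. card R = i}) * h i)"
    by (intro sum.cong refl) simp
  also have "\<dots> = (\<Sum>i\<le>card S. real (card S choose i) * h i)"
    using n_subsets[OF assms] by (intro sum.cong refl) (simp add: Pow_def)
  finally show ?thesis .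
qed

text \<open>The right-hand side dominates the ordered Bell numbers; the recursion closes because
  \<open>\<Sum>\<^sub>i (ln 2)\<^sup>i / i! = 2\<close>.\<close>

lemma sum_Pow_fact_ln2_le:
  assumes "finite S"
  shows "(\<Sum>R\<in>Pow S - {{}}. fact (card (S - R)) / ln 2 ^ card (S - R))
    \<le> (fact (card S) / ln 2 ^ card S :: real)"
proof -
  let ?n = "card S"
  let ?h = "\<lambda>i. fact (?n - i) / ln 2 ^ (?n - i) :: real"
  have ln2: "(0::real) < ln 2" by simp
  have c: "card (S - R) = ?n - card R" if "R \<in> Pow S" for R
    using that assms by (auto simp: card_Diff_subset finite_subset)
  have "(\<Sum>R\<in>Pow S. fact (card (S - R)) / ln 2 ^ card (S - R)) = (\<Sum>R\<in>Pow S. ?h (card R))"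
    using c by (intro sum.cong) auto
  also have "\<dots> = (\<Sum>i\<le>?n. real (?n choose i) * ?h i)" by (rule sum_Pow_card[OF assms])
  also have "\<dots> = (\<Sum>i\<le>?n. fact ?n / ln 2 ^ ?n * (ln 2 ^ i /\<^sub>R fact i))"
  proof (intro sum.cong refl)
    fix i assume "i \<in> {..?n}"
    then have i: "i \<le> ?n" by simp
    have "real (?n choose i) = fact ?n / (fact i * fact (?n - i))"
      using i by (rule binomial_fact)
    moreover have "ln 2 ^ ?n = (ln 2 ^ i * ln 2 ^ (?n - i) :: real)"
      using i by (simp flip: power_add)
    ultimately show "real (?n choose i) * ?h i = fact ?n / ln 2 ^ ?n * (ln 2 ^ i /\<^sub>R fact i)"
      using ln2 by (simp add: field_simps)
  qed
  also have "\<dots> = fact ?n / ln 2 ^ ?n * (\<Sum>i\<le>?n. ln 2 ^ i /\<^sub>R fact i)"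
    by (simp add: sum_distrib_left)
  also have "\<dots> \<le> fact ?n / ln 2 ^ ?n * exp (ln 2)"
  proof (rule mult_left_mono)
    have "(\<Sum>i\<le>?n. ln 2 ^ i /\<^sub>R fact i) \<le> (\<Sum>i. ln 2 ^ i /\<^sub>R fact i :: real)"
      by (rule sum_le_suminf) (use summable_exp_generic[of "ln 2 :: real"] in auto)
    then show "(\<Sum>i\<le>?n. ln 2 ^ i /\<^sub>R fact i) \<le> exp (ln 2 :: real)" by (simp add: exp_def)
  qed simp
  also have "\<dots> = 2 * (fact ?n / ln 2 ^ ?n)" by simp
  finally have "(\<Sum>R\<in>Pow S. fact (card (S - R)) / ln 2 ^ card (S - R)) \<le> 2 * (fact ?n / ln 2 ^ ?n :: real)" .
  \<comment> \<open>The term of the empty set equals the bound itself; taking it away from the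
    factor 2 leaves one copy for the nonempty \<open>R\<close>.\<close>
  moreover have "(\<Sum>R\<in>Pow S. fact (card (S - R)) / ln 2 ^ card (S - R) :: real)
      = fact ?n / ln 2 ^ ?n + (\<Sum>R\<in>Pow S - {{}}. fact (card (S - R)) / ln 2 ^ card (S - R))"
    by (subst sum.remove[of _ "{}"]) (use assms in auto)
  ultimately show ?thesis by simp
qed

section \<open>The abstract parametric problem\<close>

text \<open>Each \<open>B R y\<close> plays the role of the derivative, in the
  directions \<open>R\<close>, of the form \<open>B {} y\<close>; the penalty depends on \<open>\<bar>y j\<bar>\<close>, so the
  remainder estimate is only required where \<open>y j \<noteq> 0\<close>.\<close>

locale parametric_form =
  fixes V :: "'a::real_vector set" and U :: "(nat \<Rightarrow> real) set"
    and N :: "(nat \<Rightarrow> real) \<Rightarrow> 'a \<Rightarrow> real"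
    and B :: "nat set \<Rightarrow> (nat \<Rightarrow> real) \<Rightarrow> 'a \<Rightarrow> 'a \<Rightarrow> real"
    and u :: "(nat \<Rightarrow> real) \<Rightarrow> 'a" and l :: "'a \<Rightarrow> real"
    and K :: "nat set \<Rightarrow> real" and bs :: "'a set"
  assumes V: "subspace V"
    and B1: "\<And>R y v. y \<in> U \<Longrightarrow> finite R \<Longrightarrow> v \<in> V \<Longrightarrow> lin_on V (\<lambda>w. B R y w v)"
    and B2: "\<And>R y w. y \<in> U \<Longrightarrow> finite R \<Longrightarrow> w \<in> V \<Longrightarrow> lin_on V (B R y w)"
    and N_nonneg: "\<And>y v. 0 \<le> N y v"
    and coercive: "\<And>y v. y \<in> U \<Longrightarrow> v \<in> V \<Longrightarrow> B {} y v v = (N y v)\<^sup>2"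
    and bounded: "\<And>R y w v. y \<in> U \<Longrightarrow> finite R \<Longrightarrow> w \<in> V \<Longrightarrow> v \<in> V
      \<Longrightarrow> \<bar>B R y w v\<bar> \<le> K R * N y w * N y v"
    and basis: "finite bs" "bs \<subseteq> V"
      "\<And>y v. y \<in> U \<Longrightarrow> v \<in> V \<Longrightarrow> \<exists>w\<in>span bs. N y (v - w) = 0"
    and U_upd: "\<And>y j t. y \<in> U \<Longrightarrow> y(j := t) \<in> U"
    and remainder: "\<And>R y j. y \<in> U \<Longrightarrow> y j \<noteq> 0 \<Longrightarrow> finite R \<Longrightarrow> j \<notin> R \<Longrightarrow>
      \<exists>L \<delta>. 0 < \<delta> \<and> (\<forall>t w v. \<bar>t\<bar> < \<delta> \<longrightarrow> w \<in> V \<longrightarrow> v \<in> V \<longrightarrow>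
        \<bar>B R (y(j := y j + t)) w v - B R y w v - t * B (insert j R) y w v\<bar> \<le> L * t\<^sup>2 * N y w * N y v)"
    and u: "\<And>y. y \<in> U \<Longrightarrow> u y \<in> V" "\<And>y v. y \<in> U \<Longrightarrow> v \<in> V \<Longrightarrow> B {} y (u y) v = l v"
begin

text \<open>Testing against the finite set \<open>bs\<close> suffices: any \<open>v\<close> differs
  from an element of \<open>span bs\<close> by a vector of norm zero, where both sides vanish by
  boundedness.\<close>

lemma solvable:
  assumes y: "y \<in> U" and r: "lin_on V r" "\<And>v. v \<in> V \<Longrightarrow> \<bar>r v\<bar> \<le> C * N y v"
  shows "\<exists>w\<in>V. \<forall>v\<in>V. B {} y w v = r v"
proof -
  have bd: "\<bar>B {} y w v\<bar> \<le> K {} * N y w * N y v" if "w \<in> V" "v \<in> V" for w v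
    using bounded[OF y _ that] by simp
  have sV: "span bs \<subseteq> V" by (rule span_minimal[OF basis(2) V])
  obtain w where w: "w \<in> span bs" "\<And>v. v \<in> bs \<Longrightarrow> B {} y w v = r v"
    using coercive_solvable[of V "B {} y" "K {}" "N y" bs r C, OF V B1[OF y] B2[OF y] bd coercive[OF y]
        basis(1,2) r] by auto
  have wV: "w \<in> V" using w(1) sV by auto
  have "B {} y w v = r v" if v: "v \<in> V" for v
  proof -
    obtain v' where v': "v' \<in> span bs" "N y (v - v') = 0" using basis(3)[OF y v] by auto
    have v'V: "v' \<in> V" using v' sV by auto
    have d: "v - v' \<in> V" by (rule subspace_diff[OF V v v'V])
    have "B {} y w (v - v') = 0" using bd[OF wV d] v'(2) by simp
    moreover have "r (v - v') = 0" using r(2)[OF d] v'(2) by simp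
    moreover have "B {} y w v' = r v'"
      by (rule lin_on_eq_span[OF V B2[OF y _ wV] r(1) basis(2) w(2) v'(1)]) auto
    ultimately show ?thesis
      using lin_on_diff[OF B2[OF y finite.emptyI wV] v v'V] lin_on_diff[OF r(1) v v'V] by simp
  qed
  with wV show ?thesis by auto
qed

text \<open>\<open>SOME\<close> picks among solutions that are determined only up to norm zero.
  Returning \<open>u y\<close> for infinite \<open>S\<close> lets the cardinality decrease in every
  recursive call.\<close>

function sol :: "(nat \<Rightarrow> real) \<Rightarrow> nat set \<Rightarrow> 'a" where
  "sol y S = (if finite S \<and> S \<noteq> {} then SOME w. w \<in> V \<and>
       (\<forall>v\<in>V. B {} y w v = - (\<Sum>R\<in>Pow S - {{}}. B R y (sol y (S - R)) v)) else u y)"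
  by pat_completeness auto
termination
  by (relation "Wellfounded.measure (\<lambda>(y, S). card S)") (auto intro!: psubset_card_mono)

declare sol.simps [simp del]

lemma sol_empty [simp]: "sol y {} = u y"
  by (simp add: sol.simps)

lemma sol_spec:
  assumes y: "y \<in> U" and S: "finite S"
  shows "sol y S \<in> V \<and> (S \<noteq> {} \<longrightarrow> (\<forall>v\<in>V.
      B {} y (sol y S) v = - (\<Sum>R\<in>Pow S - {{}}. B R y (sol y (S - R)) v)))"
  using S
proof (induction S rule: finite_psubset_induct)
  case (psubset S)
  show ?case
  proof (cases "S = {}")
    case True
    then show ?thesis using u(1)[OF y] by simp
  next
    case False
    let ?r = "\<lambda>v. - (\<Sum>R\<in>Pow S - {{}}. B R y (sol y (S - R)) v)"
    have fin: "finite R" if "R \<in> Pow S - {{}}" for R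
      using that psubset.hyps finite_subset by auto
    have inV: "sol y (S - R) \<in> V" if "R \<in> Pow S - {{}}" for R
      using psubset.IH[of "S - R"] that by auto
    have "lin_on V ?r"
      by (intro lin_on_uminus lin_on_sum B2[OF y] fin inV)
    moreover have "\<bar>?r v\<bar> \<le> (\<Sum>R\<in>Pow S - {{}}. K R * N y (sol y (S - R))) * N y v" if "v \<in> V" for v
      unfolding sum_distrib_right abs_minus_cancel
      by (intro order_trans[OF sum_abs] sum_mono bounded[OF y] fin inV that)
    ultimately have "\<exists>w. w \<in> V \<and> (\<forall>v\<in>V. B {} y w v = ?r v)"
      using solvable[OF y] by blast
    from someI_ex[OF this] show ?thesis
      using False psubset.hyps by (simp add: sol.simps[of y S])
  qed
qed

lemma sol_in: "y \<in> U \<Longrightarrow> finite S \<Longrightarrow> sol y S \<in> V"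
  using sol_spec by blast

lemma sol_step: "y \<in> U \<Longrightarrow> finite S \<Longrightarrow> S \<noteq> {} \<Longrightarrow> v \<in> V \<Longrightarrow>
    B {} y (sol y S) v = - (\<Sum>R\<in>Pow S - {{}}. B R y (sol y (S - R)) v)"
  using sol_spec by blast

text \<open>Moving the term of \<open>R = {}\<close> back gives the equations the form of a Leibniz
  rule. The right-hand side is free of \<open>y\<close>, so it cancels when two parameter points are
  subtracted, also for \<open>S = {}\<close>.\<close>

lemma sol_eq:
  assumes y: "y \<in> U" and S: "finite S" and v: "v \<in> V"
  shows "(\<Sum>R\<in>Pow S. B R y (sol y (S - R)) v) = (if S = {} then l v else 0)"
proof -
  have "(\<Sum>R\<in>Pow S. B R y (sol y (S - R)) v)
      = B {} y (sol y S) v + (\<Sum>R\<in>Pow S - {{}}. B R y (sol y (S - R)) v)"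
    by (subst sum.remove[of _ "{}"]) (use S in auto)
  then show ?thesis using sol_step[OF y S _ v] u(2)[OF y v] by auto
qed

text \<open>Homogeneity comes from coercivity and bilinearity: the square of \<open>N y\<close> is a
  quadratic form.\<close>

lemma N_scale: "y \<in> U \<Longrightarrow> v \<in> V \<Longrightarrow> N y (c *\<^sub>R v) = \<bar>c\<bar> * N y v"
proof -
  assume y: "y \<in> U" and v: "v \<in> V"
  have cv: "c *\<^sub>R v \<in> V" using V v by (rule subspace_scale)
  have "(N y (c *\<^sub>R v))\<^sup>2 = c * (c * (N y v)\<^sup>2)"
    using coercive[OF y cv] coercive[OF y v] lin_on_scale[OF B1[OF y finite.emptyI cv] v]
      lin_on_scale[OF B2[OF y finite.emptyI v] v] by simp
  also have "\<dots> = (\<bar>c\<bar> * N y v)\<^sup>2" by (simp add: power_mult_distrib power2_eq_square)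
  finally have "(N y (c *\<^sub>R v))\<^sup>2 = (\<bar>c\<bar> * N y v)\<^sup>2" .
  then show ?thesis by (metis N_nonneg abs_ge_zero mult_nonneg_nonneg power2_eq_iff_nonneg)
qed

text \<open>Testing the equation for \<open>sol y S\<close> with \<open>sol y S\<close> and
  cancelling one factor of its norm gives a recursion over nonempty \<open>R\<close>, which
  \<open>sum_Pow_fact_ln2_le\<close> closes.\<close>

lemma sol_bound:
  assumes y: "y \<in> U" and S: "finite S" and c: "1 \<le> c" and \<beta>: "\<And>j. 0 \<le> \<beta> j"
    and K: "\<And>R. finite R \<Longrightarrow> R \<noteq> {} \<Longrightarrow> K R \<le> c * (\<Prod>j\<in>R. 4 * \<beta> j)"
    and M: "N y (u y) \<le> M"
  shows "N y (sol y S) \<le> c ^ card S * (\<Prod>j\<in>S. 4 * \<beta> j) * (fact (card S) / ln 2 ^ card S) * M"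
  using S
proof (induction S rule: finite_psubset_induct)
  case (psubset S)
  show ?case
  proof (cases "S = {}")
    case True
    then show ?thesis using M by simp
  next
    case False
    let ?p = "\<lambda>S. \<Prod>j\<in>S. 4 * \<beta> j" and ?g = "\<lambda>R. fact (card (S - R)) / ln 2 ^ card (S - R) :: real"
    let ?w = "sol y S"
    have wV: "?w \<in> V" by (rule sol_in[OF y psubset.hyps])
    have M0: "0 \<le> M" using N_nonneg[of y "u y"] M by linarith
    have p0: "0 \<le> ?p R" for R using \<beta> by (intro prod_nonneg) auto
    have *: "K R * N y (sol y (S - R)) \<le> c ^ card S * ?p S * M * ?g R" if R: "R \<in> Pow S - {{}}" for R
    proof -
      have fR: "finite R" using R psubset.hyps finite_subset by auto
      have card: "card S = card R + card (S - R)"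
        using R psubset.hyps fR by (auto simp: card_Diff_subset card_mono)
      have R1: "1 \<le> card R" using R fR by (simp add: Suc_le_eq card_gt_0_iff)
      have "K R * N y (sol y (S - R)) \<le> (c * ?p R) * (c ^ card (S - R) * ?p (S - R) * ?g R * M)"
      proof (rule mult_mono)
        show "K R \<le> c * ?p R" using K fR R by auto
        show "N y (sol y (S - R)) \<le> c ^ card (S - R) * ?p (S - R) * ?g R * M"
          using psubset.IH[of "S - R"] R by auto
      qed (use c p0 N_nonneg in auto)
      also have "\<dots> = (c * c ^ card (S - R)) * (?p R * ?p (S - R)) * ?g R * M" by (simp add: mult_ac)
      also have "?p R * ?p (S - R) = ?p S"
        using R psubset.hyps by (subst prod.subset_diff[of R S]) auto
      \<comment> \<open>The block \<open>R\<close> costs a single factor \<open>c\<close>. As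
        \<open>R\<close> is nonempty and \<open>c\<close> is at least 1, one factor per element of
        \<open>R\<close> may be allowed instead.\<close>
      also have "(c * c ^ card (S - R)) * ?p S * ?g R * M \<le> c ^ card S * ?p S * ?g R * M"
      proof (intro mult_right_mono)
        have "c ^ Suc (card (S - R)) \<le> c ^ card S"
          using c card R1 by (intro power_increasing) auto
        then show "c * c ^ card (S - R) \<le> c ^ card S" by simp
      qed (use p0 M0 in auto)
      finally show ?thesis by (simp add: mult_ac)
    qed
    have "(N y ?w)\<^sup>2 = B {} y ?w ?w" using coercive[OF y wV] by simp
    also have "\<dots> = - (\<Sum>R\<in>Pow S - {{}}. B R y (sol y (S - R)) ?w)"
      by (rule sol_step[OF y psubset.hyps False wV])
    also have "\<dots> \<le> \<bar>\<Sum>R\<in>Pow S - {{}}. B R y (sol y (S - R)) ?w\<bar>" by linarith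
    also have "\<dots> \<le> (\<Sum>R\<in>Pow S - {{}}. K R * N y (sol y (S - R)) * N y ?w)"
      using psubset.hyps
      by (intro order_trans[OF sum_abs] sum_mono bounded[OF y] sol_in[OF y] wV) (auto dest: finite_subset)
    also have "\<dots> \<le> (\<Sum>R\<in>Pow S - {{}}. c ^ card S * ?p S * M * ?g R * N y ?w)"
      by (intro sum_mono mult_right_mono * N_nonneg)
    also have "\<dots> = c ^ card S * ?p S * M * (\<Sum>R\<in>Pow S - {{}}. ?g R) * N y ?w"
      by (simp add: sum_distrib_left sum_distrib_right)
    also have "\<dots> \<le> c ^ card S * ?p S * M * (fact (card S) / ln 2 ^ card S) * N y ?w"
      using c p0 M0 N_nonneg
      by (intro mult_right_mono mult_left_mono sum_Pow_fact_ln2_le psubset.hyps) auto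
    finally have "N y ?w * N y ?w \<le> (c ^ card S * ?p S * M * (fact (card S) / ln 2 ^ card S)) * N y ?w"
      by (simp add: power2_eq_square)
    moreover have "0 \<le> c ^ card S * ?p S * M * (fact (card S) / ln 2 ^ card S)"
      using c p0 M0 by auto
    ultimately have "N y ?w \<le> c ^ card S * ?p S * M * (fact (card S) / ln 2 ^ card S)"
      using N_nonneg[of y ?w] mult_le_cancel_right_pos[of "N y ?w" "N y ?w"]
      by (cases "N y ?w = 0") (auto simp del: times_divide_eq_right times_divide_eq_left)
    then show ?thesis by (simp add: mult_ac)
  qed
qed

text \<open>Order \<open>t\<^sup>2\<close> in the dual of the seminorm at the fixed point
  \<open>y\<close>; in particular the functional vanishes on vectors of norm zero for
  \<open>t\<close> near 0.\<close>

definition small :: "(nat \<Rightarrow> real) \<Rightarrow> (real \<Rightarrow> 'a \<Rightarrow> real) \<Rightarrow> bool" where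
  "small y h \<longleftrightarrow>
    (\<exists>L \<delta>. 0 < \<delta> \<and> (\<forall>t v. \<bar>t\<bar> < \<delta> \<longrightarrow> v \<in> V \<longrightarrow> \<bar>h t v\<bar> \<le> L * t\<^sup>2 * N y v))"

lemma smallI:
  assumes "0 < \<delta>" "\<And>t v. \<bar>t\<bar> < \<delta> \<Longrightarrow> v \<in> V \<Longrightarrow> \<bar>h t v\<bar> \<le> L * t\<^sup>2 * N y v"
  shows "small y h"
  using assms unfolding small_def by blast

lemma small_cong:
  assumes "small y h" "\<And>t v. v \<in> V \<Longrightarrow> h' t v = h t v"
  shows "small y h'"
  using assms unfolding small_def by simp

lemma small_add:
  assumes "small y g" "small y h"
  shows "small y (\<lambda>t v. g t v + h t v)"
proof -
  obtain L1 d1 where 1: "0 < d1" "\<And>t v. \<bar>t\<bar> < d1 \<Longrightarrow> v \<in> V \<Longrightarrow> \<bar>g t v\<bar> \<le> L1 * t\<^sup>2 * N y v"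
    using assms(1) unfolding small_def by blast
  obtain L2 d2 where 2: "0 < d2" "\<And>t v. \<bar>t\<bar> < d2 \<Longrightarrow> v \<in> V \<Longrightarrow> \<bar>h t v\<bar> \<le> L2 * t\<^sup>2 * N y v"
    using assms(2) unfolding small_def by blast
  show ?thesis
  proof (rule smallI[of "min d1 d2" _ "L1 + L2"])
    fix t v assume "\<bar>t\<bar> < min d1 d2" "v \<in> V"
    then show "\<bar>g t v + h t v\<bar> \<le> (L1 + L2) * t\<^sup>2 * N y v"
      using 1(2)[of t v] 2(2)[of t v] by (simp add: distrib_right)
  qed (use 1 2 in auto)
qed

lemma small_uminus: "small y h \<Longrightarrow> small y (\<lambda>t v. - h t v)"
  by (simp add: small_def)

lemma small_sum:
  assumes "finite I" "\<And>i. i \<in> I \<Longrightarrow> small y (h i)"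
  shows "small y (\<lambda>t v. \<Sum>i\<in>I. h i t v)"
  using assms
proof (induction I rule: finite_induct)
  case empty
  show ?case by (rule smallI[of 1 _ 0]) auto
next
  case (insert i I)
  then have "small y (\<lambda>t v. h i t v + (\<Sum>i\<in>I. h i t v))" by (intro small_add) auto
  then show ?case using insert.hyps by simp
qed

text \<open>First-order consequence of the remainder estimate: for \<open>t\<close> below 1 in size
  its square is dominated by its absolute value, and the derivative form is bounded.\<close>

lemma B_lipschitz:
  assumes y: "y \<in> U" and yj: "y j \<noteq> 0" and R: "finite R" "j \<notin> R"
  shows "\<exists>L \<delta>. 0 < \<delta> \<and> 0 \<le> L \<and> (\<forall>t w v. \<bar>t\<bar> < \<delta> \<longrightarrow> w \<in> V \<longrightarrow> v \<in> V \<longrightarrow>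
    \<bar>B R (y(j := y j + t)) w v - B R y w v\<bar> \<le> L * \<bar>t\<bar> * N y w * N y v)"
proof -
  obtain L \<delta> where d: "0 < \<delta>" and L: "\<And>t w v. \<bar>t\<bar> < \<delta> \<Longrightarrow> w \<in> V \<Longrightarrow> v \<in> V \<Longrightarrow>
    \<bar>B R (y(j := y j + t)) w v - B R y w v - t * B (insert j R) y w v\<bar> \<le> L * t\<^sup>2 * N y w * N y v"
    using remainder[OF y yj R] by blast
  let ?L = "\<bar>L\<bar> + \<bar>K (insert j R)\<bar>"
  show ?thesis
  proof (rule exI[of _ ?L], rule exI[of _ "min \<delta> 1"], intro conjI allI impI)
    fix t w v assume t: "\<bar>t\<bar> < min \<delta> 1" and w: "w \<in> V" and v: "v \<in> V"
    have N: "0 \<le> N y w * N y v" using N_nonneg by simp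
    have "t\<^sup>2 \<le> \<bar>t\<bar>"
      using t mult_left_mono[of "\<bar>t\<bar>" 1 "\<bar>t\<bar>"] by (simp add: power2_eq_square flip: abs_mult)
    then have "L * t\<^sup>2 \<le> \<bar>L\<bar> * \<bar>t\<bar>" by (intro mult_mono) auto
    then have 1: "L * t\<^sup>2 * N y w * N y v \<le> \<bar>L\<bar> * \<bar>t\<bar> * N y w * N y v"
      using mult_right_mono[OF \<open>L * t\<^sup>2 \<le> \<bar>L\<bar> * \<bar>t\<bar>\<close> N] by (simp only: mult.assoc)
    have "\<bar>B (insert j R) y w v\<bar> \<le> K (insert j R) * N y w * N y v"
      using bounded[OF y _ w v] R by simp
    also have "\<dots> \<le> \<bar>K (insert j R)\<bar> * N y w * N y v"
      using mult_right_mono[OF abs_ge_self N] by (simp add: mult.assoc)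
    finally have 2: "\<bar>t * B (insert j R) y w v\<bar> \<le> \<bar>t\<bar> * (\<bar>K (insert j R)\<bar> * N y w * N y v)"
      by (simp add: abs_mult mult_left_mono)
    have "?L * \<bar>t\<bar> * N y w * N y v
        = \<bar>L\<bar> * \<bar>t\<bar> * N y w * N y v + \<bar>t\<bar> * (\<bar>K (insert j R)\<bar> * N y w * N y v)"
      by (simp add: algebra_simps)
    then show "\<bar>B R (y(j := y j + t)) w v - B R y w v\<bar> \<le> ?L * \<bar>t\<bar> * N y w * N y v"
      using L[of t w v] 1 2 t w v by linarith
  qed (use d in auto)
qed

text \<open>Take the equations at the shifted point, subtract those at \<open>y\<close> and
  \<open>t\<close> times those of \<open>insert j S\<close> at \<open>y\<close>. What is left is an
  equation for the Taylor remainder of \<open>sol\<close> whose data are remainders of the forms and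
  remainders of \<open>sol\<close> on proper subsets; coercivity then bounds it.\<close>

lemma sol_differentiable:
  assumes y: "y \<in> U" and yj: "y j \<noteq> 0" and S: "finite S" "j \<notin> S"
  shows "\<exists>L \<delta>. 0 < \<delta> \<and> (\<forall>t. \<bar>t\<bar> < \<delta> \<longrightarrow>
    N y (sol (y(j := y j + t)) S - sol y S - t *\<^sub>R sol y (insert j S)) \<le> L * t\<^sup>2)"
  using S
proof (induction S rule: finite_psubset_induct)
  case (psubset S)
  define Y where "Y t = y(j := y j + t)" for t
  have YU: "Y t \<in> U" for t unfolding Y_def by (rule U_upd[OF y])
  have fin: "finite R" "finite (S - R)" "finite (insert j R)" "j \<notin> R" if "R \<in> Pow S" for R
    using that psubset.hyps psubset.prems finite_subset by auto
  define z where "z Q t = sol (Y t) Q - sol y Q - t *\<^sub>R sol y (insert j Q)" for Q t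
  have zV: "z Q t \<in> V" if "finite Q" for Q t
    unfolding z_def using that
    by (intro subspace_diff[OF V] subspace_scale[OF V] sol_in y YU) auto
  \<comment> \<open>The part that only sees the variation of the form, with \<open>sol\<close>
    frozen at \<open>y\<close>: the Taylor remainder of \<open>B R\<close> on the value, and
    \<open>t\<close> times its increment on the derivative.\<close>
  define g where "g R t v =
      (B R (Y t) (sol y (S - R)) v - B R y (sol y (S - R)) v - t * B (insert j R) y (sol y (S - R)) v)
      + t * (B R (Y t) (sol y (insert j (S - R))) v - B R y (sol y (insert j (S - R))) v)" for R t v
  have g: "small y (g R)" if R: "R \<in> Pow S" for R
    unfolding g_def
  proof (rule small_add)
    obtain L \<delta> where "0 < \<delta>" "\<And>t w v. \<bar>t\<bar> < \<delta> \<Longrightarrow> w \<in> V \<Longrightarrow> v \<in> V \<Longrightarrow>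
      \<bar>B R (Y t) w v - B R y w v - t * B (insert j R) y w v\<bar> \<le> L * t\<^sup>2 * N y w * N y v"
      using remainder[OF y yj fin(1,4)[OF R]] unfolding Y_def by blast
    then show "small y (\<lambda>t v. B R (Y t) (sol y (S - R)) v - B R y (sol y (S - R)) v
        - t * B (insert j R) y (sol y (S - R)) v)"
      using sol_in[OF y fin(2)[OF R]]
      by (intro smallI[of \<delta> _ "L * N y (sol y (S - R))"])
        (auto simp only: mult.assoc mult.left_commute[of "N y (sol y (S - R))"])
  next
    obtain L \<delta> where d: "0 < \<delta>" and L: "\<And>t w v. \<bar>t\<bar> < \<delta> \<Longrightarrow> w \<in> V \<Longrightarrow> v \<in> V \<Longrightarrow>
      \<bar>B R (Y t) w v - B R y w v\<bar> \<le> L * \<bar>t\<bar> * N y w * N y v"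
      using B_lipschitz[OF y yj fin(1,4)[OF R]] unfolding Y_def by blast
    let ?w = "sol y (insert j (S - R))"
    show "small y (\<lambda>t v. t * (B R (Y t) ?w v - B R y ?w v))"
    proof (rule smallI[OF d, of _ "L * N y ?w"])
      fix t v assume t: "\<bar>t\<bar> < \<delta>" and v: "v \<in> V"
      have "?w \<in> V" using fin[OF R] by (intro sol_in y) auto
      from mult_left_mono[OF L[OF t this v] abs_ge_zero[of t]]
      have "\<bar>t * (B R (Y t) ?w v - B R y ?w v)\<bar> \<le> L * N y ?w * (\<bar>t\<bar> * \<bar>t\<bar>) * N y v"
        by (simp add: abs_mult mult_ac)
      then show "\<bar>t * (B R (Y t) ?w v - B R y ?w v)\<bar> \<le> L * N y ?w * t\<^sup>2 * N y v"
        by (simp add: power2_eq_square)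
    qed
  qed
  \<comment> \<open>For nonempty \<open>R\<close> the set \<open>S - R\<close> is a proper subset,
    so the induction hypothesis controls \<open>z (S - R) t\<close>; only the term of
    \<open>R = {}\<close> stays unknown.\<close>
  have z: "small y (\<lambda>t v. B R (Y t) (z (S - R) t) v)" if R: "R \<in> Pow S - {{}}" for R
  proof -
    have R': "R \<in> Pow S" using R by simp
    obtain L \<delta> where d: "0 < \<delta>" "0 \<le> L" and L: "\<And>t w v. \<bar>t\<bar> < \<delta> \<Longrightarrow> w \<in> V \<Longrightarrow> v \<in> V \<Longrightarrow>
      \<bar>B R (Y t) w v - B R y w v\<bar> \<le> L * \<bar>t\<bar> * N y w * N y v"
      using B_lipschitz[OF y yj fin(1,4)[OF R']] unfolding Y_def by blast
    obtain L' \<delta>' where d': "0 < \<delta>'" and L': "\<And>t. \<bar>t\<bar> < \<delta>' \<Longrightarrow> N y (z (S - R) t) \<le> L' * t\<^sup>2"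
      using psubset.IH[of "S - R"] R psubset.prems unfolding z_def Y_def by blast
    let ?C = "L + \<bar>K R\<bar>"
    show ?thesis
    proof (rule smallI[of "min (min \<delta> \<delta>') 1" _ "?C * L'"])
      fix t v assume t: "\<bar>t\<bar> < min (min \<delta> \<delta>') 1" and v: "v \<in> V"
      let ?z = "z (S - R) t"
      have zV': "?z \<in> V" by (rule zV[OF fin(2)[OF R']])
      have "\<bar>B R y ?z v\<bar> \<le> K R * (N y ?z * N y v)"
        using bounded[OF y fin(1)[OF R'] zV' v] by (simp add: mult_ac)
      also have "\<dots> \<le> \<bar>K R\<bar> * (N y ?z * N y v)"
        using N_nonneg by (intro mult_right_mono) auto
      finally have 1: "\<bar>B R y ?z v\<bar> \<le> \<bar>K R\<bar> * (N y ?z * N y v)" .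
      have "L * \<bar>t\<bar> * N y ?z * N y v = \<bar>t\<bar> * (L * (N y ?z * N y v))" by simp
      also have "\<dots> \<le> 1 * (L * (N y ?z * N y v))"
        using t d N_nonneg by (intro mult_right_mono) auto
      finally have 2: "L * \<bar>t\<bar> * N y ?z * N y v \<le> L * (N y ?z * N y v)" by simp
      have "\<bar>B R (Y t) ?z v\<bar> \<le> ?C * (N y ?z * N y v)"
        using L[OF _ zV' v, of t] 1 2 t by (simp add: distrib_right)
      also have "\<dots> \<le> ?C * ((L' * t\<^sup>2) * N y v)"
        using L'[of t] t d N_nonneg by (intro mult_left_mono mult_right_mono) auto
      finally show "\<bar>B R (Y t) ?z v\<bar> \<le> ?C * L' * t\<^sup>2 * N y v" by (simp add: mult_ac)
    qed (use d d' in auto)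
  qed
  have h: "B R (Y t) (sol (Y t) (S - R)) v - B R y (sol y (S - R)) v
      - t * (B (insert j R) y (sol y (S - R)) v + B R y (sol y (insert j (S - R))) v)
      = g R t v + B R (Y t) (z (S - R) t) v" if R: "R \<in> Pow S" and v: "v \<in> V" for R t v
  proof -
    let ?w = "sol y (S - R)" and ?w' = "sol y (insert j (S - R))" and ?wt = "sol (Y t) (S - R)"
    have V': "?w \<in> V" "?w' \<in> V" "?wt \<in> V"
      using fin[OF R] by (auto intro!: sol_in y YU)
    have "B R (Y t) (z (S - R) t) v = B R (Y t) ?wt v - B R (Y t) ?w v - t * B R (Y t) ?w' v"
      unfolding z_def using V' lin_on_scale[OF B1[OF YU fin(1)[OF R] v]]
        lin_on_diff[OF B1[OF YU fin(1)[OF R] v]] subspace_diff[OF V] subspace_scale[OF V] by simp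
    then show ?thesis by (simp add: g_def algebra_simps)
  qed
  have sum0: "(\<Sum>R\<in>Pow S. g R t v + B R (Y t) (z (S - R) t) v) = 0" if v: "v \<in> V" for t v
  proof -
    have "(\<Sum>R\<in>Pow S. g R t v + B R (Y t) (z (S - R) t) v)
      = (\<Sum>R\<in>Pow S. B R (Y t) (sol (Y t) (S - R)) v) - (\<Sum>R\<in>Pow S. B R y (sol y (S - R)) v)
      - t * (\<Sum>R\<in>Pow S. B (insert j R) y (sol y (S - R)) v + B R y (sol y (insert j (S - R))) v)"
      unfolding sum_distrib_left sum_subtractf[symmetric]
      by (intro sum.cong refl h[symmetric] v)
    \<comment> \<open>Product rule on sets: subsets of \<open>insert j S\<close> split into those
      with and those without \<open>j\<close>.\<close>
    also have "(\<Sum>R\<in>Pow S. B (insert j R) y (sol y (S - R)) v + B R y (sol y (insert j (S - R))) v)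
      = (\<Sum>R\<in>Pow (insert j S). B R y (sol y (insert j S - R)) v)"
      unfolding sum_Pow_insert[OF psubset.hyps psubset.prems]
    proof (intro sum.cong refl)
      fix R assume "R \<in> Pow S"
      then have "insert j S - R = insert j (S - R)" "insert j S - insert j R = S - R"
        using psubset.prems by auto
      then show "B (insert j R) y (sol y (S - R)) v + B R y (sol y (insert j (S - R))) v
        = B R y (sol y (insert j S - R)) v + B (insert j R) y (sol y (insert j S - insert j R)) v"
        by simp
    qed
    also have "\<dots> = 0" using sol_eq[OF y _ v, of "insert j S"] psubset.hyps by simp
    finally show ?thesis
      using sol_eq[OF y psubset.hyps v] sol_eq[OF YU psubset.hyps v, of t] by simp
  qed
  have "small y (\<lambda>t v. - (g {} t v + (\<Sum>R\<in>Pow S - {{}}. g R t v + B R (Y t) (z (S - R) t) v)))"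
    using psubset.hyps by (intro small_uminus small_add small_sum g z) auto
  then have "small y (\<lambda>t v. B {} (Y t) (z S t) v)"
  proof (rule small_cong)
    fix t v assume "v \<in> V"
    from sum0[OF this, of t]
    show "B {} (Y t) (z S t) v
        = - (g {} t v + (\<Sum>R\<in>Pow S - {{}}. g R t v + B R (Y t) (z (S - R) t) v))"
      by (subst (asm) sum.remove[of _ "{}"]) (use psubset.hyps in auto)
  qed
  then obtain L \<delta> where d: "0 < \<delta>" and L: "\<And>t v. \<bar>t\<bar> < \<delta> \<Longrightarrow> v \<in> V \<Longrightarrow>
    \<bar>B {} (Y t) (z S t) v\<bar> \<le> L * t\<^sup>2 * N y v" unfolding small_def by blast
  obtain L' \<delta>' where d': "0 < \<delta>'" "0 \<le> L'" and L': "\<And>t w v. \<bar>t\<bar> < \<delta>' \<Longrightarrow> w \<in> V \<Longrightarrow> v \<in> V \<Longrightarrow>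
    \<bar>B {} (Y t) w v - B {} y w v\<bar> \<le> L' * \<bar>t\<bar> * N y w * N y v"
    using B_lipschitz[OF y yj, of "{}"] unfolding Y_def by blast
  \<comment> \<open>This radius makes \<open>L' * \<bar>t\<bar>\<close> at most 1/2, so the form at
    the shifted point stays coercive with constant 1/2 in the norm at \<open>y\<close>; hence the 2
    in \<open>2 * \<bar>L\<bar>\<close>. The summand 1 covers \<open>L' = 0\<close>.\<close>
  define \<epsilon> where "\<epsilon> = min (min \<delta> \<delta>') (1 / (2 * (L' + 1)))"
  have e: "0 < \<epsilon>" using d d' by (simp add: \<epsilon>_def)
  have "N y (z S t) \<le> (2 * \<bar>L\<bar>) * t\<^sup>2" if t: "\<bar>t\<bar> < \<epsilon>" for t
  proof -
    let ?z = "z S t"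
    have zS: "?z \<in> V" by (rule zV[OF psubset.hyps])
    have "L' * \<bar>t\<bar> \<le> (L' + 1) * (1 / (2 * (L' + 1)))"
      using t d' by (intro mult_mono) (auto simp: \<epsilon>_def)
    also have "\<dots> = 1 / 2" using d' by (simp add: field_simps)
    finally have "L' * \<bar>t\<bar> * (N y ?z * N y ?z) \<le> 1 / 2 * (N y ?z * N y ?z)"
      by (intro mult_right_mono) auto
    moreover have "\<bar>B {} (Y t) ?z ?z - N y ?z * N y ?z\<bar> \<le> L' * \<bar>t\<bar> * (N y ?z * N y ?z)"
      using L'[OF _ zS zS, of t] t coercive[OF y zS]
      by (simp add: \<epsilon>_def mult.assoc power2_eq_square)
    moreover have "\<bar>B {} (Y t) ?z ?z\<bar> \<le> L * t\<^sup>2 * N y ?z"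
      using L[OF _ zS, of t] t by (simp add: \<epsilon>_def)
    moreover have "L * t\<^sup>2 * N y ?z \<le> \<bar>L\<bar> * t\<^sup>2 * N y ?z"
      using N_nonneg by (intro mult_right_mono) auto
    ultimately have "N y ?z * N y ?z \<le> (2 * \<bar>L\<bar> * t\<^sup>2) * N y ?z" by (simp add: mult_ac)
    then show ?thesis
      using N_nonneg[of y ?z] by (cases "N y ?z = 0") auto
  qed
  with e show ?case unfolding z_def Y_def by blast
qed

end

section \<open>Real-valued functions and polynomials\<close>

text \<open>Scaling completes pointwise addition to a real vector space, so that the abstract
  results apply to sets of functions such as the discrete space.\<close>

instantiation "fun" :: (type, real_vector) real_vector
begin

definition "c *\<^sub>R f = (\<lambda>x. c *\<^sub>R f x)"

instance
  by standard (auto simp: scaleR_fun_def fun_eq_iff scaleR_add_right scaleR_add_left)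

end

lemma scaleR_fun_apply [simp]: "(c *\<^sub>R f) x = c *\<^sub>R f x"
  by (simp add: scaleR_fun_def)

text \<open>A nonempty open set is not negligible. This makes almost-everywhere identities and
  bounds between continuous functions pointwise.\<close>

lemma AE_lebesgue_on_open:
  fixes W :: "'a::euclidean_space set"
  assumes "S \<in> sets lebesgue" "W \<subseteq> S" "open {x \<in> W. \<not> P x}" "AE x in lebesgue_on S. P x" "x \<in> W"
  shows "P x"
proof (rule ccontr)
  assume nP: "\<not> P x"
  have "AE x in lebesgue. x \<in> S \<longrightarrow> P x"
    using assms(1,4) by (subst (asm) AE_restrict_space_iff) auto
  then have "AE x in lebesgue. x \<notin> {x \<in> W. \<not> P x}"
    by eventually_elim (use assms(2) in auto)
  then have "negligible {x \<in> W. \<not> P x}"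
    using assms(3) by (simp add: negligible_iff_null_sets AE_iff_null_sets)
  with assms(3,5) nP open_not_negligible[of "{x \<in> W. \<not> P x}"] show False by auto
qed

section \<open>Polynomials of bounded total degree and their gradients\<close>

lemma finite_multidegrees: "finite {\<alpha>::'d::finite \<Rightarrow> nat. sum \<alpha> UNIV \<le> k}"
proof (rule finite_subset)
  have "\<alpha> i \<le> k" if "sum \<alpha> UNIV \<le> k" for \<alpha> :: "'d \<Rightarrow> nat" and i
    using member_le_sum[of i UNIV \<alpha>] that by simp
  then show "{\<alpha>::'d \<Rightarrow> nat. sum \<alpha> UNIV \<le> k} \<subseteq> PiE UNIV (\<lambda>_. {..k})" by auto
  show "finite (PiE (UNIV::'d set) (\<lambda>_. {..k}))" by (intro finite_PiE) auto
qed

lemma polys_lincomb: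
  assumes "p \<in> polys k" "q \<in> polys k"
  shows "(\<lambda>x. a * p x + b * q x) \<in> polys k"
proof -
  obtain c d where "p = (\<lambda>x. \<Sum>\<alpha>::'a \<Rightarrow> nat | sum \<alpha> UNIV \<le> k. c \<alpha> * (\<Prod>i\<in>UNIV. x $ i ^ \<alpha> i))"
    "q = (\<lambda>x. \<Sum>\<alpha>::'a \<Rightarrow> nat | sum \<alpha> UNIV \<le> k. d \<alpha> * (\<Prod>i\<in>UNIV. x $ i ^ \<alpha> i))"
    using assms unfolding polys_def by auto
  then have "(\<lambda>x. a * p x + b * q x)
      = (\<lambda>x. \<Sum>\<alpha>::'a \<Rightarrow> nat | sum \<alpha> UNIV \<le> k. (a * c \<alpha> + b * d \<alpha>) * (\<Prod>i\<in>UNIV. x $ i ^ \<alpha> i))"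
    by (simp add: sum_distrib_left sum.distrib[symmetric] algebra_simps)
  then show ?thesis unfolding polys_def by auto
qed

lemma polys_zero: "(\<lambda>x. 0) \<in> polys k"
  unfolding polys_def by (auto intro!: exI[of _ "\<lambda>_. 0"])

lemma polys_monomial:
  assumes "sum \<alpha> UNIV \<le> k"
  shows "(\<lambda>x. \<Prod>i\<in>UNIV. x $ i ^ \<alpha> i) \<in> polys k"
proof -
  have "(\<Sum>\<alpha>' | sum \<alpha>' UNIV \<le> k. (if \<alpha>' = \<alpha> then 1 else 0) * (\<Prod>i\<in>UNIV. x $ i ^ \<alpha>' i))
      = (\<Prod>i\<in>UNIV. x $ i ^ \<alpha> i)" for x :: "real^'a"
    using assms by (subst sum.remove[OF finite_multidegrees, of \<alpha>]) auto
  then show ?thesis unfolding polys_def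
    by (auto intro!: exI[of _ "\<lambda>\<alpha>'. if \<alpha>' = \<alpha> then 1 else 0"])
qed

lemma polys_real_polynomial_function:
  "q \<in> polys k \<Longrightarrow> real_polynomial_function q"
  unfolding polys_def
  by (auto intro!: real_polynomial_function_sum finite_multidegrees real_polynomial_function.intros(4)
      real_polynomial_function_prod real_polynomial_function_power real_polynomial_function.intros(2)
      real_polynomial_function.intros(1)[OF bounded_linear_vec_nth])

lemma real_polynomial_function_gradient:
  fixes q :: "'a::euclidean_space \<Rightarrow> real"
  assumes "real_polynomial_function q"
  shows "\<exists>g. continuous_on UNIV g \<and> (\<forall>x. GDERIV q x :> g x)"
  using assms
proof (induction q rule: real_polynomial_function.induct)
  case (linear f)
  \<comment> \<open>The Riesz representative of a linear functional is its constant
    gradient.\<close>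
  have "f h = inner h (\<Sum>b\<in>Basis. f b *\<^sub>R b)" for h
  proof -
    have "f h = f (\<Sum>b\<in>Basis. inner h b *\<^sub>R b)" by (simp add: euclidean_representation)
    also have "\<dots> = inner h (\<Sum>b\<in>Basis. f b *\<^sub>R b)"
      by (simp add: linear_sum[OF bounded_linear.linear[OF linear]]
          linear_scale[OF bounded_linear.linear[OF linear]] inner_sum_right mult.commute)
    finally show ?thesis .
  qed
  then have "GDERIV f x :> (\<Sum>b\<in>Basis. f b *\<^sub>R b)" for x
    using bounded_linear_imp_has_derivative[OF linear] unfolding gderiv_def by (metis (no_types, lifting) ext)
  then show ?case by (intro exI[of _ "\<lambda>_. \<Sum>b\<in>Basis. f b *\<^sub>R b"]) auto
next
  case (const c)
  show ?case by (intro exI[of _ "\<lambda>_. 0"]) (auto intro: GDERIV_const)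
next
  case (add f g)
  then obtain f' g' where "continuous_on UNIV f'" "\<And>x. GDERIV f x :> f' x"
    "continuous_on UNIV g'" "\<And>x. GDERIV g x :> g' x" by blast
  then show ?case
    by (intro exI[of _ "\<lambda>x. f' x + g' x"]) (auto intro!: GDERIV_add continuous_intros)
next
  case (mult f g)
  then obtain f' g' where "continuous_on UNIV f'" "\<And>x. GDERIV f x :> f' x"
    "continuous_on UNIV g'" "\<And>x. GDERIV g x :> g' x" by blast
  moreover have "continuous_on UNIV f" "continuous_on UNIV g"
    using mult.hyps by (auto simp: real_polynomial_function_eq intro: continuous_on_polymonial_function)
  ultimately show ?case
    by (intro exI[of _ "\<lambda>x. f x *\<^sub>R g' x + g x *\<^sub>R f' x"]) (auto intro!: GDERIV_mult continuous_intros)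
qed

lemma grad_eqI:
  assumes "GDERIV q x :> g"
  shows "grad q x = g"
  unfolding grad_def
proof (rule the_equality)
  fix g' assume "GDERIV q x :> g'"
  with assms have "(\<lambda>h. inner h g') = (\<lambda>h. inner h g)"
    unfolding gderiv_def by (rule has_derivative_unique[rotated])
  then show "g' = g" by (metis inner_commute vector_eq_ldot)
qed (rule assms)

lemma
  assumes "real_polynomial_function q"
  shows real_polynomial_GDERIV_grad: "GDERIV q x :> grad q x"
    and real_polynomial_continuous_grad: "continuous_on A (grad q)"
proof -
  obtain g where g: "continuous_on UNIV g" "\<And>x. GDERIV q x :> g x"
    using real_polynomial_function_gradient[OF assms] by blast
  have "grad q = g" using g(2) grad_eqI by blast
  with g show "GDERIV q x :> grad q x" "continuous_on A (grad q)"
    by (auto intro: continuous_on_subset)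
qed

lemma grad_lincomb:
  assumes "real_polynomial_function p" "real_polynomial_function q"
  shows "grad (\<lambda>x. a * p x + b * q x) x = a *\<^sub>R grad p x + b *\<^sub>R grad q x"
proof -
  have "GDERIV (\<lambda>x. a * p x) x :> a *\<^sub>R grad p x" "GDERIV (\<lambda>x. b * q x) x :> b *\<^sub>R grad q x"
    using GDERIV_mult[OF GDERIV_const real_polynomial_GDERIV_grad[OF assms(1)]]
      GDERIV_mult[OF GDERIV_const real_polynomial_GDERIV_grad[OF assms(2)]] by auto
  then show ?thesis by (intro grad_eqI GDERIV_add)
qed

text \<open>On the line through \<open>x0\<close> and \<open>x\<close> the polynomial becomes one in
  a single variable with infinitely many roots near \<open>x0\<close>, so all its coefficients
  vanish.\<close>

lemma real_polynomial_function_zero_on_open: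
  fixes q :: "'a::euclidean_space \<Rightarrow> real"
  assumes q: "real_polynomial_function q" and W: "open W" "x0 \<in> W" and zero: "\<And>x. x \<in> W \<Longrightarrow> q x = 0"
  shows "q x = 0"
proof -
  define \<gamma> where "\<gamma> t = x0 + t *\<^sub>R (x - x0)" for t :: real
  have "polynomial_function \<gamma>" unfolding \<gamma>_def
    by (intro polynomial_function_add polynomial_function_const polynomial_function_bounded_linear
        bounded_linear_scaleR_left)
  from real_polynomial_function_compose[OF this q]
  obtain a and n :: nat where a: "q \<circ> \<gamma> = (\<lambda>t. \<Sum>i\<le>n. a i * t ^ i)"
    using real_polynomial_function_imp_sum by blast
  have "continuous_on UNIV \<gamma>" unfolding \<gamma>_def by (intro continuous_intros)
  then have "open (\<gamma> -` W)" using W(1) by (rule open_vimage[rotated])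
  moreover have "0 \<in> \<gamma> -` W" using W by (simp add: \<gamma>_def)
  ultimately have "infinite (\<gamma> -` W)"
    using finite_imp_not_open by blast
  moreover have "\<gamma> -` W \<subseteq> {t. (\<Sum>i\<le>n. a i * t ^ i) = 0}"
  proof
    fix t assume "t \<in> \<gamma> -` W"
    then have "(q \<circ> \<gamma>) t = 0" using zero by simp
    then show "t \<in> {t. (\<Sum>i\<le>n. a i * t ^ i) = 0}" unfolding a by simp
  qed
  ultimately have "infinite {t. (\<Sum>i\<le>n. a i * t ^ i) = 0}" using finite_subset by blast
  then have "\<forall>i\<le>n. a i = 0" using polyfun_finite_roots[of a n] by blast
  then have "(q \<circ> \<gamma>) 1 = 0" unfolding a by simp
  then show ?thesis by (simp add: \<gamma>_def)
qed

text \<open>Two polynomials that agree almost everywhere on \<open>T\<close> agree on its interior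
  and hence everywhere, so the choice in \<open>poly_on\<close> has a unique outcome. This makes
  traces and gradients linear in \<open>v\<close>.\<close>

lemma poly_on_eqI:
  assumes q: "q \<in> polys k" "AE x in lebesgue_on T. v x = q x"
    and T: "T \<in> sets lebesgue" "interior T \<noteq> {}"
  shows "poly_on k v T = q"
  unfolding poly_on_def
proof (rule some_equality)
  fix q' assume q': "q' \<in> polys k \<and> (AE x in lebesgue_on T. v x = q' x)"
  define r where "r = (\<lambda>x. 1 * q' x + (-1) * q x)"
  have r: "real_polynomial_function r"
    unfolding r_def by (rule polys_real_polynomial_function[OF polys_lincomb]) (use q q' in auto)
  have ae: "AE x in lebesgue_on T. r x = 0"
    using q(2) conjunct2[OF q'] unfolding r_def by eventually_elim simp
  have "r x = 0" if "x \<in> interior T" for x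
  proof (rule AE_lebesgue_on_open[OF T(1) interior_subset _ ae that])
    have "continuous_on UNIV r"
      using r by (auto simp: real_polynomial_function_eq intro: continuous_on_polymonial_function)
    then have "open (interior T \<inter> r -` (- {0}))"
      by (intro open_Int open_interior open_vimage) auto
    then show "open {x \<in> interior T. r x \<noteq> 0}" by (simp add: Int_def vimage_def)
  qed
  with T(2) have "r x = 0" for x
    using real_polynomial_function_zero_on_open[OF r open_interior] by blast
  then show "q' = q" by (auto simp: r_def fun_eq_iff)
qed (use q in auto)

section \<open>Faces\<close>

text \<open>The diameter has to be positive because the penalty is divided by \<open>h_face\<close>;
  in dimension one faces are points, hence the exception.\<close>

lemma element_face:
  fixes T :: "'a::euclidean_space set"
  assumes "F \<in> element_faces T" and T: "bounded T"
  obtains a b where "a \<noteq> 0" "F \<subseteq> {x. inner a x = b}" "compact F" "F \<noteq> {}" "F \<subseteq> frontier T"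
    "DIM('a) \<noteq> 1 \<Longrightarrow> 0 < diameter F"
proof -
  obtain C H where F: "F = closure C" and H: "hyperplane H"
    and C: "C \<in> components ((top_of_set H) interior_of (frontier T \<inter> H))"
    using assms(1) unfolding element_faces_def by auto
  let ?W = "(top_of_set H) interior_of (frontier T \<inter> H)"
  obtain a b where ab: "a \<noteq> 0" "H = {x. inner a x = b}" using H unfolding hyperplane_def by auto
  have W: "?W \<subseteq> frontier T \<inter> H" by (rule interior_of_subset)
  have CW: "C \<subseteq> ?W" and "C \<noteq> {}" using C in_components_subset in_components_nonempty by auto
  have clo: "closed (frontier T \<inter> H)" using ab by (auto intro: closed_Int closed_hyperplane)
  have FH: "F \<subseteq> frontier T \<inter> H" unfolding F using CW W clo by (intro closure_minimal) auto
  have bF: "bounded F" using FH compact_imp_bounded[OF compact_frontier_bounded[OF T]]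
    by (meson bounded_subset inf.boundedE)
  have "compact F" using bF unfolding F by (simp add: compact_eq_bounded_closed)
  moreover have "0 < diameter F" if dim: "DIM('a) \<noteq> 1"
  proof -
    obtain x where x: "x \<in> C" using \<open>C \<noteq> {}\<close> by auto
    have "openin (top_of_set H) ?W" by (rule openin_interior_of)
    then obtain e where e: "0 < e" "ball x e \<inter> H \<subseteq> ?W"
      using x CW unfolding openin_contains_ball by blast
    have "2 \<le> DIM('a)" using dim DIM_positive[where 'a='a] by linarith
    then obtain c where c: "c \<noteq> 0" "orthogonal a c"
      by (rule orthogonal_to_vector_exists)
    define z where "z = x + (e / 2 / norm c) *\<^sub>R c"
    have xH: "x \<in> H" using x CW W by auto
    have dz: "dist x z = e / 2" using c e by (simp add: z_def dist_norm)
    have zH: "z \<in> H" using xH c ab by (simp add: z_def inner_add_right orthogonal_def)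
    \<comment> \<open>By convexity the segment stays in the relative interior, and being connected
      it stays in the component of \<open>x\<close>.\<close>
    have "convex (ball x e \<inter> H)" using ab by (auto intro: convex_Int convex_hyperplane)
    then have "closed_segment x z \<subseteq> ball x e \<inter> H"
      using xH zH dz e by (intro closed_segment_subset) auto
    then have "closed_segment x z \<subseteq> C"
      using e x by (intro components_maximal[OF C]) auto
    then have "z \<in> F" unfolding F using closure_subset by auto
    moreover have "x \<in> F" unfolding F using x closure_subset by auto
    ultimately have "dist x z \<le> diameter F" using bF by (intro diameter_bounded_bound)
    then show ?thesis using dz e by simp
  qed
  ultimately show ?thesis using that[OF ab(1)] FH ab F \<open>C \<noteq> {}\<close> by auto
qed

text \<open>The prism over a compact face is compact, hence of finite volume. The normal component
  of a point of the prism, measured from any \<open>p\<close> in the face, is its height, so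
  subtracting it leads back to the face.\<close>

lemma face_measure:
  fixes F :: "'a::euclidean_space set"
  assumes F: "compact F" "F \<noteq> {}" and ab: "a \<noteq> 0" "F \<subseteq> {x. inner a x = b}"
  shows "space (face_measure F) = F" "sets (face_measure F) = sets (restrict_space borel F)"
    "finite_measure (face_measure F)"
proof -
  define n where "n = (SOME n. norm n = 1 \<and> (\<forall>x\<in>F. \<forall>z\<in>F. inner n (x - z) = 0))"
  define p where "p = (SOME p. p \<in> F)"
  define S where "S = {x + t *\<^sub>R n |x t. x \<in> F \<and> t \<in> {0..1}}"
  define M where "M = restrict_space lborel S"
  define \<pi> where "\<pi> z = z - inner n (z - p) *\<^sub>R n" for z
  have fm: "face_measure F = distr M (restrict_space borel F) \<pi>"
    unfolding face_measure_def Let_def M_def \<pi>_def S_def n_def p_def ..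
  have "norm (a /\<^sub>R norm a) = 1 \<and> (\<forall>x\<in>F. \<forall>z\<in>F. inner (a /\<^sub>R norm a) (x - z) = 0)"
    using ab by (auto simp: inner_diff_right subset_iff)
  then have n: "norm n = 1" "\<And>x z. x \<in> F \<Longrightarrow> z \<in> F \<Longrightarrow> inner n (x - z) = 0"
    using someI[of "\<lambda>n. norm n = 1 \<and> (\<forall>x\<in>F. \<forall>z\<in>F. inner n (x - z) = 0)" "a /\<^sub>R norm a"]
    unfolding n_def[symmetric] by blast+
  have p: "p \<in> F" unfolding p_def using F(2) by (simp add: some_in_eq)
  have "S = (\<lambda>(x, t). x + t *\<^sub>R n) ` (F \<times> {0..1})" unfolding S_def
    by (auto simp: image_iff) (metis atLeastAtMost_iff)
  then have S: "compact S"
    using F(1) by (auto intro!: compact_continuous_image compact_Times continuous_intros simp: split_beta)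
  have "\<pi> \<in> measurable M (restrict_space borel F)"
  proof (rule measurable_restrict_space2)
    show "\<pi> \<in> space M \<rightarrow> F"
    proof
      fix z assume "z \<in> space M"
      then obtain x t where z: "z = x + t *\<^sub>R n" "x \<in> F"
        unfolding M_def S_def by (auto simp: space_restrict_space)
      have "inner n (z - p) = inner n (x - p) + t * inner n n"
        unfolding z by (simp add: inner_add_right inner_diff_right)
      also have "\<dots> = t" using n(2)[OF z(2) p] n(1) by (simp add: dot_square_norm)
      finally show "\<pi> z \<in> F" using z by (simp add: \<pi>_def)
    qed
    show "\<pi> \<in> borel_measurable M" unfolding M_def \<pi>_def
      by (intro measurable_restrict_space1) simp
  qed
  moreover have "finite_measure M"
  proof (rule finite_measureI)
    have "S \<in> sets lborel" using S by (simp add: borel_compact)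
    then show "emeasure M (space M) \<noteq> \<infinity>"
      unfolding M_def using emeasure_compact_finite[OF S]
      by (simp add: emeasure_restrict_space space_restrict_space)
  qed
  ultimately show "finite_measure (face_measure F)"
    unfolding fm by (intro finite_measure.finite_measure_distr)
  show "space (face_measure F) = F" "sets (face_measure F) = sets (restrict_space borel F)"
    unfolding fm by (simp_all add: space_restrict_space)
qed

text \<open>One criterion for volume and face integrals alike; an inclusion of sigma-algebras is
  asked for because \<open>lebesgue_on\<close> has more measurable sets than the Borel ones.\<close>

lemma integrable_continuous_compact:
  fixes f :: "'a::euclidean_space \<Rightarrow> real"
  assumes M: "finite_measure M" "space M = A" "sets (restrict_space borel A) \<subseteq> sets M"
    and A: "compact A" and f: "continuous_on A f"
  shows "integrable M f"
proof -
  have "f \<in> borel_measurable (restrict_space borel A)"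
    by (rule borel_measurable_continuous_on_restrict[OF f])
  then have "f \<in> borel_measurable M"
    using M by (rule_tac measurable_mono[OF order_refl refl M(3), THEN subsetD])
      (auto simp: space_restrict_space)
  moreover obtain C where "\<And>x. x \<in> A \<Longrightarrow> norm (f x) \<le> C"
    using compact_imp_bounded[OF compact_continuous_image[OF f A]] unfolding bounded_iff by auto
  ultimately show ?thesis
    using M(2) by (intro finite_measure.integrable_const_bound[OF M(1), of _ C]) auto
qed

lemma lebesgue_on_compact:
  assumes "compact A"
  shows "finite_measure (lebesgue_on A)" "space (lebesgue_on A) = A"
    "sets (restrict_space borel A) \<subseteq> sets (lebesgue_on A)"
  using assms finite_measure_lebesgue_on[OF lmeasurable_compact]
  by (auto simp: space_restrict_space sets_restrict_space)

section \<open>The discontinuous Galerkin form\<close>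

lemma L2norm_sq: "(L2norm M g)\<^sup>2 = (\<integral>x. (norm (g x))\<^sup>2 \<partial>M)"
  unfolding L2norm_def by (intro real_sqrt_pow2 integral_nonneg_AE) auto

lemma L2_lincomb:
  assumes "v \<in> L2 M" "w \<in> L2 M"
  shows "c *\<^sub>R v + d *\<^sub>R w \<in> L2 M"
proof -
  have m: "v \<in> borel_measurable M" "w \<in> borel_measurable M"
    and i: "integrable M (\<lambda>x. (v x)\<^sup>2)" "integrable M (\<lambda>x. (w x)\<^sup>2)"
    using assms by (auto simp: L2_def)
  have "integrable M (\<lambda>x. 2 * c\<^sup>2 * (v x)\<^sup>2 + 2 * d\<^sup>2 * (w x)\<^sup>2)" using i by simp
  then have "integrable M (\<lambda>x. (c * v x + d * w x)\<^sup>2)"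
  proof (rule Bochner_Integration.integrable_bound)
    show "AE x in M. norm ((c * v x + d * w x)\<^sup>2) \<le> norm (2 * c\<^sup>2 * (v x)\<^sup>2 + 2 * d\<^sup>2 * (w x)\<^sup>2)"
    proof (rule AE_I2)
      fix x
      have "0 \<le> (c * v x - d * w x)\<^sup>2" by simp
      then have "(c * v x + d * w x)\<^sup>2 \<le> 2 * c\<^sup>2 * (v x)\<^sup>2 + 2 * d\<^sup>2 * (w x)\<^sup>2"
        by (simp add: power2_sum power2_diff power_mult_distrib)
      then show "norm ((c * v x + d * w x)\<^sup>2) \<le> norm (2 * c\<^sup>2 * (v x)\<^sup>2 + 2 * d\<^sup>2 * (w x)\<^sup>2)" by simp
    qed
  qed (use m in measurable)
  moreover have "c *\<^sub>R v + d *\<^sub>R w = (\<lambda>x. c * v x + d * w x)" by (auto simp: fun_eq_iff)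
  ultimately show ?thesis using m by (simp add: L2_def)
qed

text \<open>Optimisation over \<open>s\<close>: for positive \<open>p\<close> and \<open>q\<close>
  the minimiser is \<open>sqrt q / sqrt p\<close>. If \<open>p = 0\<close> one lets \<open>s\<close>
  tend to infinity, and if \<open>q = 0\<close> to zero.\<close>

lemma young_scaled:
  fixes x p q K :: real
  assumes h: "\<And>s. 0 < s \<Longrightarrow> x \<le> K * (s * p + q / s) / 2" and nn: "0 \<le> K" "0 \<le> p" "0 \<le> q"
  shows "x \<le> K * sqrt p * sqrt q"
proof -
  have aux: "x \<le> 0" if "\<And>s. 0 < s \<Longrightarrow> x \<le> c / s" "0 \<le> c" for c
  proof (rule ccontr)
    assume "\<not> x \<le> 0"
    then have x: "0 < x" by simp
    \<comment> \<open>Just large enough that \<open>x * s\<close> exceeds \<open>c\<close>.\<close>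
    define s where "s = (c + 1) / x"
    have "0 < s" using x that(2) by (simp add: s_def)
    then have "x * s \<le> c" using that(1)[of s] by (simp add: pos_le_divide_eq)
    then show False using x by (simp add: s_def)
  qed
  consider "p = 0" | "q = 0" | "0 < p" "0 < q" using nn by linarith
  then show ?thesis
  proof cases
    case 1
    then show ?thesis using aux[of "K * q / 2"] h nn by (simp add: field_simps)
  next
    case 2
    then have "x \<le> (K * p / 2) / s" if "0 < s" for s
      using h[of "1 / s"] that by (simp add: field_simps)
    then show ?thesis using aux[of "K * p / 2"] nn 2 by simp
  next
    case 3
    define a b where "a = sqrt p" and "b = sqrt q"
    have ab: "0 < a" "0 < b" "p = a * a" "q = b * b" using 3 by (auto simp: a_def b_def)
    have "x \<le> K * (b / a * p + q / (b / a)) / 2" using h[of "b / a"] ab by simp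
    also have "\<dots> = K * a * b" unfolding ab(3,4) using ab(1,2) by (simp add: field_simps)
    finally show ?thesis by (simp add: a_def b_def)
  qed
qed

lemma inner_young:
  fixes x y :: "'a::real_inner"
  assumes "0 < s"
  shows "\<bar>inner x y\<bar> \<le> (s * (norm x)\<^sup>2 + (norm y)\<^sup>2 / s) / 2"
proof -
  have "\<bar>inner x y\<bar> \<le> norm x * norm y" by (rule Cauchy_Schwarz_ineq2)
  also have "norm x * norm y = (sqrt s * norm x) * (norm y / sqrt s)" using assms by simp
  also have "\<dots> \<le> ((sqrt s * norm x)\<^sup>2 + (norm y / sqrt s)\<^sup>2) / 2"
  proof -
    have "c * d \<le> (c\<^sup>2 + d\<^sup>2) / 2" for c d :: real using sum_squares_bound[of c d] by simp
    then show ?thesis .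
  qed
  also have "\<dots> = (s * (norm x)\<^sup>2 + (norm y)\<^sup>2 / s) / 2"
    using assms by (simp add: power_mult_distrib power_divide)
  finally show ?thesis .
qed

locale dg_mesh =
  fixes D :: "(real^'d::finite) set" and \<T> :: "(real^'d) set set" and k :: nat
  assumes polyhedral: "convex_polyhedral_domain D" and mesh: "polyhedral_mesh D \<T>"
begin

abbreviation "Vh \<equiv> dg_space D \<T> k"

section \<open>Elements, faces and the integrals over them\<close>

lemma closure_D: "compact (closure D)" "open D" "bounded D" "D \<noteq> {}"
  using polyhedral unfolding convex_polyhedral_domain_def by (auto simp: compact_closure)

lemma finite_mesh: "finite \<T>"
  using mesh by (simp add: polyhedral_mesh_def)

text \<open>The frontier is null because finitely many hyperplanes cover it; distinct elements then
  overlap in null sets only.\<close>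

lemma element:
  assumes "T \<in> \<T>"
  shows "compact T" "T \<subseteq> closure D" "T \<in> sets lebesgue" "interior T \<noteq> {}" "bounded T"
    "negligible (frontier T)"
proof -
  have T: "polyhedral_element T" using mesh assms by (simp add: polyhedral_mesh_def)
  then show b: "bounded T" "interior T \<noteq> {}" by (simp_all add: polyhedral_element_def)
  have "closed T" using T unfolding polyhedral_element_def by (metis closed_closure)
  then show c: "compact T" using b(1) by (simp add: compact_eq_bounded_closed)
  then show "T \<in> sets lebesgue" by (simp add: borel_compact)
  show "T \<subseteq> closure D" using mesh assms by (auto simp: polyhedral_mesh_def)
  obtain \<H> where H: "finite \<H>" "\<forall>H\<in>\<H>. hyperplane H" "frontier T \<subseteq> \<Union>\<H>"
    using T unfolding polyhedral_element_def by blast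
  have "negligible H" if "H \<in> \<H>" for H
    using H(2) that unfolding hyperplane_def by (auto intro: negligible_hyperplane)
  then have "negligible (\<Union>\<H>)" using H(1) by (intro negligible_Union) auto
  then show "negligible (frontier T)" using H(3) negligible_subset by blast
qed

lemma diameter_element:
  assumes "T \<in> \<T>"
  shows "0 < diameter T"
proof -
  have "infinite (interior T)" using element(4)[OF assms] finite_imp_not_open open_interior by blast
  then obtain x z where "x \<in> interior T" "z \<in> interior T" "x \<noteq> z"
    by (metis finite.emptyI finite_insert finite_subset insertI1 subsetI)
  then have "0 < dist x z" "dist x z \<le> diameter T"
    using diameter_bounded_bound[OF element(5)[OF assms]] interior_subset by (auto dest: subsetD)
  then show ?thesis by linarith
qed

lemma face:
  assumes "F \<in> faces \<T>"
  shows "compact F" "F \<subseteq> closure D" "0 < h_face \<T> F" "finite_measure (face_measure F)"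
    "space (face_measure F) = F" "sets (restrict_space borel F) \<subseteq> sets (face_measure F)"
proof -
  obtain T where T: "T \<in> \<T>" "F \<in> element_faces T" using assms unfolding faces_def by auto
  obtain a b where F: "a \<noteq> 0" "F \<subseteq> {x. inner a x = b}" "compact F" "F \<noteq> {}" "F \<subseteq> frontier T"
    and diam: "DIM(real^'d) \<noteq> 1 \<Longrightarrow> 0 < diameter F"
    using element_face[OF T(2) element(5)[OF T(1)]] by blast
  note fm = face_measure[OF F(3,4,1,2)]
  show "compact F" by (rule F)
  show "F \<subseteq> closure D"
    using F(5) element(1,2)[OF T(1)] compact_imp_closed frontier_subset_closed by blast
  show "finite_measure (face_measure F)" "space (face_measure F) = F"
    "sets (restrict_space borel F) \<subseteq> sets (face_measure F)" using fm by auto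
  have "finite (diameter ` adjacent \<T> F)" "diameter ` adjacent \<T> F \<noteq> {}"
    using T finite_mesh by (auto simp: adjacent_def)
  then have "Min (diameter ` adjacent \<T> F) \<in> diameter ` adjacent \<T> F" by (rule Min_in)
  then have "0 < Min (diameter ` adjacent \<T> F)"
    using diameter_element by (auto simp: adjacent_def)
  then show "0 < h_face \<T> F" using diam by (simp add: h_face_def)
qed

lemma integrable_element:
  assumes "T \<in> \<T>" "continuous_on T f"
  shows "integrable (lebesgue_on T) (f :: _ \<Rightarrow> real)"
  using integrable_continuous_compact[OF lebesgue_on_compact element(1) assms(2)] element(1) assms(1) by blast

lemma integrable_face:
  assumes "F \<in> faces \<T>" "continuous_on F f"
  shows "integrable (face_measure F) (f :: _ \<Rightarrow> real)"
  using integrable_continuous_compact[OF face(4,5,6,1) assms(2)] assms(1) by blast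

lemma poly_on:
  assumes "v \<in> Vh" "T \<in> \<T>"
  shows "poly_on k v T \<in> polys k" "AE x in lebesgue_on T. v x = poly_on k v T x"
proof -
  have "\<exists>q. q \<in> polys k \<and> (AE x in lebesgue_on T. v x = q x)"
    using assms unfolding dg_space_def by auto
  from someI_ex[OF this] show "poly_on k v T \<in> polys k" "AE x in lebesgue_on T. v x = poly_on k v T x"
    unfolding poly_on_def by auto
qed

lemma poly_on_rpf: "v \<in> Vh \<Longrightarrow> T \<in> \<T> \<Longrightarrow> real_polynomial_function (poly_on k v T)"
  by (rule polys_real_polynomial_function[OF poly_on(1)])

lemma poly_on_lincomb:
  assumes "v \<in> Vh" "w \<in> Vh" "T \<in> \<T>"
  shows "poly_on k (c *\<^sub>R v + d *\<^sub>R w) T = (\<lambda>x. c * poly_on k v T x + d * poly_on k w T x)"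
proof (rule poly_on_eqI)
  show "(\<lambda>x. c * poly_on k v T x + d * poly_on k w T x) \<in> polys k"
    using assms by (intro polys_lincomb poly_on)
  show "AE x in lebesgue_on T. (c *\<^sub>R v + d *\<^sub>R w) x = c * poly_on k v T x + d * poly_on k w T x"
    using poly_on(2)[OF assms(1,3)] poly_on(2)[OF assms(2,3)] by eventually_elim simp
qed (use assms element in auto)

lemma dg_space_lincomb:
  assumes "v \<in> Vh" "w \<in> Vh"
  shows "c *\<^sub>R v + d *\<^sub>R w \<in> Vh"
proof -
  have "\<exists>q\<in>polys k. AE x in lebesgue_on T. (c *\<^sub>R v + d *\<^sub>R w) x = q x" if T: "T \<in> \<T>" for T
  proof
    show "(\<lambda>x. c * poly_on k v T x + d * poly_on k w T x) \<in> polys k"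
      using assms T by (intro polys_lincomb poly_on)
    show "AE x in lebesgue_on T. (c *\<^sub>R v + d *\<^sub>R w) x = c * poly_on k v T x + d * poly_on k w T x"
      using poly_on(2)[OF assms(1) T] poly_on(2)[OF assms(2) T] by eventually_elim simp
  qed
  then show ?thesis using assms L2_lincomb unfolding dg_space_def by blast
qed

lemma subspace_dg_space: "subspace Vh"
proof (rule subspaceI)
  have "integrable (lebesgue_on D) (\<lambda>_. 0::real)" by simp
  then show "0 \<in> Vh"
    using polys_zero by (auto simp: dg_space_def L2_def zero_fun_def intro!: bexI[of _ "\<lambda>_. 0"])
  show "v + w \<in> Vh" if "v \<in> Vh" "w \<in> Vh" for v w using dg_space_lincomb[OF that, of 1 1] by simp
  show "c *\<^sub>R v \<in> Vh" if "v \<in> Vh" for c v using dg_space_lincomb[OF that that, of c 0] by simp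
qed

section \<open>Linearity of gradients, jumps, fluxes and of the form\<close>

lemma grad_poly_on_lincomb:
  assumes "v \<in> Vh" "w \<in> Vh" "T \<in> \<T>"
  shows "grad (poly_on k (c *\<^sub>R v + d *\<^sub>R w) T) x
    = c *\<^sub>R grad (poly_on k v T) x + d *\<^sub>R grad (poly_on k w T) x"
  unfolding poly_on_lincomb[OF assms] using assms by (intro grad_lincomb poly_on_rpf)

lemma jump_lincomb:
  assumes "v \<in> Vh" "w \<in> Vh"
  shows "jump \<T> F (poly_on k (c *\<^sub>R v + d *\<^sub>R w)) x
    = c *\<^sub>R jump \<T> F (poly_on k v) x + d *\<^sub>R jump \<T> F (poly_on k w) x"
  unfolding jump_def scaleR_sum_right sum.distrib[symmetric]
  using assms by (intro sum.cong refl) (simp add: adjacent_def poly_on_lincomb scaleR_add_left)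

lemma average_flux_lincomb:
  assumes "v \<in> Vh" "w \<in> Vh"
  shows "average \<T> F (flux k a (c *\<^sub>R v + d *\<^sub>R w)) x
    = c *\<^sub>R average \<T> F (flux k a v) x + d *\<^sub>R average \<T> F (flux k a w) x"
proof -
  have "(\<Sum>T\<in>adjacent \<T> F. flux k a (c *\<^sub>R v + d *\<^sub>R w) T x)
      = c *\<^sub>R (\<Sum>T\<in>adjacent \<T> F. flux k a v T x) + d *\<^sub>R (\<Sum>T\<in>adjacent \<T> F. flux k a w T x)"
    unfolding scaleR_sum_right sum.distrib[symmetric]
    using assms by (intro sum.cong refl)
      (simp add: adjacent_def flux_def grad_poly_on_lincomb scaleR_add_right mult.commute)
  then show ?thesis by (simp add: average_def scaleR_add_right mult.commute)
qed

text \<open>The coefficient is single-valued on a face, so a weight leaves the average pointwise.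
  Forms with a weighted coefficient can thus be measured in the starred norm of the unweighted
  one.\<close>

lemma average_flux_weight:
  "average \<T> F (flux k (\<lambda>x. g x * a x) v) x = g x *\<^sub>R average \<T> F (flux k a v) x"
proof -
  have "(\<Sum>T\<in>adjacent \<T> F. flux k (\<lambda>x. g x * a x) v T x) = g x *\<^sub>R (\<Sum>T\<in>adjacent \<T> F. flux k a v T x)"
    by (simp add: flux_def scaleR_sum_right)
  then show ?thesis by (simp add: average_def mult.commute)
qed

lemma average_flux_add_weight:
  "average \<T> F (flux k (\<lambda>x. c * a x + d * b x) v) x
    = c *\<^sub>R average \<T> F (flux k a v) x + d *\<^sub>R average \<T> F (flux k b v) x"
proof -
  have "(\<Sum>T\<in>adjacent \<T> F. flux k (\<lambda>x. c * a x + d * b x) v T x)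
      = c *\<^sub>R (\<Sum>T\<in>adjacent \<T> F. flux k a v T x) + d *\<^sub>R (\<Sum>T\<in>adjacent \<T> F. flux k b v T x)"
    by (simp add: flux_def scaleR_sum_right scaleR_add_left sum.distrib)
  then show ?thesis by (simp add: average_def scaleR_add_right mult.commute)
qed

lemma continuous_grad: "v \<in> Vh \<Longrightarrow> T \<in> \<T> \<Longrightarrow> continuous_on A (grad (poly_on k v T))"
  by (intro real_polynomial_continuous_grad poly_on_rpf)

lemma continuous_flux:
  "v \<in> Vh \<Longrightarrow> T \<in> \<T> \<Longrightarrow> continuous_on A a \<Longrightarrow> continuous_on A (flux k a v T)"
  unfolding flux_def[abs_def] by (intro continuous_intros continuous_grad)

lemma continuous_average:
  "v \<in> Vh \<Longrightarrow> continuous_on A a \<Longrightarrow> continuous_on A (average \<T> F (flux k a v))"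
  unfolding average_def[abs_def] by (intro continuous_intros continuous_flux) (auto simp: adjacent_def)

lemma continuous_jump:
  assumes "v \<in> Vh"
  shows "continuous_on A (jump \<T> F (poly_on k v))"
proof -
  have "continuous_on A (poly_on k v T)" if "T \<in> \<T>" for T
    using poly_on_rpf[OF assms that]
    by (auto simp: real_polynomial_function_eq intro: continuous_on_polymonial_function)
  then show ?thesis
    unfolding jump_def[abs_def] by (intro continuous_intros) (auto simp: adjacent_def)
qed

text \<open>Naming the integrands lets linearity be checked pointwise and integrability be proved
  once.\<close>

definition elem_int :: "(real^'d \<Rightarrow> real) \<Rightarrow> (real^'d \<Rightarrow> real) \<Rightarrow> (real^'d \<Rightarrow> real) \<Rightarrow> (real^'d) set \<Rightarrow> real^'d \<Rightarrow> real" where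
  "elem_int a w v T x = inner (flux k a w T x) (grad (poly_on k v T) x)"

definition face_int :: "(real^'d \<Rightarrow> real) \<Rightarrow> real \<Rightarrow> (real^'d \<Rightarrow> real) \<Rightarrow> (real^'d \<Rightarrow> real) \<Rightarrow> (real^'d) set \<Rightarrow> real^'d \<Rightarrow> real" where
  "face_int a \<eta> w v F x = inner (average \<T> F (flux k a v) x) (jump \<T> F (poly_on k w) x)
         - inner (average \<T> F (flux k a w) x) (jump \<T> F (poly_on k v) x)
         + \<eta> / h_face \<T> F * inner (jump \<T> F (poly_on k w) x) (jump \<T> F (poly_on k v) x)"

lemma nipdg_form_alt:
  "nipdg_form \<T> k a \<eta> w v = (\<Sum>T\<in>\<T>. \<integral>x. elem_int a w v T x \<partial>lebesgue_on T)
    + (\<Sum>F\<in>faces \<T>. \<integral>x. face_int a \<eta> w v F x \<partial>face_measure F)"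
  unfolding nipdg_form_def elem_int_def face_int_def ..

context
  fixes a :: "real^'d \<Rightarrow> real"
  assumes a: "continuous_on (closure D) a"
begin

lemma integrable_elem_int:
  "w \<in> Vh \<Longrightarrow> v \<in> Vh \<Longrightarrow> T \<in> \<T> \<Longrightarrow> integrable (lebesgue_on T) (elem_int a w v T)"
  unfolding elem_int_def[abs_def]
  by (intro integrable_element continuous_intros continuous_flux continuous_grad
      continuous_on_subset[OF a] element)

lemma integrable_face_int:
  "w \<in> Vh \<Longrightarrow> v \<in> Vh \<Longrightarrow> F \<in> faces \<T> \<Longrightarrow> integrable (face_measure F) (face_int a \<eta> w v F)"
  unfolding face_int_def[abs_def]
  by (intro integrable_face continuous_intros continuous_average continuous_jump
      continuous_on_subset[OF a] face)

end

text \<open>All linearity statements about the form hold without knowing that there are finitely many faces: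
  over an infinite index set every sum is zero.\<close>

lemma nipdg_form_lincombI:
  assumes "continuous_on (closure D) a1" "continuous_on (closure D) a2"
    and V: "w1 \<in> Vh" "v1 \<in> Vh" "w2 \<in> Vh" "v2 \<in> Vh"
    and e: "\<And>T x. T \<in> \<T> \<Longrightarrow> elem_int a w v T x = c * elem_int a1 w1 v1 T x + d * elem_int a2 w2 v2 T x"
    and f: "\<And>F x. face_int a \<eta> w v F x = c * face_int a1 \<eta>1 w1 v1 F x + d * face_int a2 \<eta>2 w2 v2 F x"
  shows "nipdg_form \<T> k a \<eta> w v = c * nipdg_form \<T> k a1 \<eta>1 w1 v1 + d * nipdg_form \<T> k a2 \<eta>2 w2 v2"
proof -
  have "(\<Sum>T\<in>\<T>. \<integral>x. elem_int a w v T x \<partial>lebesgue_on T)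
      = (\<Sum>T\<in>\<T>. c * (\<integral>x. elem_int a1 w1 v1 T x \<partial>lebesgue_on T) + d * (\<integral>x. elem_int a2 w2 v2 T x \<partial>lebesgue_on T))"
  proof (rule sum.cong[OF refl])
    fix T assume T: "T \<in> \<T>"
    show "(\<integral>x. elem_int a w v T x \<partial>lebesgue_on T)
      = c * (\<integral>x. elem_int a1 w1 v1 T x \<partial>lebesgue_on T) + d * (\<integral>x. elem_int a2 w2 v2 T x \<partial>lebesgue_on T)"
      unfolding e[OF T]
      using integrable_elem_int[OF assms(1) V(1,2) T] integrable_elem_int[OF assms(2) V(3,4) T] by simp
  qed
  moreover have "(\<Sum>F\<in>faces \<T>. \<integral>x. face_int a \<eta> w v F x \<partial>face_measure F)
      = (\<Sum>F\<in>faces \<T>. c * (\<integral>x. face_int a1 \<eta>1 w1 v1 F x \<partial>face_measure F)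
          + d * (\<integral>x. face_int a2 \<eta>2 w2 v2 F x \<partial>face_measure F))"
  proof (rule sum.cong[OF refl])
    fix F assume F: "F \<in> faces \<T>"
    show "(\<integral>x. face_int a \<eta> w v F x \<partial>face_measure F)
      = c * (\<integral>x. face_int a1 \<eta>1 w1 v1 F x \<partial>face_measure F) + d * (\<integral>x. face_int a2 \<eta>2 w2 v2 F x \<partial>face_measure F)"
      unfolding f
      using integrable_face_int[OF assms(1) V(1,2) F] integrable_face_int[OF assms(2) V(3,4) F] by simp
  qed
  ultimately show ?thesis
    unfolding nipdg_form_alt by (simp add: sum.distrib sum_distrib_left distrib_left)
qed

text \<open>Joint linearity in coefficient and penalty allows a Taylor remainder in the parameter to
  be collected into a single form.\<close>

lemma nipdg_form_weights:
  assumes "continuous_on (closure D) a" "continuous_on (closure D) b" "w \<in> Vh" "v \<in> Vh"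
  shows "nipdg_form \<T> k (\<lambda>x. c * a x + d * b x) (c * \<eta> + d * \<theta>) w v
    = c * nipdg_form \<T> k a \<eta> w v + d * nipdg_form \<T> k b \<theta> w v"
  by (rule nipdg_form_lincombI[OF assms(1,2,3,4,3,4)])
    (simp_all add: elem_int_def flux_def face_int_def average_flux_add_weight
      inner_add_left inner_add_right algebra_simps add_divide_distrib)

lemma lin_on_nipdg_form_left:
  assumes "continuous_on (closure D) a" "v \<in> Vh"
  shows "lin_on Vh (\<lambda>w. nipdg_form \<T> k a \<eta> w v)"
  unfolding lin_on_def
proof (intro allI ballI)
  fix c d w1 w2 assume w: "w1 \<in> Vh" "w2 \<in> Vh"
  show "nipdg_form \<T> k a \<eta> (c *\<^sub>R w1 + d *\<^sub>R w2) v = c * nipdg_form \<T> k a \<eta> w1 v + d * nipdg_form \<T> k a \<eta> w2 v"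
    by (rule nipdg_form_lincombI[OF assms(1,1) w(1) assms(2) w(2) assms(2)])
      (simp_all add: elem_int_def flux_def grad_poly_on_lincomb[OF w] face_int_def
        average_flux_lincomb[OF w] jump_lincomb[OF w] inner_add_left inner_add_right algebra_simps)
qed

lemma lin_on_nipdg_form_right:
  assumes "continuous_on (closure D) a" "w \<in> Vh"
  shows "lin_on Vh (nipdg_form \<T> k a \<eta> w)"
  unfolding lin_on_def
proof (intro allI ballI)
  fix c d v1 v2 assume v: "v1 \<in> Vh" "v2 \<in> Vh"
  show "nipdg_form \<T> k a \<eta> w (c *\<^sub>R v1 + d *\<^sub>R v2) = c * nipdg_form \<T> k a \<eta> w v1 + d * nipdg_form \<T> k a \<eta> w v2"
    by (rule nipdg_form_lincombI[OF assms(1,1,2) v(1) assms(2) v(2)])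
      (simp_all add: elem_int_def flux_def grad_poly_on_lincomb[OF v] face_int_def
        average_flux_lincomb[OF v] jump_lincomb[OF v] inner_add_left inner_add_right algebra_simps)
qed

section \<open>Energy norms, coercivity and boundedness of the form\<close>

lemma dg_norm_nonneg:
  assumes \<eta>: "0 < \<eta>"
  shows "0 \<le> dg_norm \<T> k a \<eta> v"
proof -
  have "0 \<le> (\<Sum>T\<in>\<T>. (L2norm (lebesgue_on T) (\<lambda>x. sqrt (a x) *\<^sub>R grad (poly_on k v T) x))\<^sup>2) +
     (\<Sum>F\<in>faces \<T>. \<eta> / h_face \<T> F * (L2norm (face_measure F) (jump \<T> F (poly_on k v)))\<^sup>2)"
    using \<eta> face(3) by (intro add_nonneg_nonneg sum_nonneg mult_nonneg_nonneg divide_nonneg_nonneg) (auto intro: less_imp_le)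
  then show ?thesis by (simp add: dg_norm_def)
qed

text \<open>The update rule for the lognormal coefficient is available on the closure of
  \<open>D\<close> only; all elements and faces lie there.\<close>

lemma nipdg_form_cong:
  assumes "\<And>x. x \<in> closure D \<Longrightarrow> a x = b x"
  shows "nipdg_form \<T> k a \<eta> w v = nipdg_form \<T> k b \<eta> w v"
  unfolding nipdg_form_alt
proof (intro arg_cong2[of _ _ _ _ "(+)"] sum.cong refl Bochner_Integration.integral_cong)
  fix T x assume "T \<in> \<T>" "x \<in> space (lebesgue_on T)"
  then have "x \<in> closure D" using element(2) by (auto simp: space_restrict_space)
  then show "elem_int a w v T x = elem_int b w v T x" using assms by (simp add: elem_int_def flux_def)
next
  fix F x assume "F \<in> faces \<T>" "x \<in> space (face_measure F)"
  then have "x \<in> closure D" using face(2,5) by auto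
  then show "face_int a \<eta> w v F x = face_int b \<eta> w v F x"
    using assms by (simp add: face_int_def average_def flux_def)
qed

context
  fixes a :: "real^'d \<Rightarrow> real" and \<eta> :: real
  assumes a: "continuous_on (closure D) a" and a_nonneg: "\<And>x. x \<in> closure D \<Longrightarrow> 0 \<le> a x" and \<eta>: "0 < \<eta>"
begin

lemma dg_norm_sq:
  "(dg_norm \<T> k a \<eta> v)\<^sup>2 = (\<Sum>T\<in>\<T>. \<integral>x. a x * (norm (grad (poly_on k v T) x))\<^sup>2 \<partial>lebesgue_on T)
    + (\<Sum>F\<in>faces \<T>. \<integral>x. \<eta> / h_face \<T> F * (norm (jump \<T> F (poly_on k v) x))\<^sup>2 \<partial>face_measure F)"
proof -
  have "(L2norm (lebesgue_on T) (\<lambda>x. sqrt (a x) *\<^sub>R grad (poly_on k v T) x))\<^sup>2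
      = (\<integral>x. a x * (norm (grad (poly_on k v T) x))\<^sup>2 \<partial>lebesgue_on T)" if T: "T \<in> \<T>" for T
    unfolding L2norm_sq
    using a_nonneg element(2)[OF T] lebesgue_on_compact(2)[OF element(1)[OF T]]
    by (intro Bochner_Integration.integral_cong) (auto simp: power_mult_distrib)
  moreover have "0 \<le> (\<Sum>T\<in>\<T>. (L2norm (lebesgue_on T) (\<lambda>x. sqrt (a x) *\<^sub>R grad (poly_on k v T) x))\<^sup>2) +
     (\<Sum>F\<in>faces \<T>. \<eta> / h_face \<T> F * (L2norm (face_measure F) (jump \<T> F (poly_on k v)))\<^sup>2)"
    using \<eta> face(3)
    by (intro add_nonneg_nonneg sum_nonneg mult_nonneg_nonneg divide_nonneg_nonneg) (auto intro: less_imp_le)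
  ultimately show ?thesis unfolding dg_norm_def by (simp add: L2norm_sq[of "face_measure F" for F])
qed

lemma dg_norm_star_sq:
  "(dg_norm_star \<T> k a \<eta> v)\<^sup>2 = (dg_norm \<T> k a \<eta> v)\<^sup>2
    + (\<Sum>F\<in>faces \<T>. \<integral>x. h_face \<T> F / \<eta> * (norm (average \<T> F (flux k a v) x))\<^sup>2 \<partial>face_measure F)"
  unfolding dg_norm_star_def
  using \<eta> face(3)
  by (subst real_sqrt_pow2)
    (auto simp: L2norm_sq intro!: add_nonneg_nonneg sum_nonneg mult_nonneg_nonneg divide_nonneg_nonneg
      intro: less_imp_le)

lemma dg_norm_star_nonneg: "0 \<le> dg_norm_star \<T> k a \<eta> v"
  and dg_norm_le_star: "dg_norm \<T> k a \<eta> v \<le> dg_norm_star \<T> k a \<eta> v"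
proof -
  have s: "0 \<le> (\<Sum>F\<in>faces \<T>. h_face \<T> F / \<eta> * (L2norm (face_measure F) (average \<T> F (flux k a v)))\<^sup>2)"
    using \<eta> face(3) by (intro sum_nonneg mult_nonneg_nonneg divide_nonneg_nonneg) (auto intro: less_imp_le)
  then show "0 \<le> dg_norm_star \<T> k a \<eta> v" "dg_norm \<T> k a \<eta> v \<le> dg_norm_star \<T> k a \<eta> v"
    unfolding dg_norm_star_def by (auto intro!: real_le_rsqrt add_nonneg_nonneg)
qed

text \<open>The two consistency terms have opposite signs and cancel on the diagonal, so coercivity
  holds with constant 1 for every positive \<open>\<eta>\<close>.\<close>

lemma nipdg_form_diag:
  "nipdg_form \<T> k a \<eta> v v = (dg_norm \<T> k a \<eta> v)\<^sup>2"
  unfolding dg_norm_sq nipdg_form_alt elem_int_def face_int_def flux_def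
  by (simp add: power2_norm_eq_inner)

text \<open>Young's inequality is applied pointwise with a free parameter \<open>s\<close>, and optimising over \<open>s\<close> at the
  very end replaces the Cauchy-Schwarz inequality for the sum of all integrals.\<close>

lemma nipdg_form_bound:
  assumes g: "continuous_on (closure D) g" "\<And>x. x \<in> closure D \<Longrightarrow> \<bar>g x\<bar> \<le> \<gamma>" and e: "\<bar>e\<bar> \<le> \<epsilon>"
    and V: "w \<in> Vh" "v \<in> Vh"
  shows "\<bar>nipdg_form \<T> k (\<lambda>x. g x * a x) (e * \<eta>) w v\<bar>
    \<le> (\<gamma> + \<epsilon>) * dg_norm_star \<T> k a \<eta> w * dg_norm_star \<T> k a \<eta> v"
proof -
  define K where "K = \<gamma> + \<epsilon>"
  obtain x0 where "x0 \<in> closure D" using closure_D(4) by fastforce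
  then have \<gamma>0: "0 \<le> \<gamma>" using g(2)[of x0] by linarith
  have \<epsilon>0: "0 \<le> \<epsilon>" using e by linarith
  have ga: "continuous_on (closure D) (\<lambda>x. g x * a x)" by (intro continuous_intros g a)
  define qe where "qe v T x = a x * (norm (grad (poly_on k v T) x))\<^sup>2" for v T x
  \<comment> \<open>Integrated, \<open>qe\<close> and \<open>qf\<close> add up to the square of the
    starred norm. Jumps and averages carry reciprocal weights, which cancel in their
    products.\<close>
  define qf where "qf v F x = \<eta> / h_face \<T> F * (norm (jump \<T> F (poly_on k v) x))\<^sup>2
    + h_face \<T> F / \<eta> * (norm (average \<T> F (flux k a v) x))\<^sup>2" for v F x
  have iqe: "integrable (lebesgue_on T) (qe v T)" if "v \<in> Vh" "T \<in> \<T>" for v T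
    unfolding qe_def[abs_def] using that
    by (intro integrable_element continuous_intros continuous_grad continuous_on_subset[OF a] element)
  have iqf1: "integrable (face_measure F) (\<lambda>x. \<eta> / h_face \<T> F * (norm (jump \<T> F (poly_on k v) x))\<^sup>2)"
    if "v \<in> Vh" "F \<in> faces \<T>" for v F
    using that by (intro integrable_face continuous_intros continuous_jump)
  have iqf2: "integrable (face_measure F) (\<lambda>x. h_face \<T> F / \<eta> * (norm (average \<T> F (flux k a v) x))\<^sup>2)"
    if "v \<in> Vh" "F \<in> faces \<T>" for v F
    using that
    by (intro integrable_face continuous_intros continuous_average continuous_on_subset[OF a] face)
  have iqf: "integrable (face_measure F) (qf v F)" if "v \<in> Vh" "F \<in> faces \<T>" for v F
    unfolding qf_def[abs_def] using iqf1[OF that] iqf2[OF that] by simp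
  have star: "(dg_norm_star \<T> k a \<eta> v)\<^sup>2 = (\<Sum>T\<in>\<T>. \<integral>x. qe v T x \<partial>lebesgue_on T)
      + (\<Sum>F\<in>faces \<T>. \<integral>x. qf v F x \<partial>face_measure F)" if "v \<in> Vh" for v
    unfolding dg_norm_star_sq dg_norm_sq qe_def qf_def
    using iqf1[OF that] iqf2[OF that] by (simp add: sum.distrib)
  have e_bound: "\<bar>elem_int (\<lambda>x. g x * a x) w v T x\<bar> \<le> K * (s * qe w T x + qe v T x / s) / 2"
    if s: "0 < s" and T: "T \<in> \<T>" "x \<in> T" for s T x
  proof -
    have x: "x \<in> closure D" using element(2) T by auto
    let ?w = "grad (poly_on k w T) x" and ?v = "grad (poly_on k v T) x"
    have "\<bar>elem_int (\<lambda>x. g x * a x) w v T x\<bar> = \<bar>g x\<bar> * (a x * \<bar>inner ?w ?v\<bar>)"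
      using a_nonneg[OF x] by (simp add: elem_int_def flux_def abs_mult mult.assoc)
    also have "\<dots> \<le> K * (a x * ((s * (norm ?w)\<^sup>2 + (norm ?v)\<^sup>2 / s) / 2))"
      using g(2)[OF x] a_nonneg[OF x] \<gamma>0 \<epsilon>0 s inner_young[OF s, of ?w ?v]
      by (intro mult_mono) (auto simp: K_def)
    also have "\<dots> = K * (s * qe w T x + qe v T x / s) / 2"
      by (simp add: qe_def field_simps)
    finally show ?thesis .
  qed
  have f_bound: "\<bar>face_int (\<lambda>x. g x * a x) (e * \<eta>) w v F x\<bar> \<le> K * (s * qf w F x + qf v F x / s) / 2"
    if s: "0 < s" and F: "F \<in> faces \<T>" "x \<in> F" for s F x
  proof -
    have x: "x \<in> closure D" using face(2) F by auto
    let ?J = "\<lambda>v. jump \<T> F (poly_on k v) x" and ?A = "\<lambda>v. average \<T> F (flux k a v) x"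
    define h where "h = h_face \<T> F"
    have h: "0 < h" using face(3)[OF F(1)] by (simp add: h_def)
    \<comment> \<open>The parameters \<open>s * (\<eta> / h)\<close> and
      \<open>s * (h / \<eta>)\<close> produce exactly the weights of the starred norm.\<close>
    have young: "\<bar>inner (?J w) (?A v)\<bar> \<le> (s * (\<eta> / h * (norm (?J w))\<^sup>2) + h / \<eta> * (norm (?A v))\<^sup>2 / s) / 2"
      "\<bar>inner (?A w) (?J v)\<bar> \<le> (s * (h / \<eta> * (norm (?A w))\<^sup>2) + \<eta> / h * (norm (?J v))\<^sup>2 / s) / 2"
      using inner_young[of "s * (\<eta> / h)" "?J w" "?A v"] inner_young[of "s * (h / \<eta>)" "?A w" "?J v"] s h \<eta>
      by (simp_all add: field_simps)
    have "\<eta> / h * \<bar>inner (?J w) (?J v)\<bar> \<le> \<eta> / h * ((s * (norm (?J w))\<^sup>2 + (norm (?J v))\<^sup>2 / s) / 2)"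
      using inner_young[OF s] h \<eta> by (intro mult_left_mono) auto
    also have "\<dots> = (s * (\<eta> / h * (norm (?J w))\<^sup>2) + \<eta> / h * (norm (?J v))\<^sup>2 / s) / 2"
      using s h by (simp add: field_simps)
    finally have young3: "\<eta> / h * \<bar>inner (?J w) (?J v)\<bar>
        \<le> (s * (\<eta> / h * (norm (?J w))\<^sup>2) + \<eta> / h * (norm (?J v))\<^sup>2 / s) / 2" .
    define Q where "Q = (s * qf w F x + qf v F x / s) / 2"
    have Q: "(s * (\<eta> / h * (norm (?J w))\<^sup>2) + \<eta> / h * (norm (?J v))\<^sup>2 / s) / 2
        + (s * (h / \<eta> * (norm (?A w))\<^sup>2) + h / \<eta> * (norm (?A v))\<^sup>2 / s) / 2 = Q"
      by (simp add: Q_def qf_def h_def distrib_left add_divide_distrib)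
    have nn: "0 \<le> h / \<eta> * (norm (?A w))\<^sup>2" "0 \<le> h / \<eta> * (norm (?A v))\<^sup>2" using h \<eta> by auto
    have "0 \<le> (s * (h / \<eta> * (norm (?A w))\<^sup>2) + h / \<eta> * (norm (?A v))\<^sup>2 / s) / 2"
      using s h \<eta> by auto
    then have Q3: "\<eta> / h * \<bar>inner (?J w) (?J v)\<bar> \<le> Q" using young3 Q by linarith
    \<comment> \<open>Together the two consistency terms use each part of \<open>Q\<close> just
      once, which yields the constant \<open>\<gamma>\<close> and not \<open>2 * \<gamma>\<close>;
      the penalty term adds \<open>\<epsilon>\<close>.\<close>
    have Q12: "\<bar>inner (?A v) (?J w)\<bar> + \<bar>inner (?A w) (?J v)\<bar> \<le> Q"
      using young Q by (simp add: inner_commute add_divide_distrib)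
    have "\<bar>face_int (\<lambda>x. g x * a x) (e * \<eta>) w v F x\<bar>
        = \<bar>g x * (inner (?A v) (?J w) - inner (?A w) (?J v)) + e * (\<eta> / h * inner (?J w) (?J v))\<bar>"
      unfolding face_int_def average_flux_weight by (simp add: h_def algebra_simps)
    also have "\<dots> \<le> \<bar>g x\<bar> * \<bar>inner (?A v) (?J w) - inner (?A w) (?J v)\<bar> + \<bar>e\<bar> * (\<eta> / h * \<bar>inner (?J w) (?J v)\<bar>)"
      using h \<eta> by (intro order_trans[OF abs_triangle_ineq]) (simp add: abs_mult)
    also have "\<dots> \<le> \<gamma> * Q + \<epsilon> * Q"
      using g(2)[OF x] e Q12 Q3 \<gamma>0 \<epsilon>0 h \<eta> by (intro add_mono mult_mono) auto
    also have "\<dots> = K * Q" by (simp only: K_def distrib_right)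
    also have "\<dots> = K * (s * qf w F x + qf v F x / s) / 2"
      by (simp only: Q_def times_divide_eq_right)
    finally show ?thesis .
  qed
  have "\<bar>nipdg_form \<T> k (\<lambda>x. g x * a x) (e * \<eta>) w v\<bar>
      \<le> K * (s * (dg_norm_star \<T> k a \<eta> w)\<^sup>2 + (dg_norm_star \<T> k a \<eta> v)\<^sup>2 / s) / 2" if s: "0 < s" for s
  proof -
    have "\<bar>nipdg_form \<T> k (\<lambda>x. g x * a x) (e * \<eta>) w v\<bar>
      \<le> (\<Sum>T\<in>\<T>. \<integral>x. K * (s * qe w T x + qe v T x / s) / 2 \<partial>lebesgue_on T)
        + (\<Sum>F\<in>faces \<T>. \<integral>x. K * (s * qf w F x + qf v F x / s) / 2 \<partial>face_measure F)"
      unfolding nipdg_form_alt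
    proof (intro order_trans[OF abs_triangle_ineq] add_mono order_trans[OF sum_abs] sum_mono)
      fix T assume T: "T \<in> \<T>"
      show "\<bar>\<integral>x. elem_int (\<lambda>x. g x * a x) w v T x \<partial>lebesgue_on T\<bar>
          \<le> (\<integral>x. K * (s * qe w T x + qe v T x / s) / 2 \<partial>lebesgue_on T)"
        using integrable_elem_int[OF ga V T] iqe[OF V(1) T] iqe[OF V(2) T] e_bound[OF s T]
          lebesgue_on_compact(2)[OF element(1)[OF T]]
        by (intro integral_abs_bound_integral) auto
    next
      fix F assume F: "F \<in> faces \<T>"
      show "\<bar>\<integral>x. face_int (\<lambda>x. g x * a x) (e * \<eta>) w v F x \<partial>face_measure F\<bar>
          \<le> (\<integral>x. K * (s * qf w F x + qf v F x / s) / 2 \<partial>face_measure F)"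
        using integrable_face_int[OF ga V F] iqf[OF V(1) F] iqf[OF V(2) F] f_bound[OF s F] face(5)[OF F]
        by (intro integral_abs_bound_integral) auto
    qed
    also have "(\<Sum>T\<in>\<T>. \<integral>x. K * (s * qe w T x + qe v T x / s) / 2 \<partial>lebesgue_on T)
        = (\<Sum>T\<in>\<T>. K / 2 * (s * (\<integral>x. qe w T x \<partial>lebesgue_on T) + (\<integral>x. qe v T x \<partial>lebesgue_on T) / s))"
      using iqe V by (intro sum.cong refl) (simp add: algebra_simps)
    also have "(\<Sum>F\<in>faces \<T>. \<integral>x. K * (s * qf w F x + qf v F x / s) / 2 \<partial>face_measure F)
        = (\<Sum>F\<in>faces \<T>. K / 2 * (s * (\<integral>x. qf w F x \<partial>face_measure F) + (\<integral>x. qf v F x \<partial>face_measure F) / s))"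
      using iqf V by (intro sum.cong refl) (simp add: algebra_simps)
    finally show ?thesis
      unfolding star[OF V(1)] star[OF V(2)]
      by (simp add: sum.distrib algebra_simps add_divide_distrib flip: sum_distrib_left sum_divide_distrib)
  qed
  from young_scaled[OF this] show ?thesis
    using \<gamma>0 \<epsilon>0 dg_norm_star_nonneg by (simp add: K_def)
qed

text \<open>A lower bound of both coefficient and penalty factors out of both sums. This links the
  parameter-free norm of the Poincare-type inequality to the energy norm.\<close>

lemma broken_norm_bound:
  assumes m: "0 < m" "\<And>x. x \<in> closure D \<Longrightarrow> m \<le> a x" "m \<le> \<eta>" and v: "v \<in> Vh"
  shows "broken_norm \<T> k v \<le> dg_norm \<T> k a \<eta> v / sqrt m"
proof -
  have "m * ((\<Sum>T\<in>\<T>. (L2norm (lebesgue_on T) (grad (poly_on k v T)))\<^sup>2) +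
     (\<Sum>F\<in>faces \<T>. 1 / h_face \<T> F * (L2norm (face_measure F) (jump \<T> F (poly_on k v)))\<^sup>2))
     \<le> (dg_norm \<T> k a \<eta> v)\<^sup>2"
    unfolding dg_norm_sq distrib_left sum_distrib_left
  proof (intro add_mono sum_mono)
    fix T assume T: "T \<in> \<T>"
    have "(\<integral>x. m * (norm (grad (poly_on k v T) x))\<^sup>2 \<partial>lebesgue_on T)
        \<le> (\<integral>x. a x * (norm (grad (poly_on k v T) x))\<^sup>2 \<partial>lebesgue_on T)"
    proof (rule integral_mono)
      show "integrable (lebesgue_on T) (\<lambda>x. m * (norm (grad (poly_on k v T) x))\<^sup>2)"
        "integrable (lebesgue_on T) (\<lambda>x. a x * (norm (grad (poly_on k v T) x))\<^sup>2)"
        using T v by (intro integrable_element continuous_intros continuous_grad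
            continuous_on_subset[OF a] element; simp)+
      show "m * (norm (grad (poly_on k v T) x))\<^sup>2 \<le> a x * (norm (grad (poly_on k v T) x))\<^sup>2"
        if "x \<in> space (lebesgue_on T)" for x
        using that m(2) element(2)[OF T] lebesgue_on_compact(2)[OF element(1)[OF T]]
        by (intro mult_right_mono) auto
    qed
    then show "m * (L2norm (lebesgue_on T) (grad (poly_on k v T)))\<^sup>2
        \<le> (\<integral>x. a x * (norm (grad (poly_on k v T) x))\<^sup>2 \<partial>lebesgue_on T)"
      by (simp add: L2norm_sq)
  next
    fix F assume F: "F \<in> faces \<T>"
    have "m * (1 / h_face \<T> F * (L2norm (face_measure F) (jump \<T> F (poly_on k v)))\<^sup>2)
        \<le> \<eta> / h_face \<T> F * (L2norm (face_measure F) (jump \<T> F (poly_on k v)))\<^sup>2"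
      using m(3) face(3)[OF F] by (simp add: mult_right_mono divide_right_mono)
    then show "m * (1 / h_face \<T> F * (L2norm (face_measure F) (jump \<T> F (poly_on k v)))\<^sup>2)
        \<le> (\<integral>x. \<eta> / h_face \<T> F * (norm (jump \<T> F (poly_on k v) x))\<^sup>2 \<partial>face_measure F)"
      by (simp add: L2norm_sq)
  qed
  then have "sqrt m * broken_norm \<T> k v \<le> dg_norm \<T> k a \<eta> v"
    unfolding broken_norm_def real_sqrt_mult[symmetric]
    using dg_norm_nonneg[OF \<eta>] by (intro real_le_lsqrt) auto
  then show ?thesis using m(1) by (simp add: pos_le_divide_eq mult.commute)
qed

end

end

text \<open>Same device as for the form: Young's inequality with a free \<open>s\<close>, optimised
  after integration.\<close>

lemma L2norm_Cauchy_Schwarz: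
  fixes M :: "'a::euclidean_space measure"
  assumes f: "f \<in> L2 M" and v: "v \<in> L2 M"
  shows "\<bar>\<integral>x. f x * v x \<partial>M\<bar> \<le> L2norm M f * L2norm M v"
proof -
  have m: "f \<in> borel_measurable M" "v \<in> borel_measurable M"
    and i: "integrable M (\<lambda>x. (f x)\<^sup>2)" "integrable M (\<lambda>x. (v x)\<^sup>2)"
    using assms by (auto simp: L2_def)
  have b: "\<bar>f x * v x\<bar> \<le> (s * (f x)\<^sup>2 + (v x)\<^sup>2 / s) / 2" if "0 < s" for s x
    using inner_young[OF that, of "f x" "v x"] by simp
  have ib: "integrable M (\<lambda>x. (s * (f x)\<^sup>2 + (v x)\<^sup>2 / s) / 2)" for s using i by simp
  have fv: "integrable M (\<lambda>x. f x * v x)"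
  proof (rule Bochner_Integration.integrable_bound[OF ib[of 1]])
    show "AE x in M. norm (f x * v x) \<le> norm ((1 * (f x)\<^sup>2 + (v x)\<^sup>2 / 1) / 2)"
      using b[of 1] by (intro AE_I2) (auto intro: order_trans[OF _ abs_ge_self])
  qed (use m in measurable)
  have "\<bar>\<integral>x. f x * v x \<partial>M\<bar> \<le> 1 * (s * (L2norm M f)\<^sup>2 + (L2norm M v)\<^sup>2 / s) / 2" if s: "0 < s" for s
  proof -
    have "\<bar>\<integral>x. f x * v x \<partial>M\<bar> \<le> (\<integral>x. (s * (f x)\<^sup>2 + (v x)\<^sup>2 / s) / 2 \<partial>M)"
      by (rule integral_abs_bound_integral[OF fv ib]) (rule b[OF s])
    then show ?thesis using i by (simp add: L2norm_sq)
  qed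
  from young_scaled[OF this] show ?thesis by (simp add: L2norm_def)
qed

section \<open>A finite spanning set of the discrete space\<close>

context dg_mesh
begin

text \<open>A monomial cut off to one element. Elements are closed, so it may be nonzero on the
  boundary of a neighbour, but only on a null set; the polynomial seen there is zero.\<close>

definition basis_fun :: "(real^'d) set \<Rightarrow> ('d \<Rightarrow> nat) \<Rightarrow> real^'d \<Rightarrow> real" where
  "basis_fun T \<alpha> x = indicator T x * (\<Prod>i\<in>UNIV. x $ i ^ \<alpha> i)"

lemma
  assumes T: "T \<in> \<T>" and \<alpha>: "sum \<alpha> UNIV \<le> k"
  shows basis_fun_in: "basis_fun T \<alpha> \<in> Vh"
    and poly_on_basis_fun: "T' \<in> \<T> \<Longrightarrow>
      poly_on k (basis_fun T \<alpha>) T' = (\<lambda>x. if T' = T then \<Prod>i\<in>UNIV. x $ i ^ \<alpha> i else 0)"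
proof -
  let ?m = "\<lambda>x::real^'d. \<Prod>i\<in>UNIV. x $ i ^ \<alpha> i"
  let ?q = "\<lambda>T' x. if T' = T then ?m x else 0"
  have q: "?q T' \<in> polys k" for T'
    using polys_monomial[OF \<alpha>] polys_zero by (cases "T' = T") auto
  have ae: "AE x in lebesgue_on T'. basis_fun T \<alpha> x = ?q T' x" if T': "T' \<in> \<T>" for T'
  proof (cases "T' = T")
    case True
    then show ?thesis
      by (intro AE_I2) (auto simp: basis_fun_def space_restrict_space)
  next
    case False
    have "T' \<inter> T \<subseteq> frontier T' \<union> frontier T"
    proof
      fix x assume x: "x \<in> T' \<inter> T"
      have "interior T' \<inter> interior T = {}"
        using mesh T T' False unfolding polyhedral_mesh_def by blast
      then show "x \<in> frontier T' \<union> frontier T"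
        using x closure_subset unfolding frontier_def by fastforce
    qed
    then have "negligible (T' \<inter> T)"
      using element(6)[OF T] element(6)[OF T'] negligible_Un negligible_subset by blast
    then have "AE x in lebesgue. x \<notin> T' \<inter> T"
      by (intro AE_not_in) (simp add: negligible_iff_null_sets)
    then have "AE x in lebesgue. x \<in> T' \<longrightarrow> basis_fun T \<alpha> x = ?q T' x"
      by eventually_elim (use False in \<open>auto simp: basis_fun_def\<close>)
    then show ?thesis using element(3)[OF T'] by (subst AE_restrict_space_iff) auto
  qed
  have cm: "continuous_on T ?m" by (intro continuous_intros)
  have mono: "?m \<in> borel_measurable borel"
    by (intro borel_measurable_continuous_onI continuous_intros)
  have "T \<in> sets borel" using element(1)[OF T] by (simp add: borel_compact)
  then have "basis_fun T \<alpha> \<in> borel_measurable borel"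
    unfolding basis_fun_def[abs_def] using mono by measurable
  then have bm: "basis_fun T \<alpha> \<in> borel_measurable (lebesgue_on D)"
    by (intro measurable_restrict_space1 measurable_completion) simp
  obtain C where C: "\<And>x. x \<in> T \<Longrightarrow> \<bar>?m x\<bar> \<le> C"
    using compact_imp_bounded[OF compact_continuous_image[OF cm element(1)[OF T]]]
    unfolding bounded_iff by auto
  have fin: "finite_measure (lebesgue_on D)"
    using closure_D by (intro finite_measure_lebesgue_on bounded_set_imp_lmeasurable) auto
  have "(basis_fun T \<alpha> x)\<^sup>2 \<le> C\<^sup>2" for x
    using C[of x] by (auto simp: basis_fun_def indicator_def intro: abs_le_square_iff[THEN iffD1])
  then have "integrable (lebesgue_on D) (\<lambda>x. (basis_fun T \<alpha> x)\<^sup>2)"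
    using bm by (intro finite_measure.integrable_const_bound[OF fin, of _ "C\<^sup>2"]) auto
  moreover have "\<exists>q\<in>polys k. AE x in lebesgue_on T'. basis_fun T \<alpha> x = q x" if "T' \<in> \<T>" for T'
    using ae[OF that] by (rule bexI[OF _ q])
  ultimately show "basis_fun T \<alpha> \<in> Vh" using bm by (simp add: dg_space_def L2_def)
  show "poly_on k (basis_fun T \<alpha>) T' = ?q T'" if T': "T' \<in> \<T>"
    by (rule poly_on_eqI[OF q ae[OF T'] element(3,4)[OF T']])
qed

lemma poly_on_sum:
  fixes b :: "'i \<Rightarrow> real^'d \<Rightarrow> real" and c :: "'i \<Rightarrow> real"
  assumes "finite I" "\<And>i. i \<in> I \<Longrightarrow> b i \<in> Vh" "T \<in> \<T>"
  shows "(\<Sum>i\<in>I. c i *\<^sub>R b i) \<in> Vh \<and> poly_on k (\<Sum>i\<in>I. c i *\<^sub>R b i) T = (\<lambda>x. \<Sum>i\<in>I. c i * poly_on k (b i) T x)"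
  using assms(1,2)
proof (induction I rule: finite_induct)
  case empty
  have "poly_on k (0 :: real^'d \<Rightarrow> real) T = (\<lambda>_. 0)"
    using element[OF assms(3)] polys_zero by (intro poly_on_eqI) auto
  then show ?case using subspace_0[OF subspace_dg_space] by (simp only: sum.empty)
next
  case (insert i I)
  have IH: "(\<Sum>i\<in>I. c i *\<^sub>R b i) \<in> Vh"
    "poly_on k (\<Sum>i\<in>I. c i *\<^sub>R b i) T = (\<lambda>x. \<Sum>i\<in>I. c i * poly_on k (b i) T x)"
    using insert.IH insert.prems by blast+
  have bi: "b i \<in> Vh" using insert.prems by blast
  have eq: "(\<Sum>i\<in>insert i I. c i *\<^sub>R b i) = c i *\<^sub>R b i + 1 *\<^sub>R (\<Sum>i\<in>I. c i *\<^sub>R b i)"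
    by (simp only: sum.insert[OF insert.hyps] scaleR_one)
  show ?case
    unfolding eq poly_on_lincomb[OF bi IH(1) assms(3)] IH(2)
    using dg_space_lincomb[OF bi IH(1)] by (simp only: sum.insert[OF insert.hyps] mult_1)
qed

definition basis_set :: "(real^'d \<Rightarrow> real) set" where
  "basis_set = (\<lambda>(T, \<alpha>). basis_fun T \<alpha>) ` (\<T> \<times> {\<alpha>. sum \<alpha> UNIV \<le> k})"

lemma basis_set: "finite basis_set" "basis_set \<subseteq> Vh"
  using finite_mesh finite_multidegrees basis_fun_in by (auto simp: basis_set_def)

text \<open>Only the polynomials are matched: \<open>v\<close> is free on null sets and need not
  itself lie in the span.\<close>

lemma basis_set_spans:
  assumes v: "v \<in> Vh"
  shows "\<exists>w\<in>span basis_set. \<forall>T\<in>\<T>. poly_on k w T = poly_on k v T"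
proof -
  let ?A = "{\<alpha>::'d \<Rightarrow> nat. sum \<alpha> UNIV \<le> k}"
  have "\<forall>T\<in>\<T>. \<exists>c. poly_on k v T = (\<lambda>x. \<Sum>\<alpha>\<in>?A. c \<alpha> * (\<Prod>i\<in>UNIV. x $ i ^ \<alpha> i))"
    using poly_on(1)[OF v] unfolding polys_def by auto
  then obtain c where c: "\<And>T. T \<in> \<T> \<Longrightarrow>
      poly_on k v T = (\<lambda>x. \<Sum>\<alpha>\<in>?A. c T \<alpha> * (\<Prod>i\<in>UNIV. x $ i ^ \<alpha> i))"
    using bchoice[where Q = "\<lambda>T c. poly_on k v T = (\<lambda>x. \<Sum>\<alpha>\<in>?A. c \<alpha> * (\<Prod>i\<in>UNIV. x $ i ^ \<alpha> i))"]
    by blast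
  let ?c = "\<lambda>i. c (fst i) (snd i)" and ?b = "\<lambda>i. basis_fun (fst i) (snd i)"
  define w where "w = (\<Sum>i\<in>\<T> \<times> ?A. ?c i *\<^sub>R ?b i)"
  have "w \<in> span basis_set"
    unfolding w_def basis_set_def by (intro span_sum span_scale span_base) auto
  moreover have "poly_on k w T = poly_on k v T" if T: "T \<in> \<T>" for T
  proof
    fix x :: "real^'d"
    let ?m = "\<lambda>\<alpha>. \<Prod>i\<in>UNIV. x $ i ^ \<alpha> i"
    have "poly_on k w T = (\<lambda>x. \<Sum>i\<in>\<T> \<times> ?A. ?c i * poly_on k (?b i) T x)"
      unfolding w_def
      using finite_cartesian_product[OF finite_mesh finite_multidegrees] T
      by (intro poly_on_sum[THEN conjunct2]) (auto intro: basis_fun_in)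
    then have "poly_on k w T x = (\<Sum>i\<in>\<T> \<times> ?A. ?c i * poly_on k (?b i) T x)" by simp
    also have "\<dots> = (\<Sum>i\<in>\<T> \<times> ?A. if fst i = T then ?c i * ?m (snd i) else 0)"
    proof (intro sum.cong refl)
      fix i assume "i \<in> \<T> \<times> ?A"
      then have i: "fst i \<in> \<T>" "sum (snd i) UNIV \<le> k" by auto
      show "?c i * poly_on k (?b i) T x = (if fst i = T then ?c i * ?m (snd i) else 0)"
        unfolding poly_on_basis_fun[OF i T] by (cases "T = fst i") simp_all
    qed
    also have "\<dots> = (\<Sum>T'\<in>\<T>. \<Sum>\<alpha>\<in>?A. if T' = T then c T' \<alpha> * ?m \<alpha> else 0)"
      by (simp only: sum.cartesian_product case_prod_unfold)
    also have "\<dots> = (\<Sum>T'\<in>\<T>. if T' = T then \<Sum>\<alpha>\<in>?A. c T' \<alpha> * ?m \<alpha> else 0)"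
      by (intro sum.cong refl) simp
    also have "\<dots> = poly_on k v T x" using T finite_mesh by (simp add: c[OF T])
    finally show "poly_on k w T x = poly_on k v T x" .
  qed
  ultimately show ?thesis by blast
qed

lemma dg_norm_zero:
  assumes z: "\<And>T. T \<in> \<T> \<Longrightarrow> poly_on k v T = (\<lambda>_. 0)"
  shows "dg_norm \<T> k a \<eta> v = 0"
proof -
  have g: "grad (\<lambda>_. 0) x = 0" for x :: "real^'d" by (rule grad_eqI[OF GDERIV_const])
  have "jump \<T> F (poly_on k v) = (\<lambda>_. 0)" for F
    using z by (auto simp: jump_def fun_eq_iff adjacent_def intro!: sum.neutral)
  then show ?thesis by (simp add: dg_norm_def z g L2norm_def cong: sum.cong)
qed

end

section \<open>The lognormal coefficient\<close>

text \<open>Continuity makes the set of violation open, so the essential bound holds at every point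
  of \<open>D\<close> and then on the closure. Faces are null sets, and an almost-everywhere bound
  would say nothing about face integrals.\<close>

lemma Linf_norm_bound:
  fixes D :: "('a::euclidean_space) set" and v :: "'a \<Rightarrow> 'b::euclidean_space"
  assumes v: "v \<in> Linf D" "continuous_on (closure D) v" and D: "open D" and x: "x \<in> closure D"
  shows "norm (v x) \<le> Linf_norm D v"
proof -
  let ?e = "esssup (lebesgue_on D) (\<lambda>x. ereal (norm (v x)))"
  have "?e < \<infinity>" using v(1) by (simp add: Linf_def)
  have ae: "AE x in lebesgue_on D. norm (v x) \<le> Linf_norm D v"
    using esssup_AE[of "\<lambda>x. ereal (norm (v x))" "lebesgue_on D"]
  proof eventually_elim
    case (elim x)
    with \<open>?e < \<infinity>\<close> show ?case unfolding Linf_norm_def by (cases ?e) auto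
  qed
  have cD: "continuous_on D (\<lambda>x. norm (v x))"
    using v(2) closure_subset by (intro continuous_on_norm) (rule continuous_on_subset)
  have D': "norm (v z) \<le> Linf_norm D v" if "z \<in> D" for z
  proof (rule AE_lebesgue_on_open[OF _ order_refl _ ae that])
    have "open (D \<inter> (\<lambda>x. norm (v x)) -` {Linf_norm D v<..})"
      using cD D by (rule continuous_open_preimage) simp
    then show "open {x \<in> D. \<not> norm (v x) \<le> Linf_norm D v}"
      by (simp add: Int_def vimage_def not_le)
  qed (use D in auto)
  show ?thesis using continuous_on_closure_norm_le[OF v(2) _ x] D' by blast
qed

lemma exp_minus_linear_bound:
  fixes z :: real
  assumes "\<bar>z\<bar> \<le> 1"
  shows "\<bar>exp z - 1 - z\<bar> \<le> z\<^sup>2"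
proof (rule abs_leI)
  show "exp z - 1 - z \<le> z\<^sup>2"
  proof (cases "0 \<le> z")
    case True
    then show ?thesis using exp_bound[of z] assms by simp
  next
    case False
    \<comment> \<open>For negative \<open>z\<close> the bound rests on
      \<open>1 + (- z) \<le> exp (- z)\<close> and
      \<open>(1 + z + z\<^sup>2) * (1 - z) = 1 - z ^ 3\<close>.\<close>
    have "exp z \<le> 1 / (1 + (- z))"
      using exp_ge_add_one_self[of "- z"] False by (simp add: exp_minus field_simps)
    also have "\<dots> \<le> 1 + z + z\<^sup>2"
    proof -
      have "1 \<le> (1 + z + z\<^sup>2) * (1 + (- z))"
      proof -
        have "(1 + z + z\<^sup>2) * (1 + (- z)) = 1 - z ^ 3" by (simp add: algebra_simps power2_eq_square power3_eq_cube)
        moreover have "z ^ 3 \<le> 0" using False by (simp add: power3_eq_cube mult_nonneg_nonpos)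
        ultimately show ?thesis by simp
      qed
      then show ?thesis using False by (simp add: pos_divide_le_eq)
    qed
    finally show ?thesis by simp
  qed
  have "- (exp z - 1 - z) \<le> 0" using exp_ge_add_one_self[of z] by linarith
  then show "- (exp z - 1 - z) \<le> z\<^sup>2" using zero_le_power2[of z] by linarith
qed

lemma
  fixes f f' :: "nat \<Rightarrow> real"
  assumes f: "summable f" and eq: "\<And>i. i \<noteq> j \<Longrightarrow> f' i = f i"
  shows summable_update: "summable f'" and suminf_update: "suminf f' = suminf f + (f' j - f j)"
proof -
  have "(\<lambda>i. if i = j then f' i - f i else 0) sums (f' j - f j)" by (rule sums_single)
  from sums_add[OF summable_sums[OF f] this] have "f' sums (suminf f + (f' j - f j))"
    by (rule sums_cong[THEN iffD1, rotated]) (use eq in auto)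
  then show "summable f'" "suminf f' = suminf f + (f' j - f j)"
    using sums_iff by auto
qed

locale lognormal =
  fixes D :: "(real^'d::finite) set" and a0 :: "real^'d \<Rightarrow> real" and \<psi> :: "nat \<Rightarrow> real^'d \<Rightarrow> real"
  assumes domain: "convex_polyhedral_domain D"
    and a0: "a0 \<in> W1inf D" "0 < min_cl D a0" "bdd_above (a0 ` closure D)"
    and \<psi>: "\<And>j. \<psi> j \<in> W1inf D"
begin

abbreviation "\<beta> \<equiv> beta D \<psi>"
abbreviation "U \<equiv> U_beta \<beta>"
abbreviation "A \<equiv> lognormal_coeff a0 \<psi>"
abbreviation "H \<equiv> penalty D a0 \<psi>"

lemma D: "open D" "D \<noteq> {}" "compact (closure D)"
  using domain unfolding convex_polyhedral_domain_def by (auto simp: compact_closure)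

lemma \<psi>_continuous: "continuous_on (closure D) (\<psi> j)"
  using \<psi> by (simp add: W1inf_def)

lemma a0_continuous: "continuous_on (closure D) a0"
  using a0 by (simp add: W1inf_def)

lemma \<psi>_le: "x \<in> closure D \<Longrightarrow> \<bar>\<psi> j x\<bar> \<le> \<beta> j"
  using Linf_norm_bound[of "\<psi> j" D x] \<psi>[of j] D by (simp add: W1inf_def beta_def)

lemma \<beta>_nonneg: "0 \<le> \<beta> j"
proof -
  obtain x where "x \<in> closure D" using D(2) by fastforce
  from \<psi>_le[OF this, of j] show ?thesis by linarith
qed

lemma a0_ge: "x \<in> closure D \<Longrightarrow> min_cl D a0 \<le> a0 x"
  unfolding min_cl_def
  by (rule cINF_lower[OF bounded_imp_bdd_below])
    (auto intro: compact_imp_bounded compact_continuous_image a0_continuous D)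

lemma min_le_max: "min_cl D a0 \<le> max_cl D a0"
proof -
  obtain x where x: "x \<in> closure D" using D(2) by fastforce
  have "a0 x \<le> max_cl D a0" unfolding max_cl_def by (rule cSUP_upper[OF x a0(3)])
  with a0_ge[OF x] show ?thesis by simp
qed

lemma U_upd: "y \<in> U \<Longrightarrow> y(j := t) \<in> U"
  unfolding U_beta_def by (auto intro: summable_update[of _ j])

lemma term_le:
  assumes "x \<in> closure D"
  shows "\<bar>y j * \<psi> j x\<bar> \<le> \<beta> j * \<bar>y j\<bar>"
  using mult_left_mono[OF \<psi>_le[OF assms, of j] abs_ge_zero[of "y j"]] by (simp add: abs_mult mult.commute)

lemma summable_U: "y \<in> U \<Longrightarrow> summable (\<lambda>j. \<beta> j * \<bar>y j\<bar>)"
  by (simp add: U_beta_def)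

lemma summable_term:
  assumes "y \<in> U" "x \<in> closure D"
  shows "summable (\<lambda>j. y j * \<psi> j x)"
  using summable_U[OF assms(1)] by (rule summable_comparison_test'[of _ 0]) (use term_le[OF assms(2)] in auto)

lemma A_continuous:
  assumes y: "y \<in> U"
  shows "continuous_on (closure D) (A y)"
proof -
  have "uniform_limit (closure D) (\<lambda>n x. \<Sum>j<n. y j * \<psi> j x) (\<lambda>x. \<Sum>j. y j * \<psi> j x) sequentially"
    by (rule Weierstrass_m_test[OF _ summable_U[OF y]]) (use term_le in auto)
  then have "continuous_on (closure D) (\<lambda>x. \<Sum>j. y j * \<psi> j x)"
    by (rule uniform_limit_theorem[rotated]) (auto intro!: always_eventually continuous_intros \<psi>_continuous)
  then show ?thesis
    unfolding lognormal_coeff_def[abs_def] by (intro continuous_intros a0_continuous)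
qed

lemma a_min_pos: "0 < a_min D a0 \<psi> y"
  using a0(2) by (simp add: a_min_def)

lemma A_ge:
  assumes y: "y \<in> U" and x: "x \<in> closure D"
  shows "a_min D a0 \<psi> y \<le> A y x"
proof -
  have "\<bar>\<Sum>j. y j * \<psi> j x\<bar> \<le> (\<Sum>j. \<beta> j * \<bar>y j\<bar>)"
    using norm_suminf_le[OF _ summable_U[OF y], of "\<lambda>j. y j * \<psi> j x"] term_le[OF x] by simp
  then have "- (\<Sum>j. \<bar>y j\<bar> * \<beta> j) \<le> (\<Sum>j. y j * \<psi> j x)" by (simp add: mult.commute)
  then show ?thesis
    unfolding a_min_def lognormal_coeff_def using a0(2) a0_ge[OF x] by (intro mult_mono) auto
qed

lemma A_nonneg: "y \<in> U \<Longrightarrow> x \<in> closure D \<Longrightarrow> 0 \<le> A y x"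
  using A_ge a_min_pos less_imp_le order_trans by blast

lemma H_pos: "0 < H y"
  using a0(2) min_le_max by (simp add: penalty_def)

text \<open>The exponential factors and the factors built from minimum and maximum compare
  separately. The result serves as the condition \<open>m \<le> \<eta>\<close> of
  \<open>broken_norm_bound\<close>.\<close>

lemma H_ge:
  assumes y: "y \<in> U"
  shows "a_min D a0 \<psi> y \<le> H y"
proof -
  have s: "0 \<le> (\<Sum>j. \<beta> j * \<bar>y j\<bar>)" by (intro suminf_nonneg summable_U y mult_nonneg_nonneg \<beta>_nonneg) auto
  have "(\<Sum>j. 3 * \<beta> j * \<bar>y j\<bar>) = 3 * (\<Sum>j. \<beta> j * \<bar>y j\<bar>)"
    using suminf_mult[OF summable_U[OF y], of 3] by (simp add: mult.assoc)
  then have "exp (- (\<Sum>j. \<bar>y j\<bar> * \<beta> j)) \<le> exp (\<Sum>j. 3 * \<beta> j * \<bar>y j\<bar>)"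
    using s by (simp add: mult.commute)
  moreover have "min_cl D a0 \<le> (max_cl D a0)\<^sup>2 / min_cl D a0"
    using a0(2) min_le_max mult_mono[OF min_le_max min_le_max] by (simp add: pos_le_divide_eq power2_eq_square)
  ultimately show ?thesis
    unfolding a_min_def penalty_def using a0(2) by (intro mult_mono) auto
qed

lemma A_update:
  assumes y: "y \<in> U" and x: "x \<in> closure D"
  shows "A (y(j := y j + t)) x = exp (t * \<psi> j x) * A y x"
proof -
  have "(\<Sum>i. (y(j := y j + t)) i * \<psi> i x) = (\<Sum>i. y i * \<psi> i x) + t * \<psi> j x"
    using suminf_update[OF summable_term[OF y x], of j "\<lambda>i. (y(j := y j + t)) i * \<psi> i x"]
    by (simp add: algebra_simps)
  then show ?thesis by (simp add: lognormal_coeff_def exp_add)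
qed

text \<open>For such \<open>t\<close> the coordinate keeps its sign, so its absolute value is affine
  in \<open>t\<close> and the penalty an exact exponential.\<close>

lemma H_update:
  assumes y: "y \<in> U" and t: "\<bar>t\<bar> < \<bar>y j\<bar>"
  shows "H (y(j := y j + t)) = exp (t * (3 * \<beta> j * sgn (y j))) * H y"
proof -
  have "summable (\<lambda>i. 3 * \<beta> i * \<bar>y i\<bar>)"
    using summable_mult[OF summable_U[OF y], of 3] by (simp add: mult.assoc)
  from suminf_update[OF this, of j "\<lambda>i. 3 * \<beta> i * \<bar>(y(j := y j + t)) i\<bar>"]
  have "(\<Sum>i. 3 * \<beta> i * \<bar>(y(j := y j + t)) i\<bar>)
      = (\<Sum>i. 3 * \<beta> i * \<bar>y i\<bar>) + 3 * \<beta> j * (\<bar>y j + t\<bar> - \<bar>y j\<bar>)"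
    by (simp add: algebra_simps)
  also have "\<bar>y j + t\<bar> - \<bar>y j\<bar> = t * sgn (y j)"
    using t by (auto simp: sgn_if abs_if split: if_splits)
  finally show ?thesis by (simp add: penalty_def exp_add mult_ac)
qed

end

section \<open>The lognormal discontinuous Galerkin problem\<close>

locale lognormal_dg = lognormal D a0 \<psi> + dg_mesh D \<T> k
  for D :: "(real^'d::finite) set" and a0 \<psi> \<T> k +
  fixes f :: "real^'d \<Rightarrow> real" and u :: "(nat \<Rightarrow> real) \<Rightarrow> real^'d \<Rightarrow> real" and C\<^sub>e \<sigma> :: real
  assumes f: "f \<in> L2 (lebesgue_on D)"
    and dg_sol: "\<And>y. y \<in> U \<Longrightarrow> dg_solution D \<T> k (A y) (H y) f (u y)"
    and C\<^sub>e: "0 < C\<^sub>e" "\<And>y v. y \<in> U \<Longrightarrow> v \<in> Vh \<Longrightarrow>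
      dg_norm_star \<T> k (A y) (H y) v \<le> C\<^sub>e * dg_norm \<T> k (A y) (H y) v"
    and \<sigma>: "0 < \<sigma>" "\<And>v. v \<in> Vh \<Longrightarrow> L2norm (lebesgue_on D) v \<le> \<sigma> * broken_norm \<T> k v"
begin

definition N :: "(nat \<Rightarrow> real) \<Rightarrow> (real^'d \<Rightarrow> real) \<Rightarrow> real" where
  "N y v = dg_norm \<T> k (A y) (H y) v"

definition B :: "nat set \<Rightarrow> (nat \<Rightarrow> real) \<Rightarrow> (real^'d \<Rightarrow> real) \<Rightarrow> (real^'d \<Rightarrow> real) \<Rightarrow> real" where
  "B R y w v = nipdg_form \<T> k (\<lambda>x. (\<Prod>j\<in>R. \<psi> j x) * A y x) ((\<Prod>j\<in>R. 3 * \<beta> j * sgn (y j)) * H y) w v"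

text \<open>The first product bounds the weight of the coefficient, the second that of the penalty,
  and \<open>C\<^sub>e\<^sup>2\<close> pays for two starred norms. At the empty set the value is
  \<open>2 * C\<^sub>e\<^sup>2\<close>, so the comparison with powers of 4 is confined to nonempty
  \<open>R\<close>.\<close>

definition K :: "nat set \<Rightarrow> real" where
  "K R = ((\<Prod>j\<in>R. \<beta> j) + (\<Prod>j\<in>R. 3 * \<beta> j)) * C\<^sub>e\<^sup>2"

lemma N_nonneg: "0 \<le> N y v"
  unfolding N_def by (rule dg_norm_nonneg[OF H_pos])

lemma form_bound:
  assumes y: "y \<in> U" and g: "continuous_on (closure D) g" "\<And>x. x \<in> closure D \<Longrightarrow> \<bar>g x\<bar> \<le> \<gamma>"
    and e: "\<bar>e\<bar> \<le> \<epsilon>" and V: "w \<in> Vh" "v \<in> Vh"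
  shows "\<bar>nipdg_form \<T> k (\<lambda>x. g x * A y x) (e * H y) w v\<bar> \<le> (\<gamma> + \<epsilon>) * C\<^sub>e\<^sup>2 * N y w * N y v"
proof -
  obtain x where "x \<in> closure D" using D(2) by fastforce
  then have ge: "0 \<le> \<gamma> + \<epsilon>" using g(2)[of x] e by linarith
  have "\<bar>nipdg_form \<T> k (\<lambda>x. g x * A y x) (e * H y) w v\<bar>
      \<le> (\<gamma> + \<epsilon>) * dg_norm_star \<T> k (A y) (H y) w * dg_norm_star \<T> k (A y) (H y) v"
    by (rule nipdg_form_bound[OF A_continuous[OF y] A_nonneg[OF y] H_pos g e V])
  also have "\<dots> = (\<gamma> + \<epsilon>) * (dg_norm_star \<T> k (A y) (H y) w * dg_norm_star \<T> k (A y) (H y) v)"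
    by simp
  also have "\<dots> \<le> (\<gamma> + \<epsilon>) * ((C\<^sub>e * N y w) * (C\<^sub>e * N y v))"
    unfolding N_def
    using ge C\<^sub>e V y dg_norm_star_nonneg[OF A_continuous[OF y] A_nonneg[OF y] H_pos] dg_norm_nonneg[OF H_pos]
    by (intro mult_left_mono mult_mono) auto
  finally show ?thesis by (simp add: power2_eq_square mult_ac)
qed

lemma abs_prod_\<psi>_le: "x \<in> closure D \<Longrightarrow> \<bar>\<Prod>j\<in>R. \<psi> j x\<bar> \<le> (\<Prod>j\<in>R. \<beta> j)"
  unfolding abs_prod by (intro prod_mono conjI \<psi>_le) auto

lemma abs_prod_sgn_le: "\<bar>\<Prod>j\<in>R. 3 * \<beta> j * sgn (y j)\<bar> \<le> (\<Prod>j\<in>R. 3 * \<beta> j)" for y :: "nat \<Rightarrow> real"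
  unfolding abs_prod
  using \<beta>_nonneg by (intro prod_mono) (auto simp: abs_mult abs_sgn_eq)

lemma prod_\<psi>_continuous: "continuous_on (closure D) (\<lambda>x. \<Prod>j\<in>R. \<psi> j x)"
  by (intro continuous_intros \<psi>_continuous)

lemma weight_continuous: "y \<in> U \<Longrightarrow> continuous_on (closure D) (\<lambda>x. (\<Prod>j\<in>R. \<psi> j x) * A y x)"
  by (intro continuous_intros prod_\<psi>_continuous A_continuous)

text \<open>The remainder is again a form of the same kind: coefficient and penalty are each
  multiplied by the quadratic remainder of an exponential, so \<open>form_bound\<close>
  applies.\<close>

lemma B_remainder:
  assumes y: "y \<in> U" and yj: "y j \<noteq> 0" and R: "finite R" "j \<notin> R"
  shows "\<exists>L \<delta>. 0 < \<delta> \<and> (\<forall>t w v. \<bar>t\<bar> < \<delta> \<longrightarrow> w \<in> Vh \<longrightarrow> v \<in> Vh \<longrightarrow>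
    \<bar>B R (y(j := y j + t)) w v - B R y w v - t * B (insert j R) y w v\<bar> \<le> L * t\<^sup>2 * N y w * N y v)"
proof -
  define P where "P x = (\<Prod>i\<in>R. \<psi> i x)" for x
  define e where "e = (\<Prod>i\<in>R. 3 * \<beta> i * sgn (y i))"
  define s where "s = 3 * \<beta> j * sgn (y j)"
  define pb pe where "pb = (\<Prod>i\<in>R. \<beta> i)" and "pe = (\<Prod>i\<in>R. 3 * \<beta> i)"
  define L where "L = (pb * (\<beta> j)\<^sup>2 + pe * (3 * \<beta> j)\<^sup>2) * C\<^sub>e\<^sup>2"
  \<comment> \<open>The first bound preserves the sign of \<open>y j\<close>; the second keeps both
    exponents within 1, as \<open>exp_minus_linear_bound\<close> requires. The summand 1 covers
    \<open>\<beta> j = 0\<close>.\<close>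
  define \<delta> where "\<delta> = min \<bar>y j\<bar> (1 / (3 * \<beta> j + 1))"
  have \<beta>j: "0 \<le> \<beta> j" by (rule \<beta>_nonneg)
  have p0: "0 \<le> pb" "0 \<le> pe" using \<beta>_nonneg by (auto simp: pb_def pe_def intro!: prod_nonneg)
  have \<delta>: "0 < \<delta>" using yj \<beta>j by (simp add: \<delta>_def)
  have "\<bar>B R (y(j := y j + t)) w v - B R y w v - t * B (insert j R) y w v\<bar> \<le> L * t\<^sup>2 * N y w * N y v"
    if t: "\<bar>t\<bar> < \<delta>" and V: "w \<in> Vh" "v \<in> Vh" for t w v
  proof -
    let ?Y = "y(j := y j + t)"
    have t1: "\<bar>t\<bar> < \<bar>y j\<bar>" using t by (simp add: \<delta>_def)
    have "\<bar>t\<bar> * (3 * \<beta> j) \<le> 1 / (3 * \<beta> j + 1) * (3 * \<beta> j + 1)"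
      using t \<beta>j by (intro mult_mono) (auto simp: \<delta>_def)
    also have "\<dots> = 1" using \<beta>j by simp
    finally have t2: "\<bar>t\<bar> * (3 * \<beta> j) \<le> 1" .
    define a1 where "a1 x = P x * exp (t * \<psi> j x) * A y x" for x
    define a2 where "a2 x = P x * A y x" for x
    define a3 where "a3 x = \<psi> j x * P x * A y x" for x
    have cP: "continuous_on (closure D) P" unfolding P_def[abs_def] by (rule prod_\<psi>_continuous)
    note cont = cP \<psi>_continuous A_continuous[OF y]
    have c: "continuous_on (closure D) a1" "continuous_on (closure D) a2" "continuous_on (closure D) a3"
      unfolding a1_def[abs_def] a2_def[abs_def] a3_def[abs_def] by (intro continuous_intros cont)+
    have "(\<Prod>i\<in>R. 3 * \<beta> i * sgn (?Y i)) = e"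
      unfolding e_def using R(2) by (intro prod.cong refl) auto
    moreover have "A ?Y x = exp (t * \<psi> j x) * A y x" if "x \<in> closure D" for x
      by (rule A_update[OF y that])
    moreover have "H ?Y = exp (t * s) * H y" unfolding s_def by (rule H_update[OF y t1])
    ultimately have B1: "B R ?Y w v = nipdg_form \<T> k a1 (e * exp (t * s) * H y) w v"
      unfolding B_def by (subst nipdg_form_cong[of _ a1]) (simp_all add: a1_def P_def mult.assoc)
    have B2: "B R y w v = nipdg_form \<T> k a2 (e * H y) w v"
      unfolding B_def a2_def P_def e_def ..
    have B3: "B (insert j R) y w v = nipdg_form \<T> k a3 (s * e * H y) w v"
      unfolding B_def a3_def[abs_def] P_def e_def s_def using R by simp
    define g where "g x = P x * (exp (t * \<psi> j x) - 1 - t * \<psi> j x)" for x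
    \<comment> \<open>The factors 1 and -1 give the expression the shape of two nested applications
      of \<open>nipdg_form_weights\<close>.\<close>
    have "B R ?Y w v - B R y w v - t * B (insert j R) y w v
      = nipdg_form \<T> k (\<lambda>x. 1 * (1 * a1 x + (-1) * a2 x) + (- t) * a3 x)
          (1 * (1 * (e * exp (t * s) * H y) + (-1) * (e * H y)) + (- t) * (s * e * H y)) w v"
      unfolding B1 B2 B3
      by (subst nipdg_form_weights nipdg_form_weights[OF c(1,2) V],
          (intro continuous_intros c V)+)+ simp
    also have "(\<lambda>x. 1 * (1 * a1 x + (-1) * a2 x) + (- t) * a3 x) = (\<lambda>x. g x * A y x)"
      by (simp add: fun_eq_iff a1_def a2_def a3_def g_def algebra_simps)
    also have "1 * (1 * (e * exp (t * s) * H y) + (-1) * (e * H y)) + (- t) * (s * e * H y)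
        = (e * (exp (t * s) - 1 - t * s)) * H y"
      by (simp add: algebra_simps)
    finally have eq: "B R ?Y w v - B R y w v - t * B (insert j R) y w v
      = nipdg_form \<T> k (\<lambda>x. g x * A y x) ((e * (exp (t * s) - 1 - t * s)) * H y) w v" .
    have gb: "\<bar>g x\<bar> \<le> pb * (\<beta> j * t)\<^sup>2" if x: "x \<in> closure D" for x
    proof -
      have 1: "\<bar>t * \<psi> j x\<bar> \<le> \<bar>\<beta> j * t\<bar>"
        using mult_left_mono[OF \<psi>_le[OF x, of j] abs_ge_zero[of t]] \<beta>j by (simp add: abs_mult mult.commute)
      also have "\<dots> \<le> 1" using t2 \<beta>j by (simp add: abs_mult mult.commute)
      finally have "\<bar>exp (t * \<psi> j x) - 1 - t * \<psi> j x\<bar> \<le> (t * \<psi> j x)\<^sup>2" by (rule exp_minus_linear_bound)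
      also have "\<dots> \<le> (\<beta> j * t)\<^sup>2" using 1 by (simp add: abs_le_square_iff)
      finally have "\<bar>exp (t * \<psi> j x) - 1 - t * \<psi> j x\<bar> \<le> (\<beta> j * t)\<^sup>2" .
      then show ?thesis unfolding g_def abs_mult
        using abs_prod_\<psi>_le[OF x, of R] p0 by (intro mult_mono) (auto simp: P_def pb_def)
    qed
    have eb: "\<bar>e * (exp (t * s) - 1 - t * s)\<bar> \<le> pe * (3 * \<beta> j * t)\<^sup>2"
    proof -
      have s: "\<bar>s\<bar> = 3 * \<beta> j" using yj \<beta>j by (simp add: s_def abs_mult abs_sgn_eq)
      then have "\<bar>t * s\<bar> \<le> 1" using t2 by (simp add: abs_mult)
      then have "\<bar>exp (t * s) - 1 - t * s\<bar> \<le> (t * s)\<^sup>2" by (rule exp_minus_linear_bound)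
      also have "\<dots> = (3 * \<beta> j * t)\<^sup>2"
        using s by (metis (no_types) mult.commute power2_abs power_mult_distrib)
      finally show ?thesis unfolding abs_mult
        using abs_prod_sgn_le[of y R] p0 by (intro mult_mono) (auto simp: e_def pe_def)
    qed
    have "continuous_on (closure D) g" unfolding g_def[abs_def] by (intro continuous_intros cont)
    from form_bound[OF y this gb eb V] show ?thesis
      unfolding eq by (simp add: L_def power_mult_distrib algebra_simps)
  qed
  with \<delta> show ?thesis by blast
qed

lemma B_empty: "B {} y = nipdg_form \<T> k (A y) (H y)"
  by (simp add: B_def fun_eq_iff)

sublocale par: parametric_form Vh U N B u "\<lambda>v. \<integral>x. f x * v x \<partial>lebesgue_on D" K basis_set
proof
  show "subspace Vh" by (rule subspace_dg_space)
  show "lin_on Vh (\<lambda>w. B R y w v)" if "y \<in> U" "v \<in> Vh" for R y v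
    unfolding B_def by (intro lin_on_nipdg_form_left weight_continuous that)
  show "lin_on Vh (B R y w)" if "y \<in> U" "w \<in> Vh" for R y w
    unfolding B_def[abs_def] by (intro lin_on_nipdg_form_right weight_continuous that)
  show "0 \<le> N y v" for y v by (rule N_nonneg)
  show "B {} y v v = (N y v)\<^sup>2" if y: "y \<in> U" for y v
    unfolding B_empty N_def by (rule nipdg_form_diag[OF A_continuous[OF y] A_nonneg[OF y] H_pos])
  show "\<bar>B R y w v\<bar> \<le> K R * N y w * N y v" if "y \<in> U" "w \<in> Vh" "v \<in> Vh" for R y w v
    unfolding B_def K_def using that
    by (intro form_bound prod_\<psi>_continuous abs_prod_\<psi>_le abs_prod_sgn_le)
  show "finite basis_set" "basis_set \<subseteq> Vh" by (rule basis_set)+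
  show "\<exists>w\<in>span basis_set. N y (v - w) = 0" if v: "v \<in> Vh" for y v
  proof -
    obtain w where w: "w \<in> span basis_set" "\<And>T. T \<in> \<T> \<Longrightarrow> poly_on k w T = poly_on k v T"
      using basis_set_spans[OF v] by blast
    have wV: "w \<in> Vh" using w(1) span_minimal[OF basis_set(2) subspace_dg_space] by blast
    have "poly_on k (1 *\<^sub>R v + (-1) *\<^sub>R w) T = (\<lambda>_. 0)" if "T \<in> \<T>" for T
      unfolding poly_on_lincomb[OF v wV that] w(2)[OF that] by simp
    then have "N y (v - w) = 0" unfolding N_def by (intro dg_norm_zero) simp
    with w(1) show ?thesis by blast
  qed
  show "y(j := t) \<in> U" if "y \<in> U" for y j t by (rule U_upd[OF that])
  show "\<exists>L \<delta>. 0 < \<delta> \<and> (\<forall>t w v. \<bar>t\<bar> < \<delta> \<longrightarrow> w \<in> Vh \<longrightarrow> v \<in> Vh \<longrightarrow>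
      \<bar>B R (y(j := y j + t)) w v - B R y w v - t * B (insert j R) y w v\<bar> \<le> L * t\<^sup>2 * N y w * N y v)"
    if "y \<in> U" "y j \<noteq> 0" "finite R" "j \<notin> R" for R y j
    by (rule B_remainder[OF that])
  show "u y \<in> Vh" if "y \<in> U" for y using dg_sol[OF that] by (simp add: dg_solution_def)
  show "B {} y (u y) v = (\<integral>x. f x * v x \<partial>lebesgue_on D)" if "y \<in> U" "v \<in> Vh" for y v
    using dg_sol[OF that(1)] that(2) by (simp add: dg_solution_def B_empty)
qed

text \<open>The square root of \<open>a_min\<close> in the final bound originates here. The estimate
  also turns smallness in the energy norm into the \<open>L2norm\<close> convergence demanded of
  difference quotients.\<close>

lemma L2norm_le_N:
  assumes y: "y \<in> U" and v: "v \<in> Vh"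
  shows "L2norm (lebesgue_on D) v \<le> \<sigma> / sqrt (a_min D a0 \<psi> y) * N y v"
proof -
  have "broken_norm \<T> k v \<le> N y v / sqrt (a_min D a0 \<psi> y)"
    unfolding N_def
    by (rule broken_norm_bound[OF A_continuous[OF y] A_nonneg[OF y] H_pos a_min_pos A_ge[OF y] H_ge[OF y] v])
  then have "\<sigma> * broken_norm \<T> k v \<le> \<sigma> * (N y v / sqrt (a_min D a0 \<psi> y))"
    using \<sigma>(1) by (intro mult_left_mono) auto
  then show ?thesis using \<sigma>(2)[OF v] by simp
qed

lemma solution_bound:
  assumes y: "y \<in> U"
  shows "N y (u y) \<le> \<sigma> / sqrt (a_min D a0 \<psi> y) * L2norm (lebesgue_on D) f"
proof -
  have uV: "u y \<in> Vh" by (rule par.u(1)[OF y])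
  let ?f = "L2norm (lebesgue_on D) f" and ?c = "\<sigma> / sqrt (a_min D a0 \<psi> y)"
  have f0: "0 \<le> ?f" by (simp add: L2norm_def)
  have "(N y (u y))\<^sup>2 = (\<integral>x. f x * u y x \<partial>lebesgue_on D)"
    using par.coercive[OF y uV] par.u(2)[OF y uV] by simp
  also have "\<dots> \<le> ?f * L2norm (lebesgue_on D) (u y)"
    using L2norm_Cauchy_Schwarz[OF f, of "u y"] uV by (simp add: dg_space_def)
  also have "\<dots> \<le> ?f * (?c * N y (u y))"
    by (rule mult_left_mono[OF L2norm_le_N[OF y uV] f0])
  finally have "N y (u y) * N y (u y) \<le> (?c * ?f) * N y (u y)" by (simp add: power2_eq_square mult_ac)
  moreover have "0 \<le> ?c * ?f" using f0 \<sigma>(1) a_min_pos[of y] by simp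
  ultimately show ?thesis
    using N_nonneg[of y "u y"] mult_le_cancel_right_pos[of "N y (u y)" "N y (u y)" "?c * ?f"]
    by (cases "N y (u y) = 0") auto
qed

text \<open>The abstract estimate asks for a constant at least 1, whereas \<open>C\<^sub>e\<close>
  is only positive; hence the two cases.\<close>

lemma sol_bound:
  assumes y: "y \<in> U" and S: "finite S"
  shows "N y (par.sol y S) \<le> (C\<^sub>e\<^sup>2) ^ card S * (\<Prod>j\<in>S. 4 * \<beta> j) * (fact (card S) / ln 2 ^ card S)
    * (\<sigma> / sqrt (a_min D a0 \<psi> y) * L2norm (lebesgue_on D) f)"
proof (cases "1 \<le> C\<^sub>e")
  case True
  show ?thesis
  proof (rule par.sol_bound[OF y S _ \<beta>_nonneg _ solution_bound[OF y]])
    show "1 \<le> C\<^sub>e\<^sup>2" using True by simp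
    show "K R \<le> C\<^sub>e\<^sup>2 * (\<Prod>j\<in>R. 4 * \<beta> j)" if R: "finite R" "R \<noteq> {}" for R
    proof -
      have n: "0 < card R" using R by (simp add: card_gt_0_iff)
      then obtain m where m: "card R = Suc m" by (cases "card R") auto
      \<comment> \<open>Of the four copies of \<open>4 ^ m\<close> in \<open>4 ^ Suc m\<close>, one
        dominates 1 and three dominate \<open>3 * 3 ^ m\<close>.\<close>
      have "(1::real) \<le> 4 ^ m" by simp
      moreover have "(3::real) ^ m \<le> 4 ^ m" by (rule power_mono) auto
      ultimately have "1 + 3 ^ card R \<le> (4::real) ^ card R" unfolding m power_Suc by linarith
      then have "(1 + 3 ^ card R) * (\<Prod>j\<in>R. \<beta> j) \<le> 4 ^ card R * (\<Prod>j\<in>R. \<beta> j)"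
        using \<beta>_nonneg by (intro mult_right_mono prod_nonneg) auto
      then have "(\<Prod>j\<in>R. \<beta> j) + (\<Prod>j\<in>R. 3 * \<beta> j) \<le> (\<Prod>j\<in>R. 4 * \<beta> j)"
        by (simp add: prod.distrib distrib_right)
      then show ?thesis unfolding K_def by (simp add: mult.commute mult_left_mono)
    qed
  qed
next
  case False
  have v: "par.sol y S \<in> Vh" by (rule par.sol_in[OF y S])
  let ?n = "N y (par.sol y S)"
  \<comment> \<open>The starred norm dominates the norm, so an equivalence constant below 1 forces
    the norm to vanish.\<close>
  have "?n \<le> C\<^sub>e * ?n"
    using dg_norm_le_star[OF A_continuous[OF y] A_nonneg[OF y] H_pos] C\<^sub>e(2)[OF y v]
    unfolding N_def by (rule order_trans)
  then have "(1 - C\<^sub>e) * ?n \<le> 0" by (simp add: left_diff_distrib)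
  then have "?n \<le> 0" using False by (simp add: mult_le_0_iff)
  also have "0 \<le> (C\<^sub>e\<^sup>2) ^ card S * (\<Prod>j\<in>S. 4 * \<beta> j) * (fact (card S) / ln 2 ^ card S)
    * (\<sigma> / sqrt (a_min D a0 \<psi> y) * L2norm (lebesgue_on D) f)"
    using \<sigma>(1) \<beta>_nonneg a_min_pos[of y]
    by (intro mult_nonneg_nonneg prod_nonneg divide_nonneg_nonneg) (auto simp: L2norm_def)
  finally show ?thesis .
qed

text \<open>The point \<open>y\<close> is generalised in the induction because a derivative must be
  available along a line through \<open>y\<close> before it can be differentiated again.\<close>

lemma sol_iter_partial:
  assumes "y \<in> U" "distinct js" "\<forall>j\<in>set js. y j \<noteq> 0"
  shows "iter_partial D Vh u js y (par.sol y (set js))"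
  using assms
proof (induction js arbitrary: y)
  case Nil
  then show ?case using par.u(1) by simp
next
  case (Cons j js)
  let ?S = "set js" and ?w = "par.sol y (set (j # js))"
  define g where "g t = par.sol (y(j := y j + t)) ?S" for t
  have y: "y \<in> U" and j: "j \<notin> ?S" "y j \<noteq> 0" using Cons.prems by auto
  have wV: "?w \<in> Vh" by (intro par.sol_in y) auto
  have gV: "g t \<in> Vh" for t unfolding g_def by (intro par.sol_in U_upd y) auto
  \<comment> \<open>This holds for every \<open>t\<close>, even where \<open>y j + t = 0\<close>:
    the directions in \<open>js\<close> differ from \<open>j\<close>, so their coordinates are
    unchanged.\<close>
  have "iter_partial D Vh u js (y(j := y j + t)) (g t)" for t
    unfolding g_def using Cons.prems by (intro Cons.IH U_upd) auto
  then have "\<forall>\<^sub>F t in nhds 0. iter_partial D Vh u js (y(j := y j + t)) (g t)" by simp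
  moreover have "((\<lambda>t. L2norm (lebesgue_on D) (\<lambda>x. (g t x - g 0 x) / t - ?w x)) \<longlongrightarrow> 0) (at 0)"
  proof -
    let ?c = "\<sigma> / sqrt (a_min D a0 \<psi> y)"
    have c: "0 \<le> ?c" using \<sigma>(1) a_min_pos[of y] by simp
    obtain L \<delta> where \<delta>: "0 < \<delta>" and L: "\<And>t. \<bar>t\<bar> < \<delta> \<Longrightarrow> N y (g t - g 0 - t *\<^sub>R ?w) \<le> L * t\<^sup>2"
      using par.sol_differentiable[OF y j(2) _ j(1)] unfolding g_def by auto
    have bound: "L2norm (lebesgue_on D) (\<lambda>x. (g t x - g 0 x) / t - ?w x) \<le> ?c * L * \<bar>t\<bar>"
      if t: "\<bar>t\<bar> < \<delta>" "t \<noteq> 0" for t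
    proof -
      let ?z = "g t - g 0 - t *\<^sub>R ?w"
      have zV: "?z \<in> Vh"
        by (intro subspace_diff[OF subspace_dg_space] subspace_scale[OF subspace_dg_space] gV wV)
      then have zV': "(1 / t) *\<^sub>R ?z \<in> Vh" by (rule subspace_scale[OF subspace_dg_space])
      have "(\<lambda>x. (g t x - g 0 x) / t - ?w x) = (1 / t) *\<^sub>R ?z"
        using t(2) by (simp add: fun_eq_iff field_simps)
      then have "L2norm (lebesgue_on D) (\<lambda>x. (g t x - g 0 x) / t - ?w x) \<le> ?c * (\<bar>1 / t\<bar> * N y ?z)"
        using L2norm_le_N[OF y zV'] par.N_scale[OF y zV, of "1 / t"] by (simp only:)
      also have "\<dots> \<le> ?c * (\<bar>1 / t\<bar> * (L * t\<^sup>2))"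
        using L[OF t(1)] c by (intro mult_left_mono) auto
      also have "\<dots> = ?c * L * \<bar>t\<bar>"
        using t(2) by (simp add: field_simps power2_eq_square abs_if)
      finally show ?thesis .
    qed
    show ?thesis
    proof (rule tendsto_sandwich[of "\<lambda>_. 0" _ _ "\<lambda>t. ?c * L * \<bar>t\<bar>"])
      show "\<forall>\<^sub>F t in at 0. L2norm (lebesgue_on D) (\<lambda>x. (g t x - g 0 x) / t - ?w x) \<le> ?c * L * \<bar>t\<bar>"
        unfolding eventually_at using \<delta> bound by (auto simp: dist_real_def)
      have "((\<lambda>t. ?c * L * \<bar>t\<bar>) \<longlongrightarrow> ?c * L * \<bar>0\<bar>) (at 0)" by (intro tendsto_intros)
      then show "((\<lambda>t. ?c * L * \<bar>t\<bar>) \<longlongrightarrow> 0) (at 0)" by simp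
    qed (auto simp: L2norm_def)
  qed
  ultimately show ?case using wV by auto
qed

end

section \<open>Vanishing coordinates, and multi-indices with entries at most one\<close>

lemma AE_gauss_nonzero:
  assumes "finite S"
  shows "AE y in gauss_measure. \<forall>j\<in>S. y j \<noteq> 0"
proof (rule AE_finite_allI[OF assms])
  fix j
  have "AE t in density lborel (\<lambda>t. ennreal (std_normal_density t)). t \<noteq> 0"
    by (subst AE_density) (use AE_lborel_singleton[of "0::real"] in auto)
  then show "AE y in gauss_measure. y j \<noteq> 0"
    unfolding gauss_measure_def
    by (intro AE_PiM_component) (auto intro: prob_space_normal_density)
qed

text \<open>Such a multi-index is the indicator function of its support, and a list with these
  counts enumerates the support without repetition.\<close>

lemma
  assumes "\<nu> \<in> multi_indices" "mi_sup \<nu> \<le> 1"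
  shows mi_abs_01: "mi_abs \<nu> = card (supp \<nu>)"
    and mi_power_01: "mi_power b \<nu> = (\<Prod>j\<in>supp \<nu>. b j)"
    and count_list_01: "(\<And>j. count_list js j = \<nu> j) \<Longrightarrow> distinct js \<and> set js = supp \<nu>"
proof -
  have "\<nu> ` UNIV \<subseteq> insert 0 (\<nu> ` supp \<nu>)" by (auto simp: supp_def)
  moreover have "finite (supp \<nu>)" using assms(1) by (simp add: multi_indices_def)
  \<comment> \<open>A supremum in \<open>nat\<close> bounds the entries once their range is known to
    be bounded, which finite support guarantees.\<close>
  ultimately have "finite (range \<nu>)" by (meson finite_imageI finite_insert finite_subset)
  then have "\<nu> j \<le> mi_sup \<nu>" for j unfolding mi_sup_def by (intro cSUP_upper) auto
  then have le: "\<nu> j \<le> 1" for j using assms(2) order_trans by blast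
  have one: "\<nu> j = 1" if "j \<in> supp \<nu>" for j
  proof -
    from that have "\<nu> j \<noteq> 0" by (simp add: supp_def)
    with le[of j] show ?thesis by linarith
  qed
  show "mi_abs \<nu> = card (supp \<nu>)" "mi_power b \<nu> = (\<Prod>j\<in>supp \<nu>. b j)"
    using one by (simp_all add: mi_abs_def mi_power_def)
  have dist: "distinct xs" if "\<And>j. count_list xs j \<le> 1" for xs :: "nat list"
    using that
  proof (induction xs)
    case (Cons x xs)
    have "count_list xs j \<le> 1" for j using Cons.prems[of j] by (auto split: if_splits)
    moreover have "x \<notin> set xs" using Cons.prems[of x] by (simp add: count_list_0_iff)
    ultimately show ?case using Cons.IH by simp
  qed simp
  assume js: "\<And>j. count_list js j = \<nu> j"
  have "set js = {j. count_list js j \<noteq> 0}" by (auto simp: count_list_0_iff)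
  then show "distinct js \<and> set js = supp \<nu>" using js le dist by (simp add: supp_def)
qed

theorem corollary6p4:
  fixes D :: "(real^'d::finite) set"
    and a0 f :: "real^'d \<Rightarrow> real"
    and \<psi> :: "nat \<Rightarrow> real^'d \<Rightarrow> real"
    and p C\<^sub>e \<sigma> \<alpha> C\<^sub>D\<^sub>G :: real
    and \<T> :: "nat \<Rightarrow> (real^'d) set set"
    and k :: nat
    and u :: "nat \<Rightarrow> (nat \<Rightarrow> real) \<Rightarrow> real^'d \<Rightarrow> real"
  assumes dim: "CARD('d) \<in> {1, 2, 3}"
    and f: "f \<in> L2 (lebesgue_on D)"
    and L1: "a0 \<in> Linf D" "\<And>j. \<psi> j \<in> Linf D" "summable (\<lambda>j. Linf_norm D (\<psi> j))"
    and L2: "0 < min_cl D a0" "bdd_above (a0 ` closure D)"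
    and L3: "0 < p" "p < 1" "summable (\<lambda>j. Linf_norm D (\<psi> j) powr p)"
    and L4: "a0 \<in> W1inf D" "\<And>j. \<psi> j \<in> W1inf D" "summable (\<lambda>j. W1inf_norm D (\<psi> j))"
    and L5: "convex_polyhedral_domain D"
    and mesh: "regular_mesh_sequence D \<T>"
    and k: "1 \<le> k"
    and u: "\<And>m y. y \<in> U_beta (beta D \<psi>) \<Longrightarrow>
      dg_solution D (\<T> m) k (lognormal_coeff a0 \<psi> y) (penalty D a0 \<psi> y) f (u m y)"
    and C\<^sub>e: "0 < C\<^sub>e"
      "\<And>m y v. y \<in> U_beta (beta D \<psi>) \<Longrightarrow> v \<in> dg_space D (\<T> m) k \<Longrightarrow>
        dg_norm_star (\<T> m) k (lognormal_coeff a0 \<psi> y) (penalty D a0 \<psi> y) v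
          \<le> C\<^sub>e * dg_norm (\<T> m) k (lognormal_coeff a0 \<psi> y) (penalty D a0 \<psi> y) v"
    and C\<^sub>D\<^sub>G: "C\<^sub>D\<^sub>G = C\<^sub>e\<^sup>2"
    and \<sigma>: "0 < \<sigma>"
      "\<And>m v. v \<in> dg_space D (\<T> m) k \<Longrightarrow>
        L2norm (lebesgue_on D) v \<le> \<sigma> * broken_norm (\<T> m) k v"
    and \<alpha>: "\<alpha> = 1"
  shows "\<forall>m. \<forall>\<nu>\<in>multi_indices. 0 \<noteq> mi_sup \<nu> \<and> mi_sup \<nu> \<le> 1 \<longrightarrow>
    (AE y in gauss_measure. y \<in> U_beta (beta D \<psi>) \<longrightarrow>
      (\<exists>w. mixed_partial D (dg_space D (\<T> m) k) (u m) \<nu> y w \<and>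
        dg_norm (\<T> m) k (lognormal_coeff a0 \<psi> y) (penalty D a0 \<psi> y) w
          \<le> C\<^sub>D\<^sub>G ^ mi_abs \<nu> * 4 ^ mi_abs \<nu> * (fact (mi_abs \<nu>) / (ln 2) ^ mi_abs \<nu>)
            * mi_power (beta D \<psi>) \<nu> * (\<sigma> / (\<alpha> * a_min D a0 \<psi> y powr (1/2)))
            * L2norm (lebesgue_on D) f))"
proof (intro allI ballI impI)
  fix m \<nu>
  assume \<nu>: "\<nu> \<in> multi_indices" "0 \<noteq> mi_sup \<nu> \<and> mi_sup \<nu> \<le> 1"
  have "polyhedral_mesh D (\<T> m)" using mesh unfolding regular_mesh_sequence_def by blast
  then interpret lognormal_dg D a0 \<psi> "\<T> m" k f "u m" C\<^sub>e \<sigma>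
    using L5 L4(1,2) L2 f u C\<^sub>e \<sigma> by unfold_locales auto
  let ?S = "supp \<nu>"
  have S: "finite ?S" using \<nu>(1) by (simp add: multi_indices_def)
  note abs_eq = mi_abs_01[OF \<nu>(1) conjunct2[OF \<nu>(2)]] and pow_eq = mi_power_01[OF \<nu>(1) conjunct2[OF \<nu>(2)]]
  show "AE y in gauss_measure. y \<in> U_beta (beta D \<psi>) \<longrightarrow>
      (\<exists>w. mixed_partial D (dg_space D (\<T> m) k) (u m) \<nu> y w \<and>
        dg_norm (\<T> m) k (lognormal_coeff a0 \<psi> y) (penalty D a0 \<psi> y) w
          \<le> C\<^sub>D\<^sub>G ^ mi_abs \<nu> * 4 ^ mi_abs \<nu> * (fact (mi_abs \<nu>) / (ln 2) ^ mi_abs \<nu>)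
            * mi_power (beta D \<psi>) \<nu> * (\<sigma> / (\<alpha> * a_min D a0 \<psi> y powr (1/2)))
            * L2norm (lebesgue_on D) f)"
    using AE_gauss_nonzero[OF S]
  proof (eventually_elim, intro impI exI[of _ "par.sol _ ?S"] conjI)
    fix y assume nz: "\<forall>j\<in>?S. y j \<noteq> 0" and y: "y \<in> U_beta (beta D \<psi>)"
    show "mixed_partial D (dg_space D (\<T> m) k) (u m) \<nu> y (par.sol y ?S)"
      unfolding mixed_partial_def
    proof (intro allI impI)
      \<comment> \<open>\<open>par.sol\<close> sees only \<open>set js\<close>, so one witness
        serves every order of differentiation.\<close>
      fix js assume "\<forall>j. count_list js j = \<nu> j"
      then have "distinct js" "set js = ?S"
        using count_list_01[OF \<nu>(1) conjunct2[OF \<nu>(2)], of js] by auto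
      then show "iter_partial D (dg_space D (\<T> m) k) (u m) js y (par.sol y ?S)"
        using sol_iter_partial[OF y, of js] nz by simp
    qed
    show "dg_norm (\<T> m) k (lognormal_coeff a0 \<psi> y) (penalty D a0 \<psi> y) (par.sol y ?S)
          \<le> C\<^sub>D\<^sub>G ^ mi_abs \<nu> * 4 ^ mi_abs \<nu> * (fact (mi_abs \<nu>) / (ln 2) ^ mi_abs \<nu>)
            * mi_power (beta D \<psi>) \<nu> * (\<sigma> / (\<alpha> * a_min D a0 \<psi> y powr (1/2)))
            * L2norm (lebesgue_on D) f"
      \<comment> \<open>The powers of 4 are split off the product over the support, and the power
        1/2 of \<open>a_min\<close> is its square root.\<close>
      using sol_bound[OF y S] a_min_pos[of y]
      unfolding N_def abs_eq pow_eq C\<^sub>D\<^sub>G \<alpha>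
      by (simp add: prod.distrib powr_half_sqrt mult_ac)
  qed
qed

end
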